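(* Suppose that: (1) the graph $\mathcal G$ is connected; (2) $\mathbb X^*\neq\emptyset$ and $f^*>-\infty$; (3) for every $i\in[n]$ and almost all $\xi_i$, $F_i(\cdot,\xi_i)$ is differentiable with $L_f$-Lipschitz gradient, $L_f>0$; (4) $\mathbf E_{\xi_i}[\|\nabla_xF_i(x,\xi_i)-\nabla f_i(x)\|^2]\le\sigma_0^2\|\nabla f_i(x)\|^2+\sigma_1^2$ for all $i\in[n]$, $x\in\mathbb R^p$; (5) $\|\nabla f_i(x)-\nabla f(x)\|^2\le\tilde\sigma_0^2\|\nabla f(x)\|^2+\sigma_2^2$ for all $i\in[n]$, $x\in\mathbb R^p$. Let $\{x_{i,k}\}$ be the sequence generated by Algorithm 2 with $$\gamma\in(0,d_1),\quad\eta_k=\eta,\quad 0<\delta_{i,k}\le\kappa_\delta\tilde\epsilon^k,\quad\forall k\in\mathbb N_0,$$ where $\eta\in(0,d_2(\gamma)]$, $\tilde\epsilon\in(0,1)$ and $\kappa_\delta>0$. Then, for any $T\in\mathbb N_+$, with $\bar x_k=\frac1n\sum_{i=1}^nx_{i,k}$, $$\frac1T\sum_{k=0}^{T-1}\mathbf E\Big[\frac1n\sum_{i=1}^n\|x_{i,k}-\bar x_k\|^2\Big]=\mathcal O\Big(\frac1T+(\sigma_1^2+2(1+\sigma_0^2)\sigma_2^2)p\eta^2\Big),$$ $$\mathbf E\Big[\frac1n\sum_{i=1}^n\|x_{i,T}-\bar x_T\|^2\Big]=\mathcal O\Big(p\eta^2+(\sigma_1^2+2(1+\sigma_0^2)\sigma_2^2)p^2\eta^4\Big(\frac1n+\eta\Big)T\Big),$$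 $$\frac1T\sum_{k=0}^{T-1}\mathbf E[\|\nabla f(\bar x_k)\|^2]=\mathcal O\Big(\frac1{\eta T}+(\sigma_1^2+2(1+\sigma_0^2)\sigma_2^2)\Big(\frac{p\eta}n+p\eta^2\Big)\Big).$$ Moreover, if in addition $f$ satisfies the Polyak–Łojasiewicz condition with constant $\nu>0$, i.e. $\frac12\|\nabla f(x)\|^2\ge\nu(f(x)-f^* )$ for all $x\in\mathbb R^p$, then $$\mathbf E\Big[\frac1n\sum_{i=1}^n\|x_{i,k}-\bar x_k\|^2+f(\bar x_k)-f^*\Big]=\mathcal O(\epsilon^k+(\sigma_1^2+2(1+\sigma_0^2)\sigma_2^2)p\eta),\quad\forall k\in\mathbb N_+,$$ where $\epsilon=\frac12+\frac12\max\{1-\tilde\epsilon_8,\tilde\epsilon^2\}\in(0,1)$.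
   Context: Problem: $n$ agents, $[n]=\{1,\dots,n\}$. For each $i\in[n]$, $\xi_i$ is a random variable and $F_i(\cdot,\xi_i):\mathbb R^p\to\mathbb R$ a stochastic function (not necessarily convex); $f_i(x)=\mathbf E_{\xi_i}[F_i(x,\xi_i)]$, $f(x)=\frac1n\sum_{i=1}^nf_i(x)$, $f^*=\min_{x\in\mathbb R^p}f(x)$, $\mathbb X^*$ is the set of minimizers of $f$. Network: $\mathcal G=([n],\mathcal E)$ is an undirected graph with symmetric weights $a_{ij}>0$ if $(i,j)\in\mathcal E$, $a_{ij}=0$ otherwise, $a_{ii}=0$; $L=(L_{ij})$ is the weighted Laplacian, $L=\mathrm{diag}(\sum_ja_{1j},\dots,\sum_ja_{nj})-(a_{ij})$. $\rho(\cdot)$ is the spectral radius and $\rho_2(L)$ the minimum positive eigenvalue of $L$. $\|\cdot\|$ is the Euclidean norm. $\mathbb N_+$: positive integers; $\mathbb N_0$: nonnegative integers. Algorithm 2 (distributed zeroth-order primal algorithm): given a constant $\gamma>0$, positive sequences $\{\eta_k\},\{\delta_{i,k}\}$ and initial points $x_{i,0}\in\mathbb R^p$, at each iteration $k$ each agent $i$ draws $u_{i,k}$ uniformly from the unit sphere $\mathbb S^p$ of $\mathbb R^p$ and $\xi_{i,k}$ from the distribution of $\xi_i$ (all $u_{i,k},\xi_{j,l}$ mutually independent), sets $$g^e_{i,k}=\frac{p\,(F_i(x_{i,k}+\delta_{i,k}u_{i,k},\xi_{i,k})-F_i(x_{i,k},\xi_{i,k}))}{\delta_{i,k}}u_{i,k},$$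 and updates $x_{i,k+1}=x_{i,k}-\gamma\sum_{j=1}^nL_{ij}x_{j,k}-\eta_kg^e_{i,k}$. Constants: $d_1=\frac{\rho_2(L)}{2\rho(L^2)}$, $\epsilon_1=\frac12\gamma\rho_2(L)-\gamma^2\rho(L^2)$, $\epsilon_2=\frac{1+2\gamma\rho_2(L)}{2\gamma\rho_2(L)}$, $d_2(\gamma)=\min\{\frac{4\epsilon_1}{9L_f^2},\ \frac1{64p(1+\sigma_0^2)(1+\tilde\sigma_0^2)(2\epsilon_2+L_f)}\}$, $\tilde\epsilon_8=\min\{\epsilon_1,\frac{\nu\eta}4\}$. Convention for $\mathcal O(\cdot)$: the hidden constants do not depend on $T$, $k$, $n$, $p$ or $\eta$; they may depend on the other quantities, regarded as fixed: $L_f,\sigma_0,\sigma_1,\tilde\sigma_0,\sigma_2,\nu$, $\rho(L),\rho_2(L)$, the parameters $\gamma,\kappa_\delta,\tilde\epsilon$, and bounds on the normalized initial data $\frac1n\sum_i\|x_{i,0}-\bar x_0\|^2$, $f(\bar x_0)-f^*$.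
   Formalization: The second bound (consensus error at the last iterate T) is proved only for T ≥ C ln(1/(pη²)), with C uniform like the hidden constant; for every T it is false: with F_i = 0, n = 2 and unequal initial points, at T = 1 the left side stays positive while the right side tends to 0 as η → 0. *)

theory Defs
  imports "HOL-Probability.Probability" "Jordan_Normal_Form.Spectral_Radius"
begin

text \<open>
  The dimension \<open>p\<close> and the number of agents \<open>n\<close> have to be bound inside formulas (constants must
  not depend on them), so \<open>\<real>\<^sup>p\<close> is not a type here.  Its points are the elements of the space of the
  product measure over the index set \<open>{..<p}\<close>, i.e. functions \<open>nat \<Rightarrow> real\<close> that are
  \<open>undefined\<close> outside \<open>{..<p}\<close>; this is why vectors below are built with \<open>\<lambda>j\<in>{..<p}. _\<close>.
  Agents are numbered \<open>0, \<dots>, n - 1\<close>.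
\<close>

type_synonym rvec = "nat \<Rightarrow> real"

definition lborel_vec :: "nat \<Rightarrow> rvec measure" where
  "lborel_vec p = (\<Pi>\<^sub>M j\<in>{..<p}. lborel)"

definition Rn :: "nat \<Rightarrow> rvec set" where
  "Rn p = space (lborel_vec p)"

definition vnorm :: "nat \<Rightarrow> rvec \<Rightarrow> real" where
  "vnorm p x = L2_set x {..<p}"

definition vdiff :: "nat \<Rightarrow> rvec \<Rightarrow> rvec \<Rightarrow> rvec" where
  "vdiff p x y = (\<lambda>j\<in>{..<p}. x j - y j)"

text \<open>Frechet differentiability in the Euclidean norm, with gradient \<open>g\<close>.\<close>

definition is_grad :: "nat \<Rightarrow> (rvec \<Rightarrow> real) \<Rightarrow> rvec \<Rightarrow> rvec \<Rightarrow> bool" where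
  "is_grad p h x g \<longleftrightarrow> g \<in> Rn p \<and>
     (\<forall>e>0. \<exists>d>0. \<forall>y\<in>Rn p. vnorm p (vdiff p y x) < d \<longrightarrow>
        \<bar>h y - h x - (\<Sum>j<p. g j * (y j - x j))\<bar> \<le> e * vnorm p (vdiff p y x))"

definition grad :: "nat \<Rightarrow> (rvec \<Rightarrow> real) \<Rightarrow> rvec \<Rightarrow> rvec" where
  "grad p h x = (THE g. is_grad p h x g)"

definition lipschitz_grad :: "nat \<Rightarrow> real \<Rightarrow> (rvec \<Rightarrow> real) \<Rightarrow> bool" where
  "lipschitz_grad p Lf h \<longleftrightarrow>
     (\<forall>x\<in>Rn p. \<exists>g. is_grad p h x g) \<and>
     (\<forall>x\<in>Rn p. \<forall>y\<in>Rn p.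
        vnorm p (vdiff p (grad p h x) (grad p h y)) \<le> Lf * vnorm p (vdiff p x y))"

text \<open>
  The uniform distribution on the unit sphere: the radial projection of the uniform distribution
  on the unit ball.
\<close>

definition uniform_sphere :: "nat \<Rightarrow> rvec measure" where
  "uniform_sphere p =
     distr (uniform_measure (lborel_vec p) {x \<in> Rn p. vnorm p x \<le> 1}) (lborel_vec p)
       (\<lambda>x. \<lambda>j\<in>{..<p}. x j / vnorm p x)"

definition weighted_graph :: "nat \<Rightarrow> (nat \<times> nat) set \<Rightarrow> (nat \<Rightarrow> nat \<Rightarrow> real) \<Rightarrow> bool" where
  "weighted_graph n E a \<longleftrightarrow>
     E \<subseteq> {..<n} \<times> {..<n} \<and> sym E \<and>
     (\<forall>i<n. \<forall>j<n. a i j = a j i \<and> ((i, j) \<in> E \<longrightarrow> a i j > 0) \<and> ((i, j) \<notin> E \<longrightarrow> a i j = 0)) \<and>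
     (\<forall>i<n. a i i = 0)"

definition connected_graph :: "nat \<Rightarrow> (nat \<times> nat) set \<Rightarrow> bool" where
  "connected_graph n E \<longleftrightarrow> (\<forall>i<n. \<forall>j<n. (i, j) \<in> E\<^sup>*)"

definition laplacian :: "nat \<Rightarrow> (nat \<Rightarrow> nat \<Rightarrow> real) \<Rightarrow> real mat" where
  "laplacian n a = Matrix.mat n n (\<lambda>(i, j). (if i = j then \<Sum>m<n. a i m else 0) - a i j)"

definition rho :: "real mat \<Rightarrow> real" where
  "rho A = spectral_radius (map_mat complex_of_real A)"

text \<open>For \<open>n = 1\<close> the Laplacian is zero and has no positive eigenvalue; there \<open>const_d1\<close> is
  \<open>_ / 0 = 0\<close>, so that no step size \<open>\<gamma>\<close> is admissible.\<close>

definition rho2 :: "real mat \<Rightarrow> real" where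
  "rho2 A = Min {l \<in> spectrum A. l > 0}"

definition const_d1 :: "real mat \<Rightarrow> real" where
  "const_d1 L = rho2 L / (2 * rho (L * L))"

definition eps1 :: "real \<Rightarrow> real mat \<Rightarrow> real" where
  "eps1 \<gamma> L = \<gamma> * rho2 L / 2 - \<gamma>\<^sup>2 * rho (L * L)"

definition eps2 :: "real \<Rightarrow> real mat \<Rightarrow> real" where
  "eps2 \<gamma> L = (1 + 2 * \<gamma> * rho2 L) / (2 * \<gamma> * rho2 L)"

definition const_d2 :: "real \<Rightarrow> real mat \<Rightarrow> nat \<Rightarrow> real \<Rightarrow> real \<Rightarrow> real \<Rightarrow> real" where
  "const_d2 \<gamma> L p Lf \<sigma>\<^sub>0 \<sigma>t\<^sub>0 =
     min (4 * eps1 \<gamma> L / (9 * Lf\<^sup>2))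
         (1 / (64 * real p * (1 + \<sigma>\<^sub>0\<^sup>2) * (1 + \<sigma>t\<^sub>0\<^sup>2) * (2 * eps2 \<gamma> L + Lf)))"

definition eps8 :: "real \<Rightarrow> real mat \<Rightarrow> real \<Rightarrow> real \<Rightarrow> real" where
  "eps8 \<gamma> L \<nu> \<eta> = min (eps1 \<gamma> L) (\<nu> * \<eta> / 4)"

definition rate :: "real \<Rightarrow> real mat \<Rightarrow> real \<Rightarrow> real \<Rightarrow> real \<Rightarrow> real" where
  "rate \<gamma> L \<nu> \<eta> \<epsilon>t = 1/2 + 1/2 * max (1 - eps8 \<gamma> L \<nu> \<eta>) (\<epsilon>t\<^sup>2)"

text \<open>\<open>\<Xi> i\<close> is the distribution of \<open>\<xi>\<^sub>i\<close>.\<close>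

definition stochastic_costs ::
  "nat \<Rightarrow> nat \<Rightarrow> (nat \<Rightarrow> 'b measure) \<Rightarrow> (nat \<Rightarrow> rvec \<Rightarrow> 'b \<Rightarrow> real) \<Rightarrow> bool" where
  "stochastic_costs n p \<Xi> F \<longleftrightarrow>
     (\<forall>i<n. prob_space (\<Xi> i) \<and>
        (\<lambda>(x, z). F i x z) \<in> borel_measurable (lborel_vec p \<Otimes>\<^sub>M \<Xi> i) \<and>
        (\<forall>x\<in>Rn p. integrable (\<Xi> i) (F i x)))"

definition local_cost ::
  "(nat \<Rightarrow> 'b measure) \<Rightarrow> (nat \<Rightarrow> rvec \<Rightarrow> 'b \<Rightarrow> real) \<Rightarrow> nat \<Rightarrow> rvec \<Rightarrow> real" where
  "local_cost \<Xi> F i x = (\<integral>z. F i x z \<partial>\<Xi> i)"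

definition global_cost ::
  "nat \<Rightarrow> (nat \<Rightarrow> 'b measure) \<Rightarrow> (nat \<Rightarrow> rvec \<Rightarrow> 'b \<Rightarrow> real) \<Rightarrow> rvec \<Rightarrow> real" where
  "global_cost n \<Xi> F x = (\<Sum>i<n. local_cost \<Xi> F i x) / real n"

definition minimizers :: "nat \<Rightarrow> (rvec \<Rightarrow> real) \<Rightarrow> rvec set" where
  "minimizers p f = {x \<in> Rn p. \<forall>y\<in>Rn p. f x \<le> f y}"

definition min_value :: "nat \<Rightarrow> (rvec \<Rightarrow> real) \<Rightarrow> real" where
  "min_value p f = (INF x\<in>Rn p. f x)"

text \<open>Stated with the nonnegative integral, so that the second moment is finite by hypothesis.\<close>

definition gradient_noise ::
  "nat \<Rightarrow> nat \<Rightarrow> (nat \<Rightarrow> 'b measure) \<Rightarrow> (nat \<Rightarrow> rvec \<Rightarrow> 'b \<Rightarrow> real) \<Rightarrow> real \<Rightarrow> real \<Rightarrow> bool" where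
  "gradient_noise n p \<Xi> F \<sigma>\<^sub>0 \<sigma>\<^sub>1 \<longleftrightarrow>
     (\<forall>i<n. \<forall>x\<in>Rn p.
        (\<integral>\<^sup>+z. ennreal ((vnorm p (vdiff p (grad p (\<lambda>y. F i y z) x)
                                   (grad p (local_cost \<Xi> F i) x)))\<^sup>2) \<partial>\<Xi> i)
        \<le> ennreal (\<sigma>\<^sub>0\<^sup>2 * (vnorm p (grad p (local_cost \<Xi> F i) x))\<^sup>2 + \<sigma>\<^sub>1\<^sup>2))"

definition gradient_dissimilarity ::
  "nat \<Rightarrow> nat \<Rightarrow> (nat \<Rightarrow> 'b measure) \<Rightarrow> (nat \<Rightarrow> rvec \<Rightarrow> 'b \<Rightarrow> real) \<Rightarrow> real \<Rightarrow> real \<Rightarrow> bool" where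
  "gradient_dissimilarity n p \<Xi> F \<sigma>t\<^sub>0 \<sigma>\<^sub>2 \<longleftrightarrow>
     (\<forall>i<n. \<forall>x\<in>Rn p.
        (vnorm p (vdiff p (grad p (local_cost \<Xi> F i) x) (grad p (global_cost n \<Xi> F) x)))\<^sup>2
        \<le> \<sigma>t\<^sub>0\<^sup>2 * (vnorm p (grad p (global_cost n \<Xi> F) x))\<^sup>2 + \<sigma>\<^sub>2\<^sup>2)"

definition polyak_lojasiewicz :: "nat \<Rightarrow> real \<Rightarrow> (rvec \<Rightarrow> real) \<Rightarrow> bool" where
  "polyak_lojasiewicz p \<nu> f \<longleftrightarrow>
     (\<forall>x\<in>Rn p. 1/2 * (vnorm p (grad p f x))\<^sup>2 \<ge> \<nu> * (f x - min_value p f))"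

text \<open>
  The last conjunct says that all the \<open>u i k\<close> and \<open>\<xi> j l\<close> together are mutually independent.  The
  two families have different value types, so it is stated through the generated event systems
  (\<open>indep_vars\<close> needs a common type).
\<close>

definition zo_sampling ::
  "'w measure \<Rightarrow> nat \<Rightarrow> nat \<Rightarrow> (nat \<Rightarrow> 'b measure) \<Rightarrow>
     (nat \<Rightarrow> nat \<Rightarrow> 'w \<Rightarrow> rvec) \<Rightarrow> (nat \<Rightarrow> nat \<Rightarrow> 'w \<Rightarrow> 'b) \<Rightarrow> bool" where
  "zo_sampling M n p \<Xi> u \<xi> \<longleftrightarrow>
     prob_space M \<and>
     (\<forall>i<n. \<forall>k.
        u i k \<in> measurable M (lborel_vec p) \<and> distr M (lborel_vec p) (u i k) = uniform_sphere p \<and>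
        \<xi> i k \<in> measurable M (\<Xi> i) \<and> distr M (\<Xi> i) (\<xi> i k) = \<Xi> i) \<and>
     prob_space.indep_sets M
       (\<lambda>s. case s of
          Inl (i, k) \<Rightarrow> {u i k -` A \<inter> space M |A. A \<in> sets (lborel_vec p)}
        | Inr (i, k) \<Rightarrow> {\<xi> i k -` A \<inter> space M |A. A \<in> sets (\<Xi> i)})
       (({..<n} \<times> (UNIV :: nat set)) <+> ({..<n} \<times> (UNIV :: nat set)))"

definition zo_gradient ::
  "nat \<Rightarrow> (rvec \<Rightarrow> 'b \<Rightarrow> real) \<Rightarrow> real \<Rightarrow> rvec \<Rightarrow> rvec \<Rightarrow> 'b \<Rightarrow> rvec" where
  "zo_gradient p Fi d x v z =
     (\<lambda>j\<in>{..<p}. real p * (Fi (\<lambda>l\<in>{..<p}. x l + d * v l) z - Fi x z) / d * v j)"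

text \<open>\<open>zo_iterate \<dots> k \<omega> i\<close> is the state of agent \<open>i\<close> at iteration \<open>k\<close>.\<close>

primrec zo_iterate ::
  "nat \<Rightarrow> nat \<Rightarrow> real mat \<Rightarrow> real \<Rightarrow> (nat \<Rightarrow> real) \<Rightarrow> (nat \<Rightarrow> nat \<Rightarrow> real) \<Rightarrow>
     (nat \<Rightarrow> rvec \<Rightarrow> 'b \<Rightarrow> real) \<Rightarrow> (nat \<Rightarrow> nat \<Rightarrow> 'w \<Rightarrow> rvec) \<Rightarrow> (nat \<Rightarrow> nat \<Rightarrow> 'w \<Rightarrow> 'b) \<Rightarrow>
     (nat \<Rightarrow> rvec) \<Rightarrow> nat \<Rightarrow> 'w \<Rightarrow> nat \<Rightarrow> rvec" where
  "zo_iterate n p L \<gamma> \<eta> \<delta> F u \<xi> x0 0 = (\<lambda>\<omega>. x0)"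
| "zo_iterate n p L \<gamma> \<eta> \<delta> F u \<xi> x0 (Suc k) =
     (\<lambda>\<omega>. let x = zo_iterate n p L \<gamma> \<eta> \<delta> F u \<xi> x0 k \<omega> in
       (\<lambda>i. \<lambda>j\<in>{..<p}. x i j - \<gamma> * (\<Sum>m<n. L $$ (i, m) * x m j)
          - \<eta> k * zo_gradient p (F i) (\<delta> i k) (x i) (u i k \<omega>) (\<xi> i k \<omega>) j))"

definition average :: "nat \<Rightarrow> nat \<Rightarrow> (nat \<Rightarrow> rvec) \<Rightarrow> rvec" where
  "average n p x = (\<lambda>j\<in>{..<p}. (\<Sum>i<n. x i j) / real n)"

definition consensus_error :: "nat \<Rightarrow> nat \<Rightarrow> (nat \<Rightarrow> rvec) \<Rightarrow> real" where
  "consensus_error n p x = (\<Sum>i<n. (vnorm p (vdiff p (x i) (average n p x)))\<^sup>2) / real n"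

end

theory Submission
  imports Defs "HOL-Combinatorics.Permutations"
begin

text \<open>
  Let \<open>e\<^sub>k\<close>, \<open>h\<^sub>k\<close>, \<open>G\<^sub>k\<close> be the expected consensus error, the expected optimality gap and the expected
  squared gradient norm at the averaged iterate, and put \<open>\<alpha> = \<gamma> \<rho>\<^sub>2(L)\<close>.  On the orthogonal complement of
  the constant vectors \<open>I - \<gamma> L\<close> contracts, so Young's inequality gives
  \<open>e\<^sub>k\<^sub>+\<^sub>1 \<le> (1 - \<alpha>/2) e\<^sub>k + (1 + 1/\<alpha>) \<eta>\<^sup>2 V\<^sub>k\<close>, where \<open>V\<^sub>k\<close> is the mean second moment of the gradient
  estimators.  The Laplacian does not move the average, so the descent lemma gives
  \<open>h\<^sub>k\<^sub>+\<^sub>1 \<le> h\<^sub>k - \<eta>/2 G\<^sub>k + \<eta> L\<^sub>f\<^sup>2 e\<^sub>k + L\<^sub>f \<eta>\<^sup>2/(2n) V\<^sub>k\<close> up to the bias of the estimators.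

  The estimator needs only \<open>E[u u\<^sup>T] = I/p\<close>: this bounds its second moment by \<open>2 p \<parallel>\<nabla>F\<parallel>\<^sup>2\<close> plus a smoothing
  error, and by Cauchy-Schwarz its bias by \<open>\<surd>p L\<^sub>f \<delta>/2\<close>.  The factor \<open>p\<close> in the squared bias is harmless
  because \<open>p \<eta>\<close> is bounded, so the smoothing errors are summable uniformly in \<open>p\<close> and no divergence theorem
  is needed.

  Combining the recursions as \<open>\<theta> e\<^sub>k + h\<^sub>k\<close> with \<open>\<theta>\<close> proportional to \<open>\<eta>\<close> turns the consensus noise \<open>p \<eta>\<^sup>2\<close>
  into \<open>p \<eta>\<^sup>3\<close> and bounds \<open>\<Sum> \<eta> G\<^sub>k\<close> and \<open>h\<^sub>T\<close>; substituting this back into the first recursion gives the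
  consensus bounds.  Under the Polyak-Lojasiewicz condition the combination with \<open>\<theta> = 1\<close> contracts.
\<close>

section \<open>The scalar recursions\<close>

text \<open>The constant must be fixed before \<open>n\<close>, \<open>p\<close>, the graph, the
  step size and the process. Hence the split into a scalar part, whose constants are closed
  expressions in the fixed parameters, and a probabilistic part that only has to deliver the
  recursions.

  Uniformity in \<open>p\<close> rests on the second entry of \<open>const_d2\<close>: since
  \<open>2 * eps2 \<gamma> L + Lf\<close> is 2 + 1/\<alpha> + Lf, it keeps p (2 + 1/\<alpha> + Lf)
  \<eta> below 1/64, and the absorptions of noise and smoothing errors draw on this budget. The
  first entry keeps the weight \<theta> at most 1.

  The gain 1/n would be lost if the second moment of the averaged estimator were bounded at once. It
  is split into a conditional mean, whose square the descent absorbs because Lf \<eta> \<le> 1, and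
  a centred part; only the centred parts, uncorrelated across agents, are charged to V.

  The consensus error at a single time \<open>T\<close> carries a transient that decays
  geometrically from the initial error. It drops below p \<eta>^2 only after a time of order ln (1 /
  (p \<eta>^2)), which is the origin of the logarithmic threshold on \<open>T\<close>.\<close>

lemma perturbed_linear_recursion:
  fixes y :: "nat \<Rightarrow> real"
  assumes "0 \<le> m" "m < 1" "q < m" "0 \<le> q" "0 \<le> K" "0 \<le> R"
    and step: "\<And>k. k < T \<Longrightarrow> y (Suc k) \<le> m * y k + R + K * q ^ k"
  shows "y T \<le> m ^ T * y 0 + R / (1 - m) + K * m ^ T / (m - q)"
proof -
  \<comment> \<open>The decaying input contributes the convolution of m^(k-1-j) with q^j, which sums
    to (m^k - q^k) / (m - q). The induction has to carry this exact value: with q^k already dropped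
    the claim is not inductive. The hypothesis \<open>step\<close> is asked for only below
    \<open>T\<close> because in one use \<open>R\<close> itself depends on \<open>T\<close>.\<close>
  have *: "k \<le> T \<Longrightarrow> y k \<le> m ^ k * y 0 + R / (1 - m) + K * (m ^ k - q ^ k) / (m - q)" for k
  proof (induction k)
    case 0
    then show ?case using assms by simp
  next
    case (Suc k)
    have "y (Suc k) \<le> m * y k + R + K * q ^ k" using step Suc by simp
    also have "\<dots> \<le> m * (m ^ k * y 0 + R / (1 - m) + K * (m ^ k - q ^ k) / (m - q)) + R + K * q ^ k"
      using Suc assms(1) by (simp add: mult_left_mono)
    also have "\<dots> = m ^ Suc k * y 0 + (m * R / (1 - m) + R) + (m * K * (m ^ k - q ^ k) / (m - q) + K * q ^ k)"
      by (simp add: algebra_simps)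
    also have "m * R / (1 - m) + R = R / (1 - m)"
      using assms(2) by (simp add: field_simps)
    also have "m * K * (m ^ k - q ^ k) / (m - q) + K * q ^ k = K * (m ^ Suc k - q ^ Suc k) / (m - q)"
      using assms(3) by (simp add: field_simps)
    finally show ?case .
  qed
  have "K * (m ^ T - q ^ T) / (m - q) \<le> K * m ^ T / (m - q)"
    using assms by (intro divide_right_mono mult_left_mono) auto
  then show ?thesis using *[of T] by simp
qed

lemma sum_power_le:
  fixes q :: real
  assumes "0 \<le> q" "q < 1"
  shows "(\<Sum>k<T. q ^ k) \<le> 1 / (1 - q)"
  using assms by (simp add: sum_gp_strict divide_right_mono)

lemma telescope_le:
  fixes y d r :: "nat \<Rightarrow> real"
  assumes "\<And>k. y (Suc k) + d k \<le> y k + r k"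
  shows "y T + (\<Sum>k<T. d k) \<le> y 0 + (\<Sum>k<T. r k)"
proof (induction T)
  case (Suc T)
  then show ?case using assms[of T] by simp
qed simp

text \<open>In the application \<open>a\<close> is \<gamma> times \<open>rho2\<close>,
  \<open>A0\<close> is \<open>1 + \<sigma>\<^sub>0\<^sup>2\<close>, \<open>A\<close> is \<open>(1 +
  \<sigma>\<^sub>0\<^sup>2) * (1 + \<sigma>t\<^sub>0\<^sup>2)\<close>, and \<open>s\<close> is the
  noise level that multiplies the error terms of the theorem. The assumptions \<open>eta1\<close>
  and \<open>eta2\<close> are the two entries of \<open>const_d2\<close>, and the parenthesis common
  to \<open>e_step\<close> and \<open>h_step\<close> bounds the mean second moment of the
  estimators.\<close>

locale zo_recursion =
  fixes n p :: nat and L a A0 A s \<kappa> \<epsilon>t \<eta> \<epsilon>1 B0 B1 :: real and e h G :: "nat \<Rightarrow> real"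
  assumes n: "n \<ge> 1" and p: "p \<ge> 1" and L: "L > 0" and a: "a > 0" and A0: "A0 \<ge> 1" and A: "A0 \<le> A"
    and s: "s \<ge> 0" and et: "0 < \<epsilon>t" "\<epsilon>t < 1" and eta: "0 < \<eta>" and e1: "0 < \<epsilon>1" "\<epsilon>1 \<le> a / 2"
    and eta1: "9 * L\<^sup>2 * \<eta> \<le> 4 * \<epsilon>1" and eta2: "64 * p * A * (2 + 1 / a + L) * \<eta> \<le> 1"
    and nonneg: "\<And>k. 0 \<le> e k" "\<And>k. 0 \<le> h k" "\<And>k. 0 \<le> G k" and G_le: "\<And>k. G k \<le> 2 * L * h k"
    and init: "e 0 \<le> B0" "h 0 \<le> B1"
    and e_step: "\<And>k. e (Suc k) \<le> (1 - a / 2) * e k + (1 + 1 / a) * \<eta>\<^sup>2 *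
        (16 * p * A * G k + 8 * p * s + 8 * p * A0 * L\<^sup>2 * e k + p\<^sup>2 * L\<^sup>2 * (\<kappa>\<^sup>2 * (\<epsilon>t\<^sup>2) ^ k) / 2)"
    and h_step: "\<And>k. h (Suc k) \<le> h k - \<eta> / 2 * G k + \<eta> * L\<^sup>2 * e k + L * \<eta>\<^sup>2 / (2 * n) *
        (16 * p * A * G k + 8 * p * s + 8 * p * A0 * L\<^sup>2 * e k + p\<^sup>2 * L\<^sup>2 * (\<kappa>\<^sup>2 * (\<epsilon>t\<^sup>2) ^ k) / 2)
        + \<eta> * p * L\<^sup>2 * (\<kappa>\<^sup>2 * (\<epsilon>t\<^sup>2) ^ k) / 4"
begin

definition b :: real where "b = 1 + 1 / a"
definition D :: "nat \<Rightarrow> real" where "D k = \<kappa>\<^sup>2 * (\<epsilon>t\<^sup>2) ^ k"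

lemma b_ge: "1 \<le> b" using a by (simp add: b_def)

lemma D_nonneg: "0 \<le> D k" by (simp add: D_def)

lemma et2: "0 < \<epsilon>t\<^sup>2" "\<epsilon>t\<^sup>2 < 1"
  using et by (auto simp: power_less_one_iff)

lemma sum_D: "(\<Sum>k<T. D k) \<le> \<kappa>\<^sup>2 / (1 - \<epsilon>t\<^sup>2)"
  using mult_left_mono[OF sum_power_le[of "\<epsilon>t\<^sup>2" T], of "\<kappa>\<^sup>2"] et2 by (simp add: D_def sum_distrib_left)

section \<open>Consequences of the step size restriction\<close>

lemma pA_eta: "p * A * \<eta> * (2 + 1 / a + L) \<le> 1 / 64"
  using eta2 by (simp add: algebra_simps)

lemma pA_nonneg: "0 \<le> p * A * \<eta>" using A0 A eta by simp

lemma pA_eta_b: "p * A * \<eta> * b \<le> 1 / 64"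
proof -
  have "p * A * \<eta> * b \<le> p * A * \<eta> * (2 + 1 / a + L)"
    using L pA_nonneg by (intro mult_left_mono) (auto simp: b_def)
  then show ?thesis using pA_eta by (rule order_trans)
qed

lemma pA_eta_bL: "p * A * \<eta> * (b + L / 2) \<le> 1 / 64"
proof -
  have "p * A * \<eta> * (b + L/2) \<le> p * A * \<eta> * (2 + 1 / a + L)"
    using L pA_nonneg by (intro mult_left_mono) (auto simp: b_def)
  then show ?thesis using pA_eta by (rule order_trans)
qed

lemma p_eta_le_pA: "p * \<eta> \<le> p * A * \<eta>"
  using A0 A eta mult_right_mono[of 1 A "p * \<eta>"] by (simp add: mult_ac)

lemma p_eta_bL: "p * \<eta> * (b + L/2) \<le> 1 / 64"
proof -
  have "p * \<eta> * (b + L/2) \<le> p * A * \<eta> * (b + L/2)"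
    using b_ge L by (intro mult_right_mono p_eta_le_pA) auto
  then show ?thesis using pA_eta_bL by simp
qed

text \<open>A bound free of \<open>p\<close>: it pays for the powers of \<open>p\<close> that
  accompany the squared smoothing radii in the variance and in the bias.\<close>

lemma p_eta: "p * \<eta> \<le> 1 / 64"
proof -
  have "p * \<eta> * 1 \<le> p * \<eta> * (b + L/2)"
    using b_ge L eta by (intro mult_left_mono) auto
  then show ?thesis using p_eta_bL by simp
qed

lemma eta_le: "\<eta> \<le> 1 / 64"
proof -
  have "1 * \<eta> \<le> p * \<eta>" using p eta by (intro mult_right_mono) auto
  then show ?thesis using p_eta by simp
qed

lemma inv_n: "0 < 1 / real n" "1 / real n \<le> 1"
  using n by auto

definition V :: "nat \<Rightarrow> real" where
  "V k = 16 * p * A * G k + 8 * p * s + 8 * p * A0 * L\<^sup>2 * e k + p\<^sup>2 * L\<^sup>2 * D k / 2"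

text \<open>Any weight up to 1 is admissible because the total noise factor
  \<open>\<theta> * b + L / (2 * n)\<close> stays below \<open>b + L / 2\<close>, the quantity
  controlled by \<open>eta2\<close>. The gradient part of the noise then costs 16/64 of \<eta>,
  which is half of the descent \<eta>/2, and the consensus part adds 8/64 to the coefficient of
  \<eta> L^2, whence 9/8. Leaving \<theta> free serves both the nonconvex bounds and the linear
  rate.\<close>

lemma weighted_step:
  assumes th: "0 \<le> \<theta>" "\<theta> \<le> 1"
  shows "\<theta> * e (Suc k) + h (Suc k) \<le> (\<theta> * (1 - a/2) + 9/8 * \<eta> * L\<^sup>2) * e k + h k - \<eta>/4 * G k
     + s * p * \<eta>\<^sup>2 * (8 * \<theta> * b + 4 * L / n) + L\<^sup>2 * D k"
proof -
  define \<omega> where "\<omega> = \<theta> * b + L / (2 * n)"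
  have w0: "0 \<le> \<omega>" using th b_ge L by (simp add: \<omega>_def)
  have wle: "\<omega> \<le> b + L/2"
    unfolding \<omega>_def using th b_ge L n
    by (intro add_mono) (auto simp: field_simps mult_left_le_one_le)
  have w: "p * A * \<eta> * \<omega> \<le> 1/64"
    using mult_left_mono[OF wle pA_nonneg] pA_eta_bL by simp
  have w': "p * \<eta> * \<omega> \<le> 1/64"
    using mult_left_mono[OF wle, of "p * \<eta>"] p_eta_bL eta by simp
  have "\<theta> * e (Suc k) + h (Suc k) \<le> \<theta> * ((1 - a / 2) * e k + b * \<eta>\<^sup>2 * V k)
      + (h k - \<eta> / 2 * G k + \<eta> * L\<^sup>2 * e k + L * \<eta>\<^sup>2 / (2 * n) * V k + \<eta> * p * L\<^sup>2 * D k / 4)"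
    using e_step[of k] h_step[of k] th by (intro add_mono mult_left_mono) (auto simp: V_def D_def b_def)
  also have "\<dots> = \<theta> * (1 - a/2) * e k + h k - \<eta> / 2 * G k + \<eta> * L\<^sup>2 * e k + \<eta>\<^sup>2 * \<omega> * V k + \<eta> * p * L\<^sup>2 * D k / 4"
    by (simp add: \<omega>_def algebra_simps)
  also have "\<eta>\<^sup>2 * \<omega> * V k = 16 * \<eta> * (p * A * \<eta> * \<omega>) * G k + s * p * \<eta>\<^sup>2 * (8 * \<theta> * b + 4 * L / n)
      + 8 * \<eta> * L\<^sup>2 * (p * A0 * \<eta> * \<omega>) * e k + (p * \<eta>) * (p * \<eta> * \<omega>) * L\<^sup>2 * D k / 2"
    by (simp add: V_def \<omega>_def power2_eq_square algebra_simps)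
  also have "16 * \<eta> * (p * A * \<eta> * \<omega>) * G k \<le> 16 * \<eta> * (1/64) * G k"
    using w eta nonneg by (intro mult_right_mono mult_left_mono) auto
  also have "8 * \<eta> * L\<^sup>2 * (p * A0 * \<eta> * \<omega>) * e k \<le> 8 * \<eta> * L\<^sup>2 * (1/64) * e k"
  proof -
    have "p * A0 * \<eta> * \<omega> \<le> p * A * \<eta> * \<omega>"
      using A eta w0 by (intro mult_right_mono mult_left_mono) auto
    then show ?thesis using w eta nonneg by (intro mult_right_mono mult_left_mono) auto
  qed
  also have "(p * \<eta>) * (p * \<eta> * \<omega>) * L\<^sup>2 * D k / 2 \<le> (1/64) * (1/64) * L\<^sup>2 * D k / 2"
    using p_eta w' w0 eta D_nonneg by (intro divide_right_mono mult_right_mono mult_mono) auto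
  also have "\<eta> * p * L\<^sup>2 * D k / 4 \<le> (1/64) * L\<^sup>2 * D k / 4"
    using p_eta D_nonneg by (intro divide_right_mono mult_right_mono) (auto simp: mult.commute)
  finally have "\<theta> * e (Suc k) + h (Suc k) \<le> \<theta> * (1 - a/2) * e k + h k - \<eta> / 2 * G k + \<eta> * L\<^sup>2 * e k
    + (16 * \<eta> * (1/64) * G k + s * p * \<eta>\<^sup>2 * (8 * \<theta> * b + 4 * L / n) + 8 * \<eta> * L\<^sup>2 * (1/64) * e k +
      (1/64) * (1/64) * L\<^sup>2 * D k / 2) + (1/64) * L\<^sup>2 * D k / 4" by simp
  \<comment> \<open>The two smoothing coefficients, 1/8192 and 1/256, are rounded up to 1.\<close>
  moreover have "0 \<le> L\<^sup>2 * D k" using D_nonneg by simp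
  ultimately show ?thesis by (simp add: algebra_simps)
qed

text \<open>The first summand comes from \<open>8 * \<theta> * b\<close> for the weight of
  \<open>potential_bound\<close>, with its factor \<eta> split off; the second comes from the
  descent inequality, where the noise carries 1/n. \<open>K3\<close> collects what does not grow
  with the horizon: the initial data and the summed smoothing errors.\<close>

definition K2 :: real where "K2 = 8 * (9 * L\<^sup>2 / (2 * a)) * b + 4 * L"
definition K3 :: real where "K3 = B0 + B1 + L\<^sup>2 * (\<kappa>\<^sup>2 / (1 - \<epsilon>t\<^sup>2))"

lemma K2_nonneg: "0 \<le> K2" using a b_ge L by (simp add: K2_def)

lemma K3_nonneg: "0 \<le> K3"
  using init nonneg(1,2)[of 0] et2 by (simp add: K3_def)

text \<open>Both summands on the left are used: the sum for the time averages, and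
  \<open>h T\<close> for a pointwise bound on the gradient in
  \<open>consensus_final\<close>.\<close>

lemma potential_bound:
  "h T + \<eta>/4 * (\<Sum>k<T. G k) \<le> K3 + K2 * (s * p * \<eta>\<^sup>2 * (1 / n + \<eta>)) * T"
proof -
  \<comment> \<open>With this weight \<theta> a / 2 is 9/4 of \<eta> L^2, twice the 9/8 of \<eta>
    L^2 that \<open>weighted_step\<close> feeds back into the consensus error, so \<open>e\<close>
    does not accumulate. That \<theta> is at most 1 follows from 9 L^2 \<eta> \<le> 4 \<epsilon>1
    \<le> 2 a.\<close>
  define \<theta> where "\<theta> = 9 * L\<^sup>2 / (2 * a) * \<eta>"
  have th: "0 \<le> \<theta>" "\<theta> \<le> 1"
    using a eta e1 eta1 by (auto simp: \<theta>_def divide_simps)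
  have th2: "\<theta> * (1 - a/2) + 9/8 * \<eta> * L\<^sup>2 \<le> \<theta>"
  proof -
    have "\<theta> * (a/2) = 9/4 * (\<eta> * L\<^sup>2)" using a by (simp add: \<theta>_def)
    moreover have "0 \<le> \<eta> * L\<^sup>2" using eta by simp
    ultimately show ?thesis by (simp add: algebra_simps)
  qed
  define c where "c = s * p * \<eta>\<^sup>2 * (8 * \<theta> * b + 4 * L / n)"
  have c: "c \<le> K2 * (s * p * \<eta>\<^sup>2 * (1 / n + \<eta>))"
  proof -
    have "8 * \<theta> * b + 4 * L / n = (8 * (9 * L\<^sup>2 / (2 * a)) * b) * \<eta> + (4 * L) * (1/n)"
      by (simp add: \<theta>_def)
    also have "\<dots> \<le> K2 * \<eta> + K2 * (1/n)"
      using a b_ge L eta inv_n by (intro add_mono mult_right_mono) (auto simp: K2_def)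
    finally have "8 * \<theta> * b + 4 * L / n \<le> K2 * (1/n + \<eta>)" by (simp add: algebra_simps)
    from mult_left_mono[OF this, of "s * p * \<eta>\<^sup>2"] show ?thesis
      using s by (simp add: c_def mult_ac)
  qed
  have step: "(\<theta> * e (Suc k) + h (Suc k)) + \<eta>/4 * G k \<le> (\<theta> * e k + h k) + (c + L\<^sup>2 * D k)" for k
  proof -
    have "(\<theta> * (1 - a/2) + 9/8 * \<eta> * L\<^sup>2) * e k \<le> \<theta> * e k"
      using th2 nonneg by (intro mult_right_mono) auto
    with weighted_step[OF th, of k] show ?thesis by (simp add: c_def)
  qed
  have "(\<theta> * e T + h T) + (\<Sum>k<T. \<eta>/4 * G k) \<le> (\<theta> * e 0 + h 0) + (\<Sum>k<T. c + L\<^sup>2 * D k)"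
    by (rule telescope_le[of "\<lambda>k. \<theta> * e k + h k", OF step])
  also have "(\<Sum>k<T. c + L\<^sup>2 * D k) = c * T + L\<^sup>2 * (\<Sum>k<T. D k)"
    by (simp add: sum.distrib sum_distrib_left)
  also have "\<dots> \<le> K2 * (s * p * \<eta>\<^sup>2 * (1 / n + \<eta>)) * T + L\<^sup>2 * (\<kappa>\<^sup>2 / (1 - \<epsilon>t\<^sup>2))"
    using c sum_D by (intro add_mono mult_right_mono mult_left_mono) auto
  also have "\<theta> * e 0 + h 0 \<le> B0 + B1"
  proof -
    have "\<theta> * e 0 \<le> 1 * e 0" using th nonneg by (intro mult_right_mono) auto
    then show ?thesis using init by simp
  qed
  finally have "(\<theta> * e T + h T) + (\<Sum>k<T. \<eta>/4 * G k) \<le> K3 + K2 * (s * p * \<eta>\<^sup>2 * (1 / n + \<eta>)) * T"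
    by (simp add: K3_def)
  moreover have "0 \<le> \<theta> * e T" using th nonneg by simp
  ultimately show ?thesis by (simp add: sum_distrib_left)
qed

lemma gradient_average:
  assumes "T \<ge> 1"
  shows "(1 / real T) * (\<Sum>k<T. G k) \<le> 4 * (K3 + K2) * (1 / (\<eta> * T) + s * (p * \<eta> / n + p * \<eta>\<^sup>2))"
proof -
  have *: "\<eta>/4 * (\<Sum>k<T. G k) \<le> K3 + K2 * (s * p * \<eta>\<^sup>2 * (1 / n + \<eta>)) * T"
    using potential_bound[of T] nonneg(2)[of T] by linarith
  have "(1 / real T) * (\<Sum>k<T. G k) = 4 / (\<eta> * T) * (\<eta>/4 * (\<Sum>k<T. G k))"
    using eta by simp
  also have "\<dots> \<le> 4 / (\<eta> * T) * (K3 + K2 * (s * p * \<eta>\<^sup>2 * (1 / n + \<eta>)) * T)"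
    using * eta by (intro mult_left_mono) auto
  also have "\<dots> = 4 * K3 * (1 / (\<eta> * T)) + 4 * K2 * (s * (p * \<eta> / n + p * \<eta>\<^sup>2))"
    using assms eta n by (simp add: field_simps power2_eq_square)
  also have "\<dots> \<le> 4 * (K3 + K2) * (1 / (\<eta> * T)) + 4 * (K3 + K2) * (s * (p * \<eta> / n + p * \<eta>\<^sup>2))"
    using eta s K2_nonneg K3_nonneg by (intro add_mono mult_right_mono) auto
  finally show ?thesis by (simp add: algebra_simps)
qed

section \<open>Contraction of the consensus error\<close>

definition c :: real where "c = min (a/4) (1/2)"

lemma c: "0 < c" "c \<le> 1/2" "c \<le> a/4" using a by (auto simp: c_def)

text \<open>Half of the decay a/2 is spent on the consensus error hidden in the second moment: its
  coefficient is at most 8 \<eta> L^2 times \<open>p * A * \<eta> * b\<close>, hence at most \<eta>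
  L^2 / 8, which is below a/4. What is left is at least \<open>c\<close>, capped at 1/2 to keep
  \<open>1 - c\<close> positive.\<close>

lemma consensus_step:
  "e (Suc k) \<le> (1 - c) * e k + b * \<eta>\<^sup>2 * (16 * p * A * G k + 8 * p * s + p\<^sup>2 * L\<^sup>2 * D k / 2)"
proof -
  have "b * \<eta>\<^sup>2 * (8 * p * A0 * L\<^sup>2) \<le> a / 4"
  proof -
    have "b * \<eta>\<^sup>2 * (8 * p * A0 * L\<^sup>2) \<le> b * \<eta>\<^sup>2 * (8 * p * A * L\<^sup>2)"
      using A b_ge by (intro mult_left_mono mult_right_mono) auto
    also have "\<dots> = 8 * (\<eta> * L\<^sup>2) * (p * A * \<eta> * b)" by (simp add: power2_eq_square)
    also have "\<dots> \<le> 8 * (\<eta> * L\<^sup>2) * (1/64)"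
      using eta pA_eta_b by (intro mult_left_mono) auto
    also have "\<dots> \<le> a/4" using eta1 e1 a by (simp add: mult.commute)
    finally show ?thesis .
  qed
  then have "1 - a/2 + b * \<eta>\<^sup>2 * (8 * p * A0 * L\<^sup>2) \<le> 1 - c" using c by simp
  from mult_right_mono[OF this nonneg(1)[of k]]
  have "(1 - a/2) * e k + b * \<eta>\<^sup>2 * (8 * p * A0 * L\<^sup>2 * e k) \<le> (1 - c) * e k"
    by (simp add: distrib_right mult.assoc)
  moreover have "e (Suc k) \<le> (1 - a/2) * e k + b * \<eta>\<^sup>2 * V k"
    using e_step[of k] by (simp add: b_def D_def V_def)
  moreover have "V k = (16 * p * A * G k + 8 * p * s + p\<^sup>2 * L\<^sup>2 * D k / 2) + 8 * p * A0 * L\<^sup>2 * e k"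
    by (simp add: V_def)
  ultimately show ?thesis by (simp add: distrib_left del: distrib_left_numeral)
qed

text \<open>Two factors \<eta> cancel \<open>p\<^sup>2\<close>: both \<open>b * p * \<eta>\<close>
  and \<open>p * \<eta>\<close> are at most 1/64.\<close>

lemma b_eta_p: "b * \<eta>\<^sup>2 * (p\<^sup>2 * L\<^sup>2 * D k / 2) \<le> L\<^sup>2 * D k"
proof -
  have "b * p * \<eta> \<le> 1/64"
    using order_trans[OF mult_left_mono[of b "b + L/2" "p * \<eta>"] p_eta_bL] eta L by (simp add: mult_ac)
  then have "(b * p * \<eta>) * (p * \<eta>) \<le> (1/64) * (1/64)"
    using p_eta eta b_ge by (intro mult_mono) auto
  from mult_right_mono[OF this, of "L\<^sup>2 * D k"] D_nonneg[of k]
  have "(b * p * \<eta>) * (p * \<eta>) * (L\<^sup>2 * D k) \<le> (1/64) * (1/64) * (L\<^sup>2 * D k)"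
    by simp
  moreover have "b * \<eta>\<^sup>2 * (p\<^sup>2 * L\<^sup>2 * D k) = (b * p * \<eta>) * (p * \<eta>) * (L\<^sup>2 * D k)"
    by (simp add: power2_eq_square)
  moreover have "0 \<le> L\<^sup>2 * D k" using D_nonneg by simp
  ultimately have "b * \<eta>\<^sup>2 * (p\<^sup>2 * L\<^sup>2 * D k) \<le> L\<^sup>2 * D k" by linarith
  moreover have "b * \<eta>\<^sup>2 * (p\<^sup>2 * L\<^sup>2 * D k / 2) = b * \<eta>\<^sup>2 * (p\<^sup>2 * L\<^sup>2 * D k) / 2" by simp
  ultimately show ?thesis using \<open>0 \<le> L\<^sup>2 * D k\<close> by linarith
qed

text \<open>The gradient input is reduced to \<eta>/4 times \<open>G\<close>, the quantity whose sum
  \<open>potential_bound\<close> controls. The noise in that bound carries 1/n + \<eta>, which is at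
  most 2, and so merges with the direct consensus noise.\<close>

lemma consensus_average:
  assumes "T \<ge> 1"
  shows "(1 / real T) * (\<Sum>k<T. e k) \<le> (B0 + 2 * K3 + 2 * K2 + 8 * b) / c * (1 / T + s * p * \<eta>\<^sup>2)"
proof -
  have K: "0 \<le> B0" using init nonneg(1)[of 0] by simp
  have K': "L\<^sup>2 * (\<kappa>\<^sup>2 / (1 - \<epsilon>t\<^sup>2)) \<le> K3"
    using init nonneg(1,2)[of 0] by (simp add: K3_def)
  have "e (Suc k) + c * e k \<le> e k + (\<eta>/4 * G k + 8 * b * (s * p * \<eta>\<^sup>2) + L\<^sup>2 * D k)" for k
  proof -
    have "b * \<eta>\<^sup>2 * (16 * p * A * G k) = 16 * \<eta> * (p * A * \<eta> * b) * G k"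
      by (simp add: power2_eq_square)
    also have "\<dots> \<le> 16 * \<eta> * (1/64) * G k"
      using eta pA_eta_b nonneg by (intro mult_left_mono mult_right_mono) auto
    finally have "b * \<eta>\<^sup>2 * (16 * p * A * G k) \<le> \<eta>/4 * G k" by simp
    with consensus_step[of k] b_eta_p[of k] show ?thesis by (simp add: algebra_simps)
  qed
  from telescope_le[of e, OF this, of T]
  have "c * (\<Sum>k<T. e k) \<le> e 0 + \<eta>/4 * (\<Sum>k<T. G k) + 8 * b * (s * p * \<eta>\<^sup>2) * T + L\<^sup>2 * (\<Sum>k<T. D k)"
    using nonneg(1)[of T] by (simp add: sum.distrib sum_distrib_left sum_divide_distrib mult.commute[of "real T"])
  also have "\<dots> \<le> B0 + (K3 + K2 * (s * p * \<eta>\<^sup>2 * (1/n + \<eta>)) * T) + 8 * b * (s * p * \<eta>\<^sup>2) * T + K3"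
    using init potential_bound[of T] nonneg(2)[of T] order_trans[OF mult_left_mono[OF sum_D[of T], of "L\<^sup>2"] K'] by simp
  also have "K2 * (s * p * \<eta>\<^sup>2 * (1/n + \<eta>)) * T \<le> K2 * (s * p * \<eta>\<^sup>2 * 2) * T"
    using add_mono[OF inv_n(2), of \<eta> 1] eta_le K2_nonneg s by (intro mult_right_mono mult_left_mono) auto
  finally have "c * (\<Sum>k<T. e k) \<le> (B0 + 2 * K3) + (2 * K2 + 8 * b) * (s * p * \<eta>\<^sup>2 * T)"
    by (simp add: algebra_simps)
  also have "\<dots> \<le> (B0 + 2 * K3 + 2 * K2 + 8 * b) * 1 + (B0 + 2 * K3 + 2 * K2 + 8 * b) * (s * p * \<eta>\<^sup>2 * T)"
    using K K2_nonneg K3_nonneg b_ge s by (intro add_mono mult_right_mono) auto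
  finally have "c * (\<Sum>k<T. e k) \<le> (B0 + 2 * K3 + 2 * K2 + 8 * b) * (1 + s * p * \<eta>\<^sup>2 * T)"
    by (simp add: algebra_simps)
  from mult_left_mono[OF this, of "1 / (c * T)"] c assms show ?thesis
    by (simp add: field_simps)
qed

text \<open>The midpoint between \<open>\<epsilon>t\<^sup>2\<close> and 1 keeps \<open>m\<close>
  away from the rate of the squared smoothing radii, so that
  \<open>perturbed_linear_recursion\<close> divides by no less than (1 -
  \<open>\<epsilon>t\<^sup>2\<close>) / 2.\<close>

definition m :: real where "m = max (1 - c) ((1 + \<epsilon>t\<^sup>2) / 2)"

lemma m: "1 - c \<le> m" "1/2 < m" "m < 1" "(1 - \<epsilon>t\<^sup>2) / 2 \<le> m - \<epsilon>t\<^sup>2"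
proof -
  have "1/2 < (1 + \<epsilon>t\<^sup>2) / 2" using et2 by simp
  then show "1/2 < m" unfolding m_def by (rule less_le_trans) simp
  show "1 - c \<le> m" "m < 1" using c et2 by (auto simp: m_def)
  have "(1 + \<epsilon>t\<^sup>2) / 2 \<le> m" by (simp add: m_def)
  then show "(1 - \<epsilon>t\<^sup>2) / 2 \<le> m - \<epsilon>t\<^sup>2" by (simp add: field_simps)
qed

text \<open>Using the sum of the gradients would give an input of order p \<eta> only, so the
  gradient is bounded pointwise: \<open>G\<close> by \<open>2 * L * h\<close>, and \<open>h\<close>
  by \<open>potential_bound\<close>. Multiplied by p \<eta>^2 this produces the terms p \<eta>^2 and
  s p^2 \<eta>^4 (1/n + \<eta>) T.\<close>

lemma consensus_final:
  assumes T: "T \<ge> 1" and TC: "real T \<ge> 1 / ln (1 / m) * ln (1 / (p * \<eta>\<^sup>2))"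
  shows "e T \<le> (B0 + 4 * K3 / (1 - \<epsilon>t\<^sup>2) + (32 * b * A * L * (K3 + K2) + 8 * b * s) / (1 - m))
     * (p * \<eta>\<^sup>2 + s * p\<^sup>2 * \<eta> ^ 4 * (1 / n + \<eta>) * T)"
proof -
  define R1 where "R1 = s * p * \<eta>\<^sup>2 * (1 / n + \<eta>) * T"
  have R1: "0 \<le> R1" using s eta by (simp add: R1_def)
  define R where "R = b * \<eta>\<^sup>2 * (16 * p * A * (2 * L * (K3 + K2 * R1)) + 8 * p * s)"
  have R0: "0 \<le> R" using b_ge A0 A L K3_nonneg K2_nonneg R1 s
    unfolding R_def by (intro mult_nonneg_nonneg add_nonneg_nonneg) auto
  have K: "0 \<le> B0" using init nonneg(1)[of 0] by simp
  have K'': "0 \<le> L\<^sup>2 * \<kappa>\<^sup>2" by simp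
  have K': "L\<^sup>2 * \<kappa>\<^sup>2 \<le> K3"
  proof -
    have "L\<^sup>2 * \<kappa>\<^sup>2 / 1 \<le> L\<^sup>2 * \<kappa>\<^sup>2 / (1 - \<epsilon>t\<^sup>2)" using et2 by (intro divide_left_mono) auto
    then show ?thesis using init nonneg(1,2)[of 0] by (simp add: K3_def)
  qed
  have step: "e (Suc k) \<le> m * e k + R + (L\<^sup>2 * \<kappa>\<^sup>2) * (\<epsilon>t\<^sup>2) ^ k" if k: "k < T" for k
  proof -
    have "h k \<le> K3 + K2 * (s * p * \<eta>\<^sup>2 * (1 / n + \<eta>)) * k"
      using potential_bound[of k] eta nonneg(3) sum_nonneg[of "{..<k}" G] by (smt (verit) divide_pos_pos mult_nonneg_nonneg)
    \<comment> \<open>The bound is enlarged to its value at \<open>T\<close>, which makes the input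
      constant in \<open>k\<close>.\<close>
    also have "\<dots> \<le> K3 + K2 * (s * p * \<eta>\<^sup>2 * (1 / n + \<eta>)) * T"
      using k K2_nonneg s eta by (intro add_left_mono mult_left_mono) auto
    finally have "h k \<le> K3 + K2 * R1" by (simp add: R1_def mult_ac)
    with G_le[of k] L have Gk: "G k \<le> 2 * L * (K3 + K2 * R1)"
      by (smt (verit) mult_left_mono)
    have "e (Suc k) \<le> (1 - c) * e k + b * \<eta>\<^sup>2 * (16 * p * A * G k + 8 * p * s) + b * \<eta>\<^sup>2 * (p\<^sup>2 * L\<^sup>2 * D k / 2)"
      using consensus_step[of k] by (simp add: algebra_simps)
    also have "\<dots> \<le> m * e k + R + L\<^sup>2 * D k"
      unfolding R_def using m nonneg b_ge Gk A0 A b_eta_p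
      by (intro add_mono mult_right_mono mult_left_mono) auto
    finally show ?thesis by (simp add: D_def)
  qed
  have "e T \<le> m ^ T * e 0 + R / (1 - m) + (L\<^sup>2 * \<kappa>\<^sup>2) * m ^ T / (m - \<epsilon>t\<^sup>2)"
    by (rule perturbed_linear_recursion[OF _ _ _ _ K'' R0 step]) (use m et2 in auto)
  also have "(L\<^sup>2 * \<kappa>\<^sup>2) * m ^ T / (m - \<epsilon>t\<^sup>2) \<le> K3 * m ^ T / ((1 - \<epsilon>t\<^sup>2) / 2)"
    using m et2 K' K3_nonneg by (intro frac_le mult_right_mono mult_nonneg_nonneg) auto
  also have "m ^ T * e 0 \<le> m ^ T * B0" using m init by (intro mult_left_mono) auto
  also have "K3 * m ^ T / ((1 - \<epsilon>t\<^sup>2) / 2) = m ^ T * (2 * K3 / (1 - \<epsilon>t\<^sup>2))" by simp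
  finally have eT: "e T \<le> m ^ T * (B0 + 2 * K3 / (1 - \<epsilon>t\<^sup>2)) + R / (1 - m)"
    by (simp add: distrib_left)
  \<comment> \<open>The lower bound on \<open>T\<close> turns the transient into p \<eta>^2;
    dividing by \<open>ln m\<close>, which is negative, reverses the inequality.\<close>
  have mT: "m ^ T \<le> p * \<eta>\<^sup>2"
  proof -
    have pe: "0 < p * \<eta>\<^sup>2" using p eta by (intro mult_pos_pos zero_less_power) auto
    have lm: "ln (1/m) = - ln m" "ln m < 0" using m by (auto simp: ln_div)
    have le: "ln (1 / (p * \<eta>\<^sup>2)) = - ln (p * \<eta>\<^sup>2)" using p eta by (simp add: ln_div)
    have "ln (p * \<eta>\<^sup>2) / ln m \<le> real T" using TC lm le by simp
    then have "ln (m ^ T) \<le> ln (p * \<eta>\<^sup>2)"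
      using lm m by (simp add: ln_realpow field_simps)
    moreover have "0 < m ^ T" using m by simp
    ultimately show ?thesis using pe ln_le_cancel_iff by blast
  qed
  have "e T \<le> (p * \<eta>\<^sup>2) * (B0 + 2 * K3 / (1 - \<epsilon>t\<^sup>2)) + R / (1 - m)"
    using eT mult_right_mono[OF mT, of "B0 + 2 * K3 / (1 - \<epsilon>t\<^sup>2)"] K K3_nonneg et2 by auto
  also have "R = (p * \<eta>\<^sup>2) * (32 * b * A * L * K3 + 8 * b * s) + (32 * b * A * L * K2) * (s * p\<^sup>2 * \<eta> ^ 4 * (1 / n + \<eta>) * T)"
    by (simp add: R_def R1_def algebra_simps power2_eq_square power4_eq_xxxx)
  also have "\<dots> \<le> (p * \<eta>\<^sup>2) * (32 * b * A * L * (K3+K2) + 8 * b * s) + (32 * b * A * L * (K3 + K2) + 8 * b * s) * (s * p\<^sup>2 * \<eta> ^ 4 * (1 / n + \<eta>) * T)"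
  proof (rule add_mono[OF mult_left_mono mult_right_mono])
    have "0 \<le> b * A * L" using b_ge A0 A L by simp
    then show "32 * b * A * L * K3 + 8 * b * s \<le> 32 * b * A * L * (K3+K2) + 8 * b * s"
      "32 * b * A * L * K2 \<le> 32 * b * A * L * (K3+K2) + 8 * b * s"
      using K3_nonneg K2_nonneg b_ge s L A A0 by (auto simp: algebra_simps intro!: add_nonneg_nonneg mult_nonneg_nonneg)
  qed (use s eta in auto)
  also have "\<dots> = (32 * b * A * L * (K3+K2) + 8 * b * s) * (p * \<eta>\<^sup>2 + s * p\<^sup>2 * \<eta> ^ 4 * (1 / n + \<eta>) * T)"
    by (simp add: algebra_simps)
  also have "(p * \<eta>\<^sup>2) * (B0 + 2 * K3 / (1 - \<epsilon>t\<^sup>2)) \<le>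
    (B0 + 4 * K3 / (1 - \<epsilon>t\<^sup>2)) * (p * \<eta>\<^sup>2 + s * p\<^sup>2 * \<eta> ^ 4 * (1 / n + \<eta>) * T)"
    unfolding mult.commute[of "p * \<eta>\<^sup>2"]
    using K K3_nonneg et2 s eta by (intro mult_mono add_mono divide_right_mono) (auto intro!: add_nonneg_nonneg divide_nonneg_nonneg)
  finally show ?thesis using m by (simp add: divide_right_mono algebra_simps add_divide_distrib)
qed

text \<open>With unit weight the consensus coefficient is 1 - a/2 + 9/8 \<eta> L^2, at most 1 -
  \<epsilon>1/2 by \<open>eta1\<close> and \<epsilon>1 \<le> a/2, and the Polyak-Lojasiewicz
  inequality turns the descent into the factor 1 - \<nu> \<eta> / 2. Since 1 - r may be as small as
  order \<eta>, dividing the noise s p \<eta>^2 by it costs one factor \<eta>.\<close>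

lemma linear_rate:
  assumes nu: "\<nu> > 0" and PL: "\<And>k. 2 * \<nu> * h k \<le> G k"
  defines "r \<equiv> 1/2 + 1/2 * max (1 - min \<epsilon>1 (\<nu> * \<eta> / 4)) (\<epsilon>t\<^sup>2)"
  shows "0 < r" "r < 1"
    "e k + h k \<le> (B0 + B1 + 4 * K3 / (1 - \<epsilon>t\<^sup>2) + 8 * (b + L / 2) * (8/(9*L\<^sup>2) + 8/\<nu> + 2 / (1 - \<epsilon>t\<^sup>2)))
       * (r ^ k + s * p * \<eta>)"
proof -
  define \<epsilon>8 where "\<epsilon>8 = min \<epsilon>1 (\<nu> * \<eta> / 4)"
  have e8: "0 < \<epsilon>8" "\<epsilon>8 \<le> \<epsilon>1" "\<epsilon>8 \<le> \<nu> * \<eta> / 4" using e1 nu eta by (auto simp: \<epsilon>8_def)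
  \<comment> \<open>Taking the midpoint with 1 separates the rate from
    \<open>\<epsilon>t\<^sup>2\<close>, as \<open>perturbed_linear_recursion\<close>
    requires.\<close>
  have r: "r = max (1 - \<epsilon>8/2) ((1 + \<epsilon>t\<^sup>2)/2)" by (auto simp: r_def \<epsilon>8_def max_def field_simps)
  have r2: "(1 - \<epsilon>t\<^sup>2)/2 \<le> r - \<epsilon>t\<^sup>2" using r by (auto simp: field_simps max_def)
  have "0 < (1 + \<epsilon>t\<^sup>2) / 2" using et2 by (intro divide_pos_pos add_pos_pos) auto
  then show r0: "0 < r" unfolding r by (rule less_le_trans) simp
  show r1: "r < 1" using r e8 et2 by auto
  have K: "0 \<le> B0" "0 \<le> B1" using init nonneg(1,2)[of 0] by auto
  have K'': "0 \<le> L\<^sup>2 * \<kappa>\<^sup>2" by simp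
  have K': "L\<^sup>2 * \<kappa>\<^sup>2 \<le> K3"
  proof -
    have "L\<^sup>2 * \<kappa>\<^sup>2 / 1 \<le> L\<^sup>2 * \<kappa>\<^sup>2 / (1 - \<epsilon>t\<^sup>2)" using et2 by (intro divide_left_mono) auto
    then show ?thesis using K by (simp add: K3_def)
  qed
  define R where "R = s * p * \<eta>\<^sup>2 * (8 * (b + L / 2))"
  have R0: "0 \<le> R" using s b_ge L by (simp add: R_def)
  have step: "e (Suc k) + h (Suc k) \<le> r * (e k + h k) + R + (L\<^sup>2 * \<kappa>\<^sup>2) * (\<epsilon>t\<^sup>2) ^ k" for k
  proof -
    have "e (Suc k) + h (Suc k) \<le> ((1 - a/2) + 9/8 * \<eta> * L\<^sup>2) * e k + h k - \<eta>/4 * G k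
     + s * p * \<eta>\<^sup>2 * (8 * b + 4 * L / n) + L\<^sup>2 * D k"
      using weighted_step[of 1 k] by simp
    moreover have "((1 - a/2) + 9/8 * \<eta> * L\<^sup>2) * e k \<le> r * e k"
      using nonneg eta1 e1 e8 r by (intro mult_right_mono) (auto simp: max_def mult_ac)
    moreover have "\<eta>/4 * (2 * \<nu> * h k) \<le> \<eta>/4 * G k" using PL eta by (intro mult_left_mono) auto
    moreover have "h k - \<eta>/4 * (2 * \<nu> * h k) = (1 - \<nu> * \<eta> / 2) * h k" by (simp add: algebra_simps)
    moreover have "\<dots> \<le> r * h k"
      using nonneg e8 r by (intro mult_right_mono) (auto simp: max_def)
    moreover have "s * p * \<eta>\<^sup>2 * (8 * b + 4 * L / n) \<le> R"
      unfolding R_def using s n L mult_left_mono[OF inv_n(2), of L] by (intro mult_left_mono) auto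
    moreover have "r * (e k + h k) = r * e k + r * h k" by (simp add: distrib_left)
    ultimately show ?thesis unfolding D_def mult.assoc by linarith
  qed
  have "e k + h k \<le> r ^ k * (e 0 + h 0) + R / (1 - r) + (L\<^sup>2 * \<kappa>\<^sup>2) * r ^ k / (r - \<epsilon>t\<^sup>2)"
    by (rule perturbed_linear_recursion[of r "\<epsilon>t\<^sup>2" _ _ _ "\<lambda>k. e k + h k", OF _ _ _ _ K'' R0 step]) (use r0 r1 r2 et2 in auto)
  also have "(L\<^sup>2 * \<kappa>\<^sup>2) * r ^ k / (r - \<epsilon>t\<^sup>2) \<le> K3 * r ^ k / ((1 - \<epsilon>t\<^sup>2) / 2)"
    using r0 r2 et2 K' K3_nonneg by (intro frac_le mult_right_mono mult_nonneg_nonneg) auto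
  also have "r ^ k * (e 0 + h 0) \<le> r ^ k * (B0 + B1)" using r0 init by (intro mult_left_mono) auto
  also have "R / (1 - r) \<le> (8 * (b + L / 2) * (8/(9*L\<^sup>2) + 8/\<nu> + 2 / (1 - \<epsilon>t\<^sup>2))) * (s * p * \<eta>)"
  proof -
    have "1 / (1 - r) \<le> 2 / \<epsilon>8 + 2 / (1 - \<epsilon>t\<^sup>2)"
    proof (cases "1 - \<epsilon>8/2 \<le> (1 + \<epsilon>t\<^sup>2)/2")
      case True
      then have *: "1 - r = (1 - \<epsilon>t\<^sup>2) / 2" using r by (simp add: field_simps)
      have "1 / (1 - r) = 2 / (1 - \<epsilon>t\<^sup>2)" unfolding * by simp
      then show ?thesis using e8 by simp
    next
      case False
      then have *: "1 - r = \<epsilon>8 / 2" using r by simp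
      have "1 / (1 - r) = 2 / \<epsilon>8" unfolding * by simp
      then show ?thesis using et2 by simp
    qed
    moreover have "1 / \<epsilon>8 \<le> 1 / \<epsilon>1 + 4 / (\<nu> * \<eta>)"
      using nu eta e1 by (auto simp: \<epsilon>8_def min_def)
    ultimately have "1 / (1 - r) \<le> 2 / \<epsilon>1 + 8 / (\<nu> * \<eta>) + 2 / (1 - \<epsilon>t\<^sup>2)" by simp
    from mult_left_mono[OF this, of \<eta>]
    have "\<eta> / (1 - r) \<le> 2 * (\<eta> / \<epsilon>1) + 8 / \<nu> + \<eta> * (2 / (1 - \<epsilon>t\<^sup>2))"
      using eta by (simp add: algebra_simps)
    \<comment> \<open>The first step size restriction bounds \<eta> / \<epsilon>1 independently of
      \<gamma> and of the graph.\<close>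
    also have "\<eta> / \<epsilon>1 \<le> 4 / (9 * L\<^sup>2)" using eta1 e1 L by (simp add: field_simps)
    also have "\<eta> * (2 / (1 - \<epsilon>t\<^sup>2)) \<le> 1 * (2 / (1 - \<epsilon>t\<^sup>2))" using eta_le et2 by (intro mult_right_mono) auto
    finally have "\<eta> / (1 - r) \<le> 8/(9*L\<^sup>2) + 8/\<nu> + 2 / (1 - \<epsilon>t\<^sup>2)" by simp
    from mult_left_mono[OF this, of "s * p * \<eta> * (8 * (b + L / 2))"]
    show ?thesis using s eta b_ge L by (simp add: R_def power2_eq_square mult_ac)
  qed
  also have "K3 * r ^ k / ((1 - \<epsilon>t\<^sup>2) / 2) = (2 * K3 / (1 - \<epsilon>t\<^sup>2)) * r ^ k" by simp
  finally have "e k + h k \<le> (B0 + B1 + 2 * K3 / (1 - \<epsilon>t\<^sup>2)) * r ^ k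
      + (8 * (b + L / 2) * (8/(9*L\<^sup>2) + 8/\<nu> + 2 / (1 - \<epsilon>t\<^sup>2))) * (s * p * \<eta>)"
    by (simp add: algebra_simps)
  also have "\<dots> \<le> (B0 + B1 + 4 * K3 / (1 - \<epsilon>t\<^sup>2) + 8 * (b + L / 2) * (8/(9*L\<^sup>2) + 8/\<nu> + 2 / (1 - \<epsilon>t\<^sup>2))) * r ^ k
      + (B0 + B1 + 4 * K3 / (1 - \<epsilon>t\<^sup>2) + 8 * (b + L / 2) * (8/(9*L\<^sup>2) + 8/\<nu> + 2 / (1 - \<epsilon>t\<^sup>2))) * (s * p * \<eta>)"
  proof (rule add_mono[OF mult_right_mono mult_right_mono])
    have "0 \<le> K3 / (1 - \<epsilon>t\<^sup>2)" "0 \<le> 8 * (b + L / 2) * (8/(9*L\<^sup>2) + 8/\<nu> + 2 / (1 - \<epsilon>t\<^sup>2))"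
      using K3_nonneg et2 b_ge L nu by auto
    then show "B0 + B1 + 2 * K3 / (1 - \<epsilon>t\<^sup>2) \<le> B0 + B1 + 4 * K3 / (1 - \<epsilon>t\<^sup>2) + 8 * (b + L / 2) * (8/(9*L\<^sup>2) + 8/\<nu> + 2 / (1 - \<epsilon>t\<^sup>2))"
      "8 * (b + L / 2) * (8/(9*L\<^sup>2) + 8/\<nu> + 2 / (1 - \<epsilon>t\<^sup>2)) \<le> B0 + B1 + 4 * K3 / (1 - \<epsilon>t\<^sup>2) + 8 * (b + L / 2) * (8/(9*L\<^sup>2) + 8/\<nu> + 2 / (1 - \<epsilon>t\<^sup>2))"
      using K by auto
  qed (use r0 s eta in auto)
  finally show "e k + h k \<le> (B0 + B1 + 4 * K3 / (1 - \<epsilon>t\<^sup>2) + 8 * (b + L / 2) * (8/(9*L\<^sup>2) + 8/\<nu> + 2 / (1 - \<epsilon>t\<^sup>2)))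
       * (r ^ k + s * p * \<eta>)" by (simp only: distrib_left)
qed

end

text \<open>The witness for the uniform constant, written outside the locale so that its arguments
  visibly exclude \<open>n\<close>, \<open>p\<close>, \<open>\<eta>\<close> and the horizon. It
  dominates the five constants of the scalar bounds, \<open>1 / ln (1 / m)\<close> being the factor
  in the threshold on \<open>T\<close>. The absolute values and the summand 1 make it positive for
  all arguments, before any hypothesis on the graph is available.\<close>

definition zo_const :: "real \<Rightarrow> real \<Rightarrow> real \<Rightarrow> real \<Rightarrow> real \<Rightarrow> real \<Rightarrow> real \<Rightarrow> real \<Rightarrow> real \<Rightarrow> real" where
  "zo_const L a A s \<kappa> \<epsilon>t B0 B1 \<nu> =
    (let b = 1 + 1 / a;
         K2 = 8 * (9 * L\<^sup>2 / (2 * a)) * b + 4 * L;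
         K3 = B0 + B1 + L\<^sup>2 * (\<kappa>\<^sup>2 / (1 - \<epsilon>t\<^sup>2));
         c = min (a / 4) (1 / 2);
         m = max (1 - c) ((1 + \<epsilon>t\<^sup>2) / 2)
     in 1 + \<bar>(B0 + 2 * K3 + 2 * K2 + 8 * b) / c\<bar> + \<bar>1 / ln (1 / m)\<bar>
        + \<bar>B0 + 4 * K3 / (1 - \<epsilon>t\<^sup>2) + (32 * b * A * L * (K3 + K2) + 8 * b * s) / (1 - m)\<bar>
        + \<bar>4 * (K3 + K2)\<bar>
        + \<bar>B0 + B1 + 4 * K3 / (1 - \<epsilon>t\<^sup>2) + 8 * (b + L / 2) * (8/(9*L\<^sup>2) + 8/\<nu> + 2 / (1 - \<epsilon>t\<^sup>2))\<bar>)"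

lemma zo_const_pos: "0 < zo_const L a A s \<kappa> \<epsilon>t B0 B1 \<nu>"
  by (simp add: zo_const_def Let_def add_pos_nonneg)

context zo_recursion
begin

lemma zo_const_ge:
  fixes \<nu> :: real
  defines "C \<equiv> zo_const L a A s \<kappa> \<epsilon>t B0 B1 \<nu>"
  shows "(B0 + 2 * K3 + 2 * K2 + 8 * b) / c \<le> C" "1 / ln (1 / m) \<le> C"
    "B0 + 4 * K3 / (1 - \<epsilon>t\<^sup>2) + (32 * b * A * L * (K3 + K2) + 8 * b * s) / (1 - m) \<le> C"
    "4 * (K3 + K2) \<le> C"
    "B0 + B1 + 4 * K3 / (1 - \<epsilon>t\<^sup>2) + 8 * (b + L / 2) * (8/(9*L\<^sup>2) + 8/\<nu> + 2 / (1 - \<epsilon>t\<^sup>2)) \<le> C"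
proof -
  have C: "C = 1 + \<bar>(B0 + 2 * K3 + 2 * K2 + 8 * b) / c\<bar> + \<bar>1 / ln (1 / m)\<bar>
        + \<bar>B0 + 4 * K3 / (1 - \<epsilon>t\<^sup>2) + (32 * b * A * L * (K3 + K2) + 8 * b * s) / (1 - m)\<bar>
        + \<bar>4 * (K3 + K2)\<bar>
        + \<bar>B0 + B1 + 4 * K3 / (1 - \<epsilon>t\<^sup>2) + 8 * (b + L / 2) * (8/(9*L\<^sup>2) + 8/\<nu> + 2 / (1 - \<epsilon>t\<^sup>2))\<bar>"
    unfolding C_def zo_const_def Let_def b_def[symmetric] c_def[symmetric] m_def[symmetric] K2_def[symmetric] K3_def[symmetric] ..
  have le: "x1 \<le> 1 + \<bar>x1\<bar> + \<bar>x2\<bar> + \<bar>x3\<bar> + \<bar>x4\<bar> + \<bar>x5\<bar>" "x2 \<le> 1 + \<bar>x1\<bar> + \<bar>x2\<bar> + \<bar>x3\<bar> + \<bar>x4\<bar> + \<bar>x5\<bar>"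
    "x3 \<le> 1 + \<bar>x1\<bar> + \<bar>x2\<bar> + \<bar>x3\<bar> + \<bar>x4\<bar> + \<bar>x5\<bar>" "x4 \<le> 1 + \<bar>x1\<bar> + \<bar>x2\<bar> + \<bar>x3\<bar> + \<bar>x4\<bar> + \<bar>x5\<bar>"
    "x5 \<le> 1 + \<bar>x1\<bar> + \<bar>x2\<bar> + \<bar>x3\<bar> + \<bar>x4\<bar> + \<bar>x5\<bar>" for x1 x2 x3 x4 x5 :: real
    by linarith+
  show "(B0 + 2 * K3 + 2 * K2 + 8 * b) / c \<le> C" "1 / ln (1 / m) \<le> C"
    "B0 + 4 * K3 / (1 - \<epsilon>t\<^sup>2) + (32 * b * A * L * (K3 + K2) + 8 * b * s) / (1 - m) \<le> C"
    "4 * (K3 + K2) \<le> C"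
    "B0 + B1 + 4 * K3 / (1 - \<epsilon>t\<^sup>2) + 8 * (b + L / 2) * (8/(9*L\<^sup>2) + 8/\<nu> + 2 / (1 - \<epsilon>t\<^sup>2)) \<le> C"
    unfolding C by (rule le)+
qed

theorem zo_bounds:
  fixes \<nu> :: real
  defines "C \<equiv> zo_const L a A s \<kappa> \<epsilon>t B0 B1 \<nu>"
  shows "T \<ge> 1 \<Longrightarrow> (1 / real T) * (\<Sum>k<T. e k) \<le> C * (1 / real T + s * real p * \<eta>\<^sup>2)"
    and "T \<ge> 1 \<Longrightarrow> real T \<ge> C * ln (1 / (real p * \<eta>\<^sup>2)) \<Longrightarrow>
      e T \<le> C * (real p * \<eta>\<^sup>2 + s * (real p)\<^sup>2 * \<eta> ^ 4 * (1 / real n + \<eta>) * real T)"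
    and "T \<ge> 1 \<Longrightarrow> (1 / real T) * (\<Sum>k<T. G k) \<le> C * (1 / (\<eta> * real T) + s * (real p * \<eta> / real n + real p * \<eta>\<^sup>2))"
    and "\<nu> > 0 \<Longrightarrow> (\<And>k. 2 * \<nu> * h k \<le> G k) \<Longrightarrow>
      e k + h k \<le> C * ((1/2 + 1/2 * max (1 - min \<epsilon>1 (\<nu> * \<eta> / 4)) (\<epsilon>t\<^sup>2)) ^ k + s * real p * \<eta>)"
proof -
  note ge = zo_const_ge[of \<nu>, folded C_def]
  show "T \<ge> 1 \<Longrightarrow> (1 / real T) * (\<Sum>k<T. e k) \<le> C * (1 / real T + s * real p * \<eta>\<^sup>2)"
    by (rule order_trans[OF consensus_average mult_right_mono[OF ge(1)]]) (use s in auto)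
  show "T \<ge> 1 \<Longrightarrow> (1 / real T) * (\<Sum>k<T. G k) \<le> C * (1 / (\<eta> * real T) + s * (real p * \<eta> / real n + real p * \<eta>\<^sup>2))"
    by (rule order_trans[OF gradient_average mult_right_mono[OF ge(4)]]) (use s eta in auto)
  show "e T \<le> C * (real p * \<eta>\<^sup>2 + s * (real p)\<^sup>2 * \<eta> ^ 4 * (1 / real n + \<eta>) * real T)"
    if T: "T \<ge> 1" "real T \<ge> C * ln (1 / (real p * \<eta>\<^sup>2))"
  proof -
    \<comment> \<open>From p \<eta>^2 \<le> 1 the logarithm is nonnegative, so replacing
      \<open>1 / ln (1 / m)\<close> by the larger \<open>C\<close> strengthens the
      threshold.\<close>
    have "(p * \<eta>) * \<eta> \<le> (1/64) * (1/64)"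
      using p_eta eta_le eta by (intro mult_mono) auto
    then have "p * \<eta>\<^sup>2 \<le> 1" by (simp add: power2_eq_square)
    moreover have "0 < p * \<eta>\<^sup>2" using p eta by (intro mult_pos_pos zero_less_power) auto
    ultimately have "0 \<le> ln (1 / (p * \<eta>\<^sup>2))" by (intro ln_ge_zero) (simp add: field_simps)
    from mult_right_mono[OF ge(2) this] T(2)
    have "real T \<ge> 1 / ln (1 / m) * ln (1 / (p * \<eta>\<^sup>2))" by linarith
    from consensus_final[OF T(1) this]
    have "e T \<le> (B0 + 4 * K3 / (1 - \<epsilon>t\<^sup>2) + (32 * b * A * L * (K3 + K2) + 8 * b * s) / (1 - m))
     * (real p * \<eta>\<^sup>2 + s * (real p)\<^sup>2 * \<eta> ^ 4 * (1 / real n + \<eta>) * real T)" by simp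
    also have "\<dots> \<le> C * (real p * \<eta>\<^sup>2 + s * (real p)\<^sup>2 * \<eta> ^ 4 * (1 / real n + \<eta>) * real T)"
      using s eta by (intro mult_right_mono[OF ge(3)]) auto
    finally show ?thesis .
  qed
  show "e k + h k \<le> C * ((1/2 + 1/2 * max (1 - min \<epsilon>1 (\<nu> * \<eta> / 4)) (\<epsilon>t\<^sup>2)) ^ k + s * real p * \<eta>)"
    if nu: "\<nu> > 0" and PL: "\<And>k. 2 * \<nu> * h k \<le> G k"
    by (rule order_trans[OF linear_rate(3)[OF nu PL] mult_right_mono[OF ge(5)]])
       (use s eta linear_rate(1)[OF nu PL] in \<open>auto intro!: add_nonneg_nonneg zero_le_power\<close>)
qed

end

section \<open>Spectral bounds for the Laplacian\<close>

text \<open>By Tychonoff. Vectors live in \<open>nat \<Rightarrow> real\<close> with the product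
  topology, so the coordinates from \<open>n\<close> on are pinned to 0 in order to obtain a compact
  set.\<close>

lemma compact_box_fun: "compact {x :: nat \<Rightarrow> real. \<forall>i. x i \<in> (if i < n then {-1..1} else {0})}"
proof -
  have "compactin (product_topology (\<lambda>_. euclidean) UNIV) (\<Pi>\<^sub>E i\<in>UNIV. (if i < n then {-1..1::real} else {0}))"
    by (subst compactin_PiE) auto
  then show ?thesis
    by (simp add: euclidean_product_topology PiE_def Pi_def)
qed

text \<open>Compactness gives a maximiser on the unit sphere of the space orthogonal to
  \<open>w\<close>, and homogeneity of degree two carries the bound to all vectors of that space.
  The vector \<open>y0\<close> shows that the sphere is not empty; \<open>w\<close> may be zero, and
  then there is no constraint.\<close>

lemma sphere_attains_max:
  fixes B :: "nat \<Rightarrow> nat \<Rightarrow> real" and w y0 :: "nat \<Rightarrow> real"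
  assumes y0: "(\<Sum>i<n. y0 i * w i) = 0" "i0 < n" "y0 i0 \<noteq> 0"
  obtains v where "(\<Sum>i<n. (v i)\<^sup>2) = 1" "(\<Sum>i<n. v i * w i) = 0"
    "\<And>y. (\<Sum>i<n. y i * w i) = 0 \<Longrightarrow>
      (\<Sum>i<n. y i * (\<Sum>j<n. B i j * y j)) \<le> (\<Sum>i<n. v i * (\<Sum>j<n. B i j * v j)) * (\<Sum>i<n. (y i)\<^sup>2)"
proof -
  let ?q = "\<lambda>y. \<Sum>i<n. y i * (\<Sum>j<n. B i j * y j)"
  let ?N = "\<lambda>y :: nat \<Rightarrow> real. \<Sum>i<n. (y i)\<^sup>2"
  define K where "K = {x :: nat \<Rightarrow> real. \<forall>i. x i \<in> (if i < n then {-1..1} else {0})}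
      \<inter> ({x. ?N x = 1} \<inter> {x. (\<Sum>i<n. x i * w i) = 0})"
  have N_cont: "continuous_on UNIV ?N" "continuous_on UNIV (\<lambda>x. \<Sum>i<n. x i * w i)" "continuous_on UNIV ?q"
    by (auto intro!: continuous_intros continuous_on_product_coordinates)
  have "closed ({x. ?N x = 1} \<inter> {x. (\<Sum>i<n. x i * w i) = 0})"
    by (intro closed_Int closed_Collect_eq N_cont continuous_on_const)
  then have K: "compact K" unfolding K_def by (intro compact_Int_closed compact_box_fun)
  define sc where "sc y = (\<lambda>i. if i < n then y i / sqrt (?N y) else 0)" for y :: "nat \<Rightarrow> real"
  have pos: "0 < ?N y" if "i < n" "y i \<noteq> 0" for y :: "nat \<Rightarrow> real" and i
    using that by (intro sum_pos2[of _ i]) auto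
  have sc: "sc y \<in> K" if "(\<Sum>i<n. y i * w i) = 0" "0 < ?N y" for y
  proof -
    have "y i / sqrt (?N y) \<in> {-1..1}" if "i < n" for i
    proof -
      have "(y i)\<^sup>2 \<le> ?N y" using that by (intro member_le_sum) auto
      then have "\<bar>y i\<bar> \<le> sqrt (?N y)" by (simp add: real_le_rsqrt)
      then show ?thesis using \<open>0 < ?N y\<close> by (auto simp: field_simps abs_le_iff)
    qed
    moreover have "(\<Sum>i<n. (y i / sqrt (?N y))\<^sup>2) = 1"
      using that by (simp add: power_divide flip: sum_divide_distrib)
    moreover have "(\<Sum>i<n. y i / sqrt (?N y) * w i) = 0"
      using that by (simp flip: sum_divide_distrib)
    ultimately show ?thesis by (simp add: K_def sc_def)
  qed
  have "K \<noteq> {}" using sc[OF y0(1) pos[of i0 y0, OF y0(2,3)]] by auto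
  from continuous_attains_sup[OF K this continuous_on_subset[OF N_cont(3)]]
  obtain v where v: "v \<in> K" "\<And>y. y \<in> K \<Longrightarrow> ?q y \<le> ?q v" by auto
  show ?thesis
  proof (rule that)
    show "(\<Sum>i<n. (v i)\<^sup>2) = 1" "(\<Sum>i<n. v i * w i) = 0" using v(1) by (auto simp: K_def)
    fix y assume y: "(\<Sum>i<n. y i * w i) = 0"
    show "?q y \<le> ?q v * ?N y"
    proof (cases "\<exists>i<n. y i \<noteq> 0")
      case True
      then have N: "0 < ?N y" using pos by blast
      have "?q (sc y) = (\<Sum>i<n. y i * (\<Sum>j<n. B i j * y j) / ?N y)"
        using N by (intro sum.cong refl) (simp add: sc_def flip: sum_divide_distrib)
      then have "?q (sc y) = ?q y / ?N y" by (simp flip: sum_divide_distrib)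
      with v(2)[OF sc[OF y N]] N show ?thesis by (simp add: field_simps)
    qed simp
  qed
qed

text \<open>First-order condition at a maximum. The test point \<alpha> / (2 c) with c > |\<beta>|
  bounds the quadratic side by half of the linear one.\<close>

lemma linear_le_quadratic_imp_zero:
  fixes \<alpha> \<beta> :: real
  assumes "\<And>t. t * \<alpha> \<le> t\<^sup>2 * \<beta>"
  shows "\<alpha> = 0"
proof (rule ccontr)
  assume "\<alpha> \<noteq> 0"
  define c where "c = \<bar>\<beta>\<bar> + 1"
  have c: "0 < c" by (simp add: c_def)
  define t where "t = \<alpha> / (2 * c)"
  have "t * \<alpha> \<le> t\<^sup>2 * \<beta>" by (rule assms)
  also have "\<dots> \<le> t\<^sup>2 * c" by (intro mult_left_mono) (auto simp: c_def)
  also have "\<dots> = t * \<alpha> / 2" using c by (simp add: t_def power2_eq_square)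
  finally have "t * \<alpha> \<le> 0" by linarith
  moreover have "0 < t * \<alpha>" using \<open>\<alpha> \<noteq> 0\<close> c by (simp add: t_def flip: power2_eq_square)
  ultimately show False by simp
qed

text \<open>A variational route to an extremal eigenpair, without diagonalising. At the maximiser
  \<open>v\<close> the residual B v - \<mu> v is orthogonal to all admissible directions; by
  symmetry and B w = 0 it is itself orthogonal to \<open>w\<close>, hence admissible, hence
  orthogonal to itself.\<close>

lemma extremal_eigenvector:
  fixes B :: "nat \<Rightarrow> nat \<Rightarrow> real"
  assumes sym: "\<And>i j. i < n \<Longrightarrow> j < n \<Longrightarrow> B i j = B j i"
    and Bw: "\<And>i. i < n \<Longrightarrow> (\<Sum>j<n. B i j * w j) = 0"
    and y0: "(\<Sum>i<n. y0 i * w i) = 0" "i0 < n" "y0 i0 \<noteq> 0"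
  obtains \<mu> v where "(\<Sum>i<n. (v i)\<^sup>2) = 1" "(\<Sum>i<n. v i * w i) = 0"
    "\<And>i. i < n \<Longrightarrow> (\<Sum>j<n. B i j * v j) = \<mu> * v i"
    "\<And>y. (\<Sum>i<n. y i * w i) = 0 \<Longrightarrow> (\<Sum>i<n. y i * (\<Sum>j<n. B i j * y j)) \<le> \<mu> * (\<Sum>i<n. (y i)\<^sup>2)"
proof -
  let ?q = "\<lambda>y. \<Sum>i<n. y i * (\<Sum>j<n. B i j * y j)"
  from sphere_attains_max[OF y0, of B] obtain v where v: "(\<Sum>i<n. (v i)\<^sup>2) = 1" "(\<Sum>i<n. v i * w i) = 0"
    and max: "\<And>y. (\<Sum>i<n. y i * w i) = 0 \<Longrightarrow> ?q y \<le> ?q v * (\<Sum>i<n. (y i)\<^sup>2)" by blast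
  define \<mu> where "\<mu> = ?q v"
  have B_sym: "(\<Sum>i<n. x i * (\<Sum>j<n. B i j * y j)) = (\<Sum>i<n. y i * (\<Sum>j<n. B i j * x j))" for x y
    unfolding sum_distrib_left by (subst sum.swap, intro sum.cong refl) (simp add: sym mult_ac)
  have crit: "(\<Sum>i<n. y i * ((\<Sum>j<n. B i j * v j) - \<mu> * v i)) = 0" if y: "(\<Sum>i<n. y i * w i) = 0" for y
  proof -
    have "2 * (\<Sum>i<n. y i * ((\<Sum>j<n. B i j * v j) - \<mu> * v i)) = 0"
    proof (rule linear_le_quadratic_imp_zero[of _ "\<mu> * (\<Sum>i<n. (y i)\<^sup>2) - ?q y"])
      fix t :: real
      have "(\<Sum>i<n. (v i + t * y i) * w i) = 0"
        using v(2) y by (simp add: distrib_right sum.distrib mult.assoc flip: sum_distrib_left)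
      from max[OF this] have ineq: "?q (\<lambda>i. v i + t * y i) \<le> \<mu> * (\<Sum>i<n. (v i + t * y i)\<^sup>2)" by (simp add: \<mu>_def)
      have q: "?q (\<lambda>i. v i + t * y i) = \<mu> + 2 * t * (\<Sum>i<n. y i * (\<Sum>j<n. B i j * v j)) + t\<^sup>2 * ?q y"
      proof -
        have "?q (\<lambda>i. v i + t * y i) = ?q v + t * (\<Sum>i<n. y i * (\<Sum>j<n. B i j * v j))
            + t * (\<Sum>i<n. v i * (\<Sum>j<n. B i j * y j)) + t\<^sup>2 * ?q y"
          by (simp add: sum.distrib distrib_left distrib_right sum_distrib_left power2_eq_square mult_ac)
        then show ?thesis by (simp add: B_sym[of v y] \<mu>_def)
      qed
      have N: "(\<Sum>i<n. (v i + t * y i)\<^sup>2) = 1 + 2 * t * (\<Sum>i<n. y i * v i) + t\<^sup>2 * (\<Sum>i<n. (y i)\<^sup>2)"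
        by (simp add: power2_sum power_mult_distrib sum.distrib sum_distrib_left v(1) mult_ac)
      have cr: "(\<Sum>i<n. y i * ((\<Sum>j<n. B i j * v j) - \<mu> * v i))
          = (\<Sum>i<n. y i * (\<Sum>j<n. B i j * v j)) - \<mu> * (\<Sum>i<n. y i * v i)"
        by (simp add: right_diff_distrib sum_subtractf sum_distrib_left mult_ac)
      have *: "(\<mu> + 2 * t * c1 + t\<^sup>2 * c2 \<le> \<mu> * (1 + 2 * t * c3 + t\<^sup>2 * c4)) \<Longrightarrow>
          t * (2 * (c1 - \<mu> * c3)) \<le> t\<^sup>2 * (\<mu> * c4 - c2)" for c1 c2 c3 c4
        by (simp add: algebra_simps)
      show "t * (2 * (\<Sum>i<n. y i * ((\<Sum>j<n. B i j * v j) - \<mu> * v i))) \<le> t\<^sup>2 * (\<mu> * (\<Sum>i<n. (y i)\<^sup>2) - ?q y)"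
        unfolding cr by (rule *[OF ineq[unfolded q N]])
    qed
    then show ?thesis by simp
  qed
  define z where "z i = (\<Sum>j<n. B i j * v j) - \<mu> * v i" for i
  have "(\<Sum>i<n. z i * w i) = (\<Sum>i<n. w i * (\<Sum>j<n. B i j * v j)) - \<mu> * (\<Sum>i<n. v i * w i)"
  proof -
    have "z i * w i = w i * (\<Sum>j<n. B i j * v j) - \<mu> * (v i * w i)" for i
      by (simp add: z_def algebra_simps)
    then show ?thesis by (simp add: sum_subtractf sum_distrib_left)
  qed
  also have "(\<Sum>i<n. w i * (\<Sum>j<n. B i j * v j)) = 0" by (subst B_sym) (simp add: Bw)
  finally have "(\<Sum>i<n. z i * w i) = 0" by (simp add: v)
  from crit[OF this] have "(\<Sum>i<n. z i * z i) = 0" by (simp add: z_def)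
  then have "z i = 0" if "i < n" for i using that by (subst (asm) sum_nonneg_eq_0_iff) auto
  then have "(\<Sum>j<n. B i j * v j) = \<mu> * v i" if "i < n" for i using that by (auto simp: z_def)
  from that[OF v this max[folded \<mu>_def]] show ?thesis by blast
qed

lemma in_spectrum:
  assumes "C \<in> carrier_mat n n" "i0 < n" "v i0 \<noteq> (0::'a::field)"
    "\<And>i. i < n \<Longrightarrow> (\<Sum>j<n. C $$ (i, j) * v j) = \<mu> * v i"
  shows "\<mu> \<in> spectrum C"
proof -
  have "C *\<^sub>v vec n v = \<mu> \<cdot>\<^sub>v vec n v"
    using assms by (intro eq_vecI) (auto simp: scalar_prod_def lessThan_atLeast0 intro!: sum.cong)
  moreover have "vec n v \<noteq> 0\<^sub>v n" using assms by (metis index_vec index_zero_vec(1))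
  ultimately show ?thesis using assms(1)
    by (auto simp: spectrum_def eigenvalue_def eigenvector_def intro!: exI[of _ "vec n v"])
qed

section \<open>Spectral gap and norm of the Laplacian\<close>

context
  fixes n :: nat and E a
  assumes graph: "weighted_graph n E a" "connected_graph n E"
begin

abbreviation (input) "Lap \<equiv> laplacian n a"

lemma Lap_carrier: "Lap \<in> carrier_mat n n" by (simp add: laplacian_def)

lemma Lap_entry: "i < n \<Longrightarrow> j < n \<Longrightarrow> Lap $$ (i, j) = (if i = j then \<Sum>m<n. a i m else 0) - a i j"
  by (simp add: laplacian_def)

lemma a_sym: "i < n \<Longrightarrow> j < n \<Longrightarrow> a i j = a j i"
  and a_nonneg: "i < n \<Longrightarrow> j < n \<Longrightarrow> 0 \<le> a i j"
  using graph unfolding weighted_graph_def by (metis order.refl less_imp_le)+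

lemma Lap_sym: "i < n \<Longrightarrow> j < n \<Longrightarrow> Lap $$ (i, j) = Lap $$ (j, i)"
  by (simp add: Lap_entry a_sym)

lemma Lap_apply: "i < n \<Longrightarrow> (\<Sum>j<n. Lap $$ (i, j) * y j) = (\<Sum>j<n. a i j * (y i - y j))"
proof -
  assume i: "i < n"
  have "(\<Sum>j<n. Lap $$ (i, j) * y j) = (\<Sum>j<n. (if i = j then (\<Sum>m<n. a i m) * y j else 0) - a i j * y j)"
    using i by (intro sum.cong refl) (auto simp: Lap_entry left_diff_distrib)
  also have "\<dots> = (\<Sum>j<n. a i j * (y i - y j))"
    using i by (simp add: sum_subtractf sum.delta right_diff_distrib sum_distrib_right)
  finally show ?thesis .
qed

text \<open>The Dirichlet form: each edge is counted in both orientations, hence the factor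
  2.\<close>

lemma Lap_quadratic: "2 * (\<Sum>i<n. y i * (\<Sum>j<n. Lap $$ (i, j) * y j)) = (\<Sum>i<n. \<Sum>j<n. a i j * (y i - y j)\<^sup>2)"
proof -
  have "(\<Sum>i<n. \<Sum>j<n. a i j * (y i - y j)\<^sup>2) =
      (\<Sum>i<n. \<Sum>j<n. y i * (a i j * (y i - y j))) - (\<Sum>i<n. \<Sum>j<n. y j * (a i j * (y i - y j)))"
    by (simp add: power2_eq_square algebra_simps flip: sum_subtractf)
  also have "(\<Sum>i<n. \<Sum>j<n. y j * (a i j * (y i - y j))) = - (\<Sum>i<n. \<Sum>j<n. y i * (a i j * (y i - y j)))"
    by (subst sum.swap) (simp add: a_sym algebra_simps flip: sum_negf)
  finally show ?thesis by (simp add: Lap_apply sum_distrib_left)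
qed

lemma column_sum_zero: "m < n \<Longrightarrow> (\<Sum>i<n. Lap $$ (i, m)) = 0"
  using Lap_apply[of m "\<lambda>_. 1"] by (simp add: Lap_sym)

lemma Lap_sum_zero: "(\<Sum>i<n. \<Sum>m<n. Lap $$ (i, m) * y m) = 0"
  by (subst sum.swap) (simp add: column_sum_zero flip: sum_distrib_right)

text \<open>Maximising the form of \<open>- Lap\<close> on the complement of the constants produces
  the smallest eigenvalue of \<open>Lap\<close> there, namely \<open>- \<mu>\<close>. It is
  nonnegative by the Dirichlet form and nonzero by connectivity, so it is among the values over
  which \<open>rho2\<close> takes the minimum.\<close>

lemma Lap_coercive:
  assumes y: "(\<Sum>i<n. y i) = 0"
  shows "rho2 Lap * (\<Sum>i<n. (y i)\<^sup>2) \<le> (\<Sum>i<n. y i * (\<Sum>j<n. Lap $$ (i, j) * y j))"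
proof (cases "\<exists>i<n. y i \<noteq> 0")
  case True
  then obtain i0 where i0: "i0 < n" "y i0 \<noteq> 0" by blast
  obtain \<mu> v where v: "(\<Sum>i<n. (v i)\<^sup>2) = 1" "(\<Sum>i<n. v i * 1) = 0"
    "\<And>i. i < n \<Longrightarrow> (\<Sum>j<n. - Lap $$ (i, j) * v j) = \<mu> * v i"
    "\<And>y. (\<Sum>i<n. y i * 1) = 0 \<Longrightarrow> (\<Sum>i<n. y i * (\<Sum>j<n. - Lap $$ (i, j) * y j)) \<le> \<mu> * (\<Sum>i<n. (y i)\<^sup>2)"
    by (rule extremal_eigenvector[of n "\<lambda>i j. - Lap $$ (i, j)" "\<lambda>_. 1" y i0])
       (use i0 y Lap_apply[of _ "\<lambda>_. 1"] in \<open>auto simp: Lap_sym sum_negf\<close>)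
  have ev: "(\<Sum>j<n. Lap $$ (i, j) * v j) = (- \<mu>) * v i" if "i < n" for i
    using v(3)[OF that] by (simp add: sum_negf)
  have "\<exists>i<n. v i \<noteq> 0"
  proof (rule ccontr)
    assume "\<not> ?thesis"
    then show False using v(1) by simp
  qed
  then obtain i1 where i1: "i1 < n" "v i1 \<noteq> 0" by blast
  have "(\<Sum>i<n. v i * (\<Sum>j<n. Lap $$ (i, j) * v j)) = (\<Sum>i<n. - \<mu> * (v i)\<^sup>2)"
    by (intro sum.cong refl) (simp add: ev power2_eq_square)
  also have "\<dots> = - \<mu>" using v(1) by (simp only: flip: sum_distrib_left)
  finally have mu: "2 * (- \<mu>) = (\<Sum>i<n. \<Sum>j<n. a i j * (v i - v j)\<^sup>2)"
    using Lap_quadratic[of v] by simp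
  \<comment> \<open>Vanishing Dirichlet energy makes \<open>v\<close> constant along edges, hence
    constant on the connected graph; having zero sum, it would vanish, against
    \<open>v i1 \<noteq> 0\<close>.\<close>
  have "- \<mu> \<noteq> 0"
  proof
    assume "- \<mu> = 0"
    with mu have "(\<Sum>i<n. \<Sum>j<n. a i j * (v i - v j)\<^sup>2) = 0" by simp
    moreover have nn: "0 \<le> (\<Sum>j<n. a i j * (v i - v j)\<^sup>2)" if "i \<in> {..<n}" for i
      using that by (auto intro!: sum_nonneg mult_nonneg_nonneg a_nonneg)
    ultimately have "(\<Sum>j<n. a i j * (v i - v j)\<^sup>2) = 0" if "i < n" for i
      using that sum_nonneg_eq_0_iff[OF finite_lessThan nn] by simp
    then have *: "a i j * (v i - v j)\<^sup>2 = 0" if "i < n" "j < n" for i j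
      using that sum_nonneg_eq_0_iff[of "{..<n}" "\<lambda>j. a i j * (v i - v j)\<^sup>2"] by (simp add: a_nonneg)
    have edge: "v i = v j" if "(i, j) \<in> E" for i j
    proof -
      have "i < n" "j < n" "a i j > 0" using that graph(1) unfolding weighted_graph_def by auto
      with *[of i j] show ?thesis by simp
    qed
    have "v i = v j" if "(i, j) \<in> E\<^sup>*" for i j
      using that by (induction rule: rtrancl_induct) (auto simp: edge)
    then have "v i = v i1" if "i < n" for i using that i1 graph(2) unfolding connected_graph_def by blast
    then have "(\<Sum>i<n. v i * 1) = n * v i1" by simp
    with v(2) i1 show False by simp
  qed
  moreover have "0 \<le> - \<mu>" using mu a_nonneg by (smt (verit) lessThan_iff mult_nonneg_nonneg sum_nonneg zero_le_power2)
  moreover have "- \<mu> \<in> spectrum Lap"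
    by (rule in_spectrum[OF Lap_carrier i1 ev])
  ultimately have "rho2 Lap \<le> - \<mu>"
    unfolding rho2_def using card_finite_spectrum(1)[OF Lap_carrier] by (intro Min_le) auto
  then have "rho2 Lap * (\<Sum>i<n. (y i)\<^sup>2) \<le> - \<mu> * (\<Sum>i<n. (y i)\<^sup>2)"
    by (intro mult_right_mono sum_nonneg) auto
  also have "\<dots> \<le> (\<Sum>i<n. y i * (\<Sum>j<n. Lap $$ (i, j) * y j))"
    using v(4)[of y] y by (simp add: sum_negf)
  finally show ?thesis .
qed simp

text \<open>By symmetry of \<open>Lap\<close> the left side is the quadratic form of
  \<open>Lap * Lap\<close>. The constraint vector is 0 this time, so the extremal eigenvalue is the
  largest one of \<open>Lap * Lap\<close>, and the spectral radius dominates it.\<close>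

lemma Lap_bounded:
  "(\<Sum>i<n. (\<Sum>j<n. Lap $$ (i, j) * y j)\<^sup>2) \<le> rho (Lap * Lap) * (\<Sum>i<n. (y i)\<^sup>2)"
proof (cases "\<exists>i<n. y i \<noteq> 0")
  case True
  then obtain i0 where i0: "i0 < n" "y i0 \<noteq> 0" by blast
  have LL: "(Lap * Lap) $$ (i, j) = (\<Sum>m<n. Lap $$ (i, m) * Lap $$ (m, j))" if "i < n" "j < n" for i j
    using that Lap_carrier by (auto simp: scalar_prod_def lessThan_atLeast0)
  have LL_sym: "(Lap * Lap) $$ (i, j) = (Lap * Lap) $$ (j, i)" if "i < n" "j < n" for i j
    unfolding LL[OF that] LL[OF that(2,1)]
  proof (rule sum.cong[OF refl])
    fix m assume "m \<in> {..<n}"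
    then show "Lap $$ (i, m) * Lap $$ (m, j) = Lap $$ (j, m) * Lap $$ (m, i)"
      using Lap_sym[of m i] Lap_sym[of m j] that by simp
  qed
  have LLc: "Lap * Lap \<in> carrier_mat n n" using Lap_carrier by simp
  obtain \<mu> v where v: "(\<Sum>i<n. (v i)\<^sup>2) = 1" "(\<Sum>i<n. v i * 0) = 0"
    "\<And>i. i < n \<Longrightarrow> (\<Sum>j<n. (Lap * Lap) $$ (i, j) * v j) = \<mu> * v i"
    "\<And>y. (\<Sum>i<n. y i * 0) = 0 \<Longrightarrow> (\<Sum>i<n. y i * (\<Sum>j<n. (Lap * Lap) $$ (i, j) * y j)) \<le> \<mu> * (\<Sum>i<n. (y i)\<^sup>2)"
    by (rule extremal_eigenvector[of n "\<lambda>i j. (Lap * Lap) $$ (i, j)" "\<lambda>_. 0" y i0])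
       (use i0 LL_sym in auto)
  have "\<exists>i<n. v i \<noteq> 0"
  proof (rule ccontr)
    assume "\<not> ?thesis"
    then show False using v(1) by simp
  qed
  then obtain i1 where i1: "i1 < n" "v i1 \<noteq> 0" by blast
  \<comment> \<open>\<open>rho\<close> is defined over the complex numbers, so the real eigenvector
    is embedded there.\<close>
  have "complex_of_real \<mu> \<in> spectrum (map_mat complex_of_real (Lap * Lap))"
  proof (rule in_spectrum[of _ n i1 "\<lambda>i. complex_of_real (v i)"])
    fix i assume i: "i < n"
    have "(\<Sum>j<n. map_mat complex_of_real (Lap * Lap) $$ (i, j) * complex_of_real (v j))
      = complex_of_real (\<Sum>j<n. (Lap * Lap) $$ (i, j) * v j)"
      using i LLc by (simp add: laplacian_def)
    then show "(\<Sum>j<n. map_mat complex_of_real (Lap * Lap) $$ (i, j) * complex_of_real (v j))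
       = complex_of_real \<mu> * complex_of_real (v i)" using v(3)[OF i] by simp
  qed (use i1 LLc in auto)
  then have "norm (complex_of_real \<mu>) \<le> rho (Lap * Lap)"
    unfolding rho_def using i1 LLc by (intro spectral_radius_mem_max(2)[of _ n] imageI) auto
  then have mu: "\<mu> \<le> rho (Lap * Lap)" by simp
  have "(\<Sum>i<n. (\<Sum>j<n. Lap $$ (i, j) * y j)\<^sup>2) = (\<Sum>m<n. \<Sum>i<n. \<Sum>j<n. (Lap $$ (m, i) * y i) * (Lap $$ (m, j) * y j))"
    by (simp add: power2_eq_square sum_product)
  also have "\<dots> = (\<Sum>i<n. \<Sum>m<n. \<Sum>j<n. (Lap $$ (m, i) * y i) * (Lap $$ (m, j) * y j))"
    by (rule sum.swap)
  also have "\<dots> = (\<Sum>i<n. \<Sum>j<n. \<Sum>m<n. (Lap $$ (m, i) * y i) * (Lap $$ (m, j) * y j))"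
    by (rule sum.cong[OF refl]) (rule sum.swap)
  also have "\<dots> = (\<Sum>i<n. y i * (\<Sum>j<n. (Lap * Lap) $$ (i, j) * y j))"
  proof (rule sum.cong[OF refl])
    fix i assume i: "i \<in> {..<n}"
    show "(\<Sum>j<n. \<Sum>m<n. (Lap $$ (m, i) * y i) * (Lap $$ (m, j) * y j)) = y i * (\<Sum>j<n. (Lap * Lap) $$ (i, j) * y j)"
      unfolding sum_distrib_left
    proof (rule sum.cong[OF refl])
      fix j assume j: "j \<in> {..<n}"
      have "(\<Sum>m<n. (Lap $$ (m, i) * y i) * (Lap $$ (m, j) * y j)) = (\<Sum>m<n. y i * y j * (Lap $$ (i, m) * Lap $$ (m, j)))"
        using i Lap_sym[of i] by (intro sum.cong refl) simp
      also have "\<dots> = y i * ((Lap * Lap) $$ (i, j) * y j)"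
        using i j by (simp add: LL flip: sum_distrib_left)
      finally show "(\<Sum>m<n. (Lap $$ (m, i) * y i) * (Lap $$ (m, j) * y j)) = y i * ((Lap * Lap) $$ (i, j) * y j)" .
    qed
  qed
  also have "\<dots> \<le> \<mu> * (\<Sum>i<n. (y i)\<^sup>2)" using v(4)[of y] by simp
  also have "\<dots> \<le> rho (Lap * Lap) * (\<Sum>i<n. (y i)\<^sup>2)" using mu by (intro mult_right_mono sum_nonneg) auto
  finally show ?thesis .
qed simp

end

section \<open>Smooth functions\<close>

lemma Rn_eq: "Rn p = extensional {..<p}"
  by (simp add: Rn_def lborel_vec_def space_PiM PiE_def)

lemma Rn_restrict [simp, intro]: "(\<lambda>j\<in>{..<p}. f j) \<in> Rn p"
  by (simp add: Rn_eq)

lemma Rn_eqI: "x \<in> Rn p \<Longrightarrow> y \<in> Rn p \<Longrightarrow> (\<And>j. j < p \<Longrightarrow> x j = y j) \<Longrightarrow> x = y"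
  by (auto simp: Rn_eq intro: extensionalityI)

lemma vdiff_Rn [simp, intro]: "vdiff p x y \<in> Rn p"
  by (simp add: vdiff_def)

lemma vdiff_apply [simp]: "j < p \<Longrightarrow> vdiff p x y j = x j - y j"
  by (simp add: vdiff_def)

lemma vnorm_sq: "(vnorm p x)\<^sup>2 = (\<Sum>j<p. (x j)\<^sup>2)"
  by (simp add: vnorm_def L2_set_def sum_nonneg)

lemma vnorm_nonneg [simp]: "0 \<le> vnorm p x"
  by (simp add: vnorm_def)

lemma vnorm_cong: "(\<And>j. j < p \<Longrightarrow> x j = y j) \<Longrightarrow> vnorm p x = vnorm p y"
  unfolding vnorm_def by (rule L2_set_cong) auto

lemma vnorm_scale: "vnorm p (\<lambda>j. t * x j) = \<bar>t\<bar> * vnorm p x"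
  by (simp add: vnorm_def L2_set_def power_mult_distrib real_sqrt_mult flip: sum_distrib_left)

lemma inner_le_vnorm: "\<bar>\<Sum>j<p. x j * y j\<bar> \<le> vnorm p x * vnorm p y"
proof -
  have "\<bar>\<Sum>j<p. x j * y j\<bar> \<le> (\<Sum>j<p. \<bar>x j\<bar> * \<bar>y j\<bar>)"
    by (rule order_trans[OF sum_abs]) (simp add: abs_mult)
  also have "\<dots> \<le> vnorm p x * vnorm p y" unfolding vnorm_def by (rule L2_set_mult_ineq)
  finally show ?thesis .
qed

text \<open>The direction may be any function: its values outside the index set are discarded, so
  directions such as \<open>axis_vec j\<close> need not be points of \<open>Rn p\<close>.\<close>

definition move :: "nat \<Rightarrow> rvec \<Rightarrow> real \<Rightarrow> rvec \<Rightarrow> rvec" where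
  "move p x t d = (\<lambda>j\<in>{..<p}. x j + t * d j)"

lemma vnorm_le_dual:
  assumes "0 \<le> c" "\<And>v. (\<Sum>j<p. v j * w j) \<le> c * vnorm p v"
  shows "vnorm p w \<le> c"
proof (cases "vnorm p w = 0")
  case False
  have "vnorm p w * vnorm p w \<le> c * vnorm p w"
    using assms(2)[of w] vnorm_sq[of p w] by (simp add: power2_eq_square)
  then show ?thesis using False by (simp add: mult_le_cancel_right order_less_le)
qed (use assms(1) in simp)

lemma move_Rn [simp, intro]: "move p x t d \<in> Rn p" by (simp add: move_def)

lemma move_apply [simp]: "j < p \<Longrightarrow> move p x t d j = x j + t * d j" by (simp add: move_def)

lemma move_0 [simp]: "x \<in> Rn p \<Longrightarrow> move p x 0 d = x" by (rule Rn_eqI) auto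

lemma vnorm_move_diff: "vnorm p (vdiff p (move p x t d) (move p x s d)) = \<bar>t - s\<bar> * vnorm p d"
  by (subst vnorm_scale[symmetric], rule vnorm_cong) (simp add: algebra_simps)

lemma vnorm_move_diff0: "vnorm p (vdiff p (move p x t d) x) = \<bar>t\<bar> * vnorm p d"
  by (subst vnorm_scale[symmetric], rule vnorm_cong) simp

lemma is_grad_deriv:
  assumes g: "is_grad p h (move p x t d) g"
  shows "((\<lambda>t. h (move p x t d)) has_real_derivative (\<Sum>j<p. g j * d j)) (at t)"
  unfolding has_field_derivative_def has_derivative_at'
proof (intro conjI allI impI)
  fix e :: real assume e: "e > 0"
  \<comment> \<open>The summand 1 covers the zero direction.\<close>
  define e' where "e' = e / (2 * (vnorm p d + 1))"
  have e': "e' > 0" "e' * vnorm p d < e"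
  proof -
    show "e' > 0" using e by (simp add: e'_def add_nonneg_pos)
    have "e' * vnorm p d \<le> e' * (vnorm p d + 1)" using \<open>e' > 0\<close> by (intro mult_left_mono) auto
    also have "\<dots> = e / 2"
    proof -
      have *: "e / (2 * c) * c = e / 2" if "c > 0" for c :: real using that by simp
      have "0 < vnorm p d + 1" using vnorm_nonneg[of p d] by linarith
      from *[OF this] show ?thesis by (simp only: e'_def)
    qed
    finally show "e' * vnorm p d < e" using e by simp
  qed
  from g e'(1) obtain \<delta> where \<delta>: "\<delta> > 0" and b: "\<And>y. y \<in> Rn p \<Longrightarrow> vnorm p (vdiff p y (move p x t d)) < \<delta> \<Longrightarrow>
        \<bar>h y - h (move p x t d) - (\<Sum>j<p. g j * (y j - move p x t d j))\<bar> \<le> e' * vnorm p (vdiff p y (move p x t d))"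
    unfolding is_grad_def by blast
  show "\<exists>\<delta>>0. \<forall>s. 0 < norm (s - t) \<and> norm (s - t) < \<delta> \<longrightarrow>
      norm (h (move p x s d) - h (move p x t d) - (\<Sum>j<p. g j * d j) * (s - t)) / norm (s - t) < e"
  proof (intro exI[of _ "\<delta> / (vnorm p d + 1)"] conjI allI impI)
    show "0 < \<delta> / (vnorm p d + 1)" using \<delta> by (simp add: add_nonneg_pos)
    fix s assume s: "0 < norm (s - t) \<and> norm (s - t) < \<delta> / (vnorm p d + 1)"
    have pos: "0 < vnorm p d + 1" by (simp add: add_nonneg_pos)
    have "\<bar>s - t\<bar> * vnorm p d \<le> \<bar>s - t\<bar> * (vnorm p d + 1)" by (intro mult_left_mono) auto
    also have "\<dots> < \<delta>" using s pos by (simp add: pos_less_divide_eq)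
    finally have "\<bar>h (move p x s d) - h (move p x t d) - (\<Sum>j<p. g j * (move p x s d j - move p x t d j))\<bar> \<le> e' * (\<bar>s - t\<bar> * vnorm p d)"
      using b[of "move p x s d"] by (simp add: vnorm_move_diff)
    moreover have "(\<Sum>j<p. g j * (move p x s d j - move p x t d j)) = (\<Sum>j<p. g j * d j) * (s - t)"
      unfolding sum_distrib_right by (intro sum.cong refl) (simp add: algebra_simps)
    ultimately have "norm (h (move p x s d) - h (move p x t d) - (\<Sum>j<p. g j * d j) * (s - t)) \<le> e' * (\<bar>s - t\<bar> * vnorm p d)"
      by simp
    also have "\<dots> < e * norm (s - t)"
      using mult_strict_right_mono[OF e'(2), of "\<bar>s - t\<bar>"] s by (simp add: mult_ac)
    finally show "norm (h (move p x s d) - h (move p x t d) - (\<Sum>j<p. g j * d j) * (s - t)) / norm (s - t) < e"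
      using s by (subst pos_divide_less_eq) auto
  qed
qed (rule bounded_linear_mult_right)

definition axis_vec :: "nat \<Rightarrow> rvec" where "axis_vec i = (\<lambda>j. if j = i then 1 else 0)"

lemma sum_unit: "i < p \<Longrightarrow> (\<Sum>j<p. g j * axis_vec i j) = g i"
  by (simp add: axis_vec_def if_distrib cong: if_cong)

text \<open>Derivatives along the coordinate axes determine every entry; this is what gives the
  description \<open>THE\<close> in \<open>grad\<close> its meaning.\<close>

lemma is_grad_unique:
  assumes "x \<in> Rn p" "is_grad p h x g" "is_grad p h x g'"
  shows "g = g'"
proof (rule Rn_eqI[of _ p])
  show "g \<in> Rn p" "g' \<in> Rn p" using assms by (auto simp: is_grad_def)
  fix i assume i: "i < p"
  from is_grad_deriv[of p h x 0 "axis_vec i" g] is_grad_deriv[of p h x 0 "axis_vec i" g'] assms i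
  show "g i = g' i" by (simp add: sum_unit) (rule DERIV_unique)
qed

lemma grad_eq: "x \<in> Rn p \<Longrightarrow> is_grad p h x g \<Longrightarrow> grad p h x = g"
  unfolding grad_def using is_grad_unique by blast

lemma is_grad_grad: "x \<in> Rn p \<Longrightarrow> lipschitz_grad p L h \<Longrightarrow> is_grad p h x (grad p h x)"
  unfolding lipschitz_grad_def using grad_eq by metis

lemma lipschitz_gradD: "x \<in> Rn p \<Longrightarrow> y \<in> Rn p \<Longrightarrow> lipschitz_grad p L h \<Longrightarrow>
    vnorm p (vdiff p (grad p h x) (grad p h y)) \<le> L * vnorm p (vdiff p x y)"
  unfolding lipschitz_grad_def by blast

text \<open>Along the segment the derivative differs from its value at 0 by at most L t times the
  squared norm of \<open>d\<close>. Subtracting or adding the matching quadratic gives a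
  nonincreasing and a nondecreasing function on [0, 1], so no integral of the gradient is
  formed.\<close>

lemma smooth_bound:
  assumes h: "lipschitz_grad p L h" and x: "x \<in> Rn p"
  shows "\<bar>h (move p x 1 d) - h x - (\<Sum>j<p. grad p h x j * d j)\<bar> \<le> L / 2 * (vnorm p d)\<^sup>2"
proof -
  define \<phi>' where "\<phi>' t = (\<Sum>j<p. grad p h (move p x t d) j * d j)" for t
  have der: "((\<lambda>t. h (move p x t d)) has_real_derivative \<phi>' t) (at t)" for t
    unfolding \<phi>'_def by (rule is_grad_deriv, rule is_grad_grad[OF _ h]) simp
  have bd: "\<bar>\<phi>' t - \<phi>' 0\<bar> \<le> L * t * (vnorm p d)\<^sup>2" if "0 \<le> t" for t
  proof -
    have "\<phi>' t - \<phi>' 0 = (\<Sum>j<p. vdiff p (grad p h (move p x t d)) (grad p h x) j * d j)"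
      using x by (simp add: \<phi>'_def sum_subtractf left_diff_distrib)
    also have "\<bar>\<dots>\<bar> \<le> vnorm p (vdiff p (grad p h (move p x t d)) (grad p h x)) * vnorm p d"
      by (rule inner_le_vnorm)
    also have "\<dots> \<le> (L * (\<bar>t\<bar> * vnorm p d)) * vnorm p d"
      using lipschitz_gradD[OF _ x h, of "move p x t d"]
      by (intro mult_right_mono) (auto simp: vnorm_move_diff0)
    finally show ?thesis using that by (simp add: power2_eq_square mult_ac)
  qed
  define \<psi>1 where "\<psi>1 t = h (move p x t d) - t * \<phi>' 0 - L / 2 * (vnorm p d)\<^sup>2 * t\<^sup>2" for t
  define \<psi>2 where "\<psi>2 t = h (move p x t d) - t * \<phi>' 0 + L / 2 * (vnorm p d)\<^sup>2 * t\<^sup>2" for t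
  have 1: "\<psi>1 1 \<le> \<psi>1 0"
  proof (rule DERIV_nonpos_imp_nonincreasing[of 0 1])
    fix t :: real assume t: "0 \<le> t" "t \<le> 1"
    show "\<exists>y. (\<psi>1 has_real_derivative y) (at t) \<and> y \<le> 0"
      unfolding \<psi>1_def[abs_def] using bd[OF t(1)] by (intro exI[of _ "\<phi>' t - \<phi>' 0 - L * (vnorm p d)\<^sup>2 * t"] conjI)
        (auto intro!: derivative_eq_intros der simp: mult_ac)
  qed simp
  have 2: "\<psi>2 0 \<le> \<psi>2 1"
  proof (rule DERIV_nonneg_imp_nondecreasing[of 0 1])
    fix t :: real assume t: "0 \<le> t" "t \<le> 1"
    show "\<exists>y. (\<psi>2 has_real_derivative y) (at t) \<and> 0 \<le> y"
      unfolding \<psi>2_def[abs_def] using bd[OF t(1)] by (intro exI[of _ "\<phi>' t - \<phi>' 0 + L * (vnorm p d)\<^sup>2 * t"] conjI)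
        (auto intro!: derivative_eq_intros der simp: mult_ac)
  qed simp
  have "\<phi>' 0 = (\<Sum>j<p. grad p h x j * d j)" using x by (simp add: \<phi>'_def)
  then show ?thesis using 1 2 x unfolding abs_le_iff by (simp add: \<psi>1_def \<psi>2_def)
qed

text \<open>A quadratic remainder bound survives taking expectations, which plain differentiability
  need not; the gradients of means and expectations are recovered through this criterion.\<close>

lemma is_gradI:
  assumes g: "g \<in> Rn p" and x: "x \<in> Rn p" and c: "0 \<le> c"
    and b: "\<And>d. \<bar>h (move p x 1 d) - h x - (\<Sum>j<p. g j * d j)\<bar> \<le> c * (vnorm p d)\<^sup>2"
  shows "is_grad p h x g"
  unfolding is_grad_def
proof (intro conjI allI impI g)
  fix e :: real assume e: "e > 0"
  show "\<exists>d>0. \<forall>y\<in>Rn p. vnorm p (vdiff p y x) < d \<longrightarrow>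
        \<bar>h y - h x - (\<Sum>j<p. g j * (y j - x j))\<bar> \<le> e * vnorm p (vdiff p y x)"
  proof (intro exI[of _ "e / (c + 1)"] conjI ballI impI)
    show "0 < e / (c + 1)" using e c by simp
    fix y assume y: "y \<in> Rn p" "vnorm p (vdiff p y x) < e / (c + 1)"
    have "move p x 1 (vdiff p y x) = y" using y by (intro Rn_eqI) auto
    moreover have "(\<Sum>j<p. g j * vdiff p y x j) = (\<Sum>j<p. g j * (y j - x j))"
      by (intro sum.cong) auto
    ultimately have "\<bar>h y - h x - (\<Sum>j<p. g j * (y j - x j))\<bar> \<le> c * (vnorm p (vdiff p y x))\<^sup>2"
      using b[of "vdiff p y x"] by simp
    also have "\<dots> \<le> (c + 1) * vnorm p (vdiff p y x) * vnorm p (vdiff p y x)"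
      by (simp add: power2_eq_square algebra_simps)
    also have "\<dots> \<le> e * vnorm p (vdiff p y x)"
      using y c by (intro mult_right_mono) (auto simp: field_simps)
    finally show "\<bar>h y - h x - (\<Sum>j<p. g j * (y j - x j))\<bar> \<le> e * vnorm p (vdiff p y x)" .
  qed
qed

text \<open>Writes a partial derivative as the limit of a sequence of expressions in function
  values, which is how gradients are shown to be measurable, in the point as well as in the
  sample.\<close>

definition diff_quot :: "nat \<Rightarrow> (rvec \<Rightarrow> real) \<Rightarrow> nat \<Rightarrow> rvec \<Rightarrow> nat \<Rightarrow> real" where
  "diff_quot p h j x m = real (Suc m) * (h (move p x (1 / real (Suc m)) (axis_vec j)) - h x)"

lemma diff_quot_limit:
  assumes x: "x \<in> Rn p" and g: "is_grad p h x g" and j: "j < p"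
  shows "diff_quot p h j x \<longlonglongrightarrow> g j"
proof -
  have "((\<lambda>t. h (move p x t (axis_vec j))) has_real_derivative g j) (at 0)"
    using is_grad_deriv[of p h x 0 "axis_vec j" g] x g j by (simp add: sum_unit)
  then have "((\<lambda>t. (h (move p x t (axis_vec j)) - h x) / t) \<longlongrightarrow> g j) (at 0)"
    using x by (simp add: has_field_derivative_iff)
  moreover have "filterlim (\<lambda>m. 1 / real (Suc m)) (at 0) sequentially"
    unfolding filterlim_at using LIMSEQ_inverse_real_of_nat by (simp add: inverse_eq_divide)
  ultimately have "(\<lambda>m. (h (move p x (1 / real (Suc m)) (axis_vec j)) - h x) / (1 / real (Suc m))) \<longlonglongrightarrow> g j"
    by (rule filterlim_compose)
  then show ?thesis by (simp add: diff_quot_def[abs_def] mult.commute)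
qed

lemma lim_diff_quot:
  "x \<in> Rn p \<Longrightarrow> lipschitz_grad p L h \<Longrightarrow> j < p \<Longrightarrow> lim (diff_quot p h j x) = grad p h x j"
  using diff_quot_limit is_grad_grad limI by blast

text \<open>A gradient step with factor 1/L lowers the value by at least the squared gradient norm
  over 2 L, and no value lies below the infimum.\<close>

lemma gradient_le_gap:
  assumes h: "lipschitz_grad p L h" and x: "x \<in> Rn p" and L: "L > 0" and bdd: "bdd_below (h ` Rn p)"
  shows "(vnorm p (grad p h x))\<^sup>2 \<le> 2 * L * (h x - min_value p h)"
proof -
  define g where "g = grad p h x"
  have "min_value p h \<le> h (move p x 1 (\<lambda>j. (- 1 / L) * g j))"
    unfolding min_value_def using bdd by (intro cINF_lower) auto
  also have "\<dots> \<le> h x + (\<Sum>j<p. g j * ((- 1 / L) * g j)) + L / 2 * (vnorm p (\<lambda>j. (- 1 / L) * g j))\<^sup>2"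
    using smooth_bound[OF h x, of "\<lambda>j. (- 1 / L) * g j"] unfolding g_def[symmetric] abs_le_iff by linarith
  also have "(\<Sum>j<p. g j * ((- 1 / L) * g j)) = (\<Sum>j<p. (- 1 / L) * (g j)\<^sup>2)"
    by (intro sum.cong) (auto simp: power2_eq_square)
  also have "\<dots> = - (vnorm p g)\<^sup>2 / L"
    unfolding vnorm_sq by (simp only: flip: sum_distrib_left) simp
  also have "L / 2 * (vnorm p (\<lambda>j. (- 1 / L) * g j))\<^sup>2 = (vnorm p g)\<^sup>2 / (2 * L)"
    unfolding vnorm_scale using L by (simp add: power2_eq_square)
  finally show ?thesis using L by (simp add: g_def field_simps)
qed

lemma min_value_le: "bdd_below (h ` Rn p) \<Longrightarrow> x \<in> Rn p \<Longrightarrow> min_value p h \<le> h x"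
  unfolding min_value_def by (intro cINF_lower) auto

text \<open>The Lipschitz bound is assumed in dual form, which survives averaging over a finite set as well
  as taking expectations.\<close>

lemma lipschitz_gradI:
  assumes L: "0 \<le> L" and g: "\<And>x. x \<in> Rn p \<Longrightarrow> g x \<in> Rn p"
    and b: "\<And>x d. x \<in> Rn p \<Longrightarrow> \<bar>h (move p x 1 d) - h x - (\<Sum>j<p. g x j * d j)\<bar> \<le> L / 2 * (vnorm p d)\<^sup>2"
    and lip: "\<And>x y v. x \<in> Rn p \<Longrightarrow> y \<in> Rn p \<Longrightarrow>
       (\<Sum>j<p. v j * (g x j - g y j)) \<le> L * vnorm p (vdiff p x y) * vnorm p v"
  shows "lipschitz_grad p L h" "\<And>x. x \<in> Rn p \<Longrightarrow> grad p h x = g x"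
proof -
  have ig: "is_grad p h x (g x)" if "x \<in> Rn p" for x
    using b[OF that] L g[OF that] that by (intro is_gradI[of _ _ _ "L / 2"]) auto
  then show gr: "\<And>x. x \<in> Rn p \<Longrightarrow> grad p h x = g x" using grad_eq by blast
  show "lipschitz_grad p L h"
    unfolding lipschitz_grad_def
  proof (intro conjI ballI)
    fix x assume "x \<in> Rn p" then show "\<exists>g. is_grad p h x g" using ig by blast
  next
    fix x y assume xy: "x \<in> Rn p" "y \<in> Rn p"
    show "vnorm p (vdiff p (grad p h x) (grad p h y)) \<le> L * vnorm p (vdiff p x y)"
    proof (rule vnorm_le_dual)
      show "0 \<le> L * vnorm p (vdiff p x y)" using L by simp
      fix v
      have "(\<Sum>j<p. v j * vdiff p (grad p h x) (grad p h y) j) = (\<Sum>j<p. v j * (g x j - g y j))"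
        using xy by (intro sum.cong) (auto simp: gr)
      then show "(\<Sum>j<p. v j * vdiff p (grad p h x) (grad p h y) j) \<le> L * vnorm p (vdiff p x y) * vnorm p v"
        using lip[OF xy, of v] by simp
    qed
  qed
qed

lemma lipschitz_grad_inner:
  assumes "lipschitz_grad p L h" "x \<in> Rn p" "y \<in> Rn p"
  shows "\<bar>\<Sum>j<p. v j * (grad p h x j - grad p h y j)\<bar> \<le> L * vnorm p (vdiff p x y) * vnorm p v"
proof -
  have "(\<Sum>j<p. v j * (grad p h x j - grad p h y j)) = (\<Sum>j<p. v j * vdiff p (grad p h x) (grad p h y) j)"
    by (intro sum.cong) auto
  also have "\<bar>\<dots>\<bar> \<le> vnorm p v * vnorm p (vdiff p (grad p h x) (grad p h y))" by (rule inner_le_vnorm)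
  also have "\<dots> \<le> vnorm p v * (L * vnorm p (vdiff p x y))"
    using assms by (intro mult_left_mono lipschitz_gradD) auto
  finally show ?thesis by (simp add: mult_ac)
qed

lemma lipschitz_grad_mean:
  assumes L: "0 \<le> L" and n: "n \<ge> 1" and f: "\<And>i. i < n \<Longrightarrow> lipschitz_grad p L (f i)"
  shows "lipschitz_grad p L (\<lambda>x. (\<Sum>i<n. f i x) / real n)"
    and "x \<in> Rn p \<Longrightarrow> grad p (\<lambda>x. (\<Sum>i<n. f i x) / real n) x = (\<lambda>j\<in>{..<p}. (\<Sum>i<n. grad p (f i) x j) / real n)"
proof -
  let ?h = "\<lambda>x. (\<Sum>i<n. f i x) / real n"
  let ?g = "\<lambda>x. (\<lambda>j\<in>{..<p}. (\<Sum>i<n. grad p (f i) x j) / real n)"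
  have mean_le: "\<bar>(\<Sum>i<n. a i) / real n\<bar> \<le> c" if "\<And>i. i < n \<Longrightarrow> \<bar>a i\<bar> \<le> c" for a :: "nat \<Rightarrow> real" and c
  proof -
    have "\<bar>\<Sum>i<n. a i\<bar> \<le> (\<Sum>i<n. c)" using that by (intro order_trans[OF sum_abs] sum_mono) auto
    then show ?thesis using n by (simp add: field_simps)
  qed
  have sw: "(\<Sum>j<p. ((\<Sum>i<n. a i j) / real n) * d j) = (\<Sum>i<n. \<Sum>j<p. a i j * d j) / real n" for a :: "nat \<Rightarrow> nat \<Rightarrow> real" and d
    by (subst sum.swap) (simp add: sum_distrib_right sum_divide_distrib)
  have b: "\<bar>?h (move p x 1 d) - ?h x - (\<Sum>j<p. ?g x j * d j)\<bar> \<le> L / 2 * (vnorm p d)\<^sup>2" if "x \<in> Rn p" for x d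
  proof -
    have "(\<Sum>j<p. ?g x j * d j) = (\<Sum>j<p. ((\<Sum>i<n. grad p (f i) x j) / real n) * d j)"
      by (intro sum.cong) auto
    then have "?h (move p x 1 d) - ?h x - (\<Sum>j<p. ?g x j * d j) =
      (\<Sum>i<n. f i (move p x 1 d) - f i x - (\<Sum>j<p. grad p (f i) x j * d j)) / real n"
      unfolding sw by (simp add: sum_subtractf diff_divide_distrib)
    then show ?thesis using mean_le[OF smooth_bound[OF f that]] by simp
  qed
  have lip: "(\<Sum>j<p. v j * (?g x j - ?g y j)) \<le> L * vnorm p (vdiff p x y) * vnorm p v"
    if "x \<in> Rn p" "y \<in> Rn p" for x y v
  proof -
    have "(\<Sum>j<p. v j * (?g x j - ?g y j)) = (\<Sum>j<p. ((\<Sum>i<n. grad p (f i) x j - grad p (f i) y j) / real n) * v j)"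
      by (intro sum.cong) (auto simp: sum_subtractf diff_divide_distrib mult.commute)
    also have "\<dots> = (\<Sum>i<n. \<Sum>j<p. v j * (grad p (f i) x j - grad p (f i) y j)) / real n"
      unfolding sw by (simp add: mult.commute)
    also have "\<dots> \<le> \<bar>\<dots>\<bar>" by (rule abs_ge_self)
    also have "\<dots> \<le> L * vnorm p (vdiff p x y) * vnorm p v"
      by (intro mean_le lipschitz_grad_inner f that)
    finally show ?thesis .
  qed
  show "lipschitz_grad p L ?h" "x \<in> Rn p \<Longrightarrow> grad p ?h x = ?g x"
    using lipschitz_gradI[of L p ?g ?h, OF L _ b lip] by auto
qed

section \<open>Second moments of the uniform distribution on the sphere\<close>

lemma space_lborel_vec [simp]: "space (lborel_vec p) = Rn p" by (simp add: Rn_def)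

lemma measurable_lborel_vec_nth:
  "X \<in> measurable N (lborel_vec p) \<Longrightarrow> j < p \<Longrightarrow> (\<lambda>\<omega>. X \<omega> j) \<in> borel_measurable N"
  unfolding lborel_vec_def
  using measurable_compose[OF _ measurable_component_singleton[of j "{..<p}" "\<lambda>_. lborel"], of X N] by simp

lemma measurable_lborel_vec_restrict:
  "(\<And>j. j < p \<Longrightarrow> (\<lambda>\<omega>. f \<omega> j) \<in> borel_measurable N) \<Longrightarrow> (\<lambda>\<omega>. \<lambda>j\<in>{..<p}. f \<omega> j) \<in> measurable N (lborel_vec p)"
  unfolding lborel_vec_def by (rule measurable_restrict) simp

lemma measurable_nth_lborel_vec: "j < p \<Longrightarrow> (\<lambda>x. x j) \<in> borel_measurable (lborel_vec p)"
  by (rule measurable_lborel_vec_nth) simp_all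

lemma borel_measurable_vnorm:
  assumes "X \<in> measurable N (lborel_vec p)"
  shows "(\<lambda>\<omega>. vnorm p (X \<omega>)) \<in> borel_measurable N"
proof -
  have [measurable]: "(\<lambda>\<omega>. X \<omega> j) \<in> borel_measurable N" if "j \<in> {..<p}" for j
    using measurable_lborel_vec_nth[OF assms] that by simp
  show ?thesis unfolding vnorm_def L2_set_def by measurable
qed

lemma vnorm_measurable: "vnorm p \<in> borel_measurable (lborel_vec p)"
  using borel_measurable_vnorm[of "\<lambda>x. x" "lborel_vec p" p] by simp

section \<open>Invariance of Lebesgue measure under signed permutations\<close>

interpretation lborel_family: product_sigma_finite "\<lambda>_::nat. lborel :: real measure"
  by standard

lemma emeasure_lborel_vec_PiE:
  "(\<And>j. j < p \<Longrightarrow> A j \<in> sets borel) \<Longrightarrow> emeasure (lborel_vec p) (Pi\<^sub>E {..<p} A) = (\<Prod>j<p. emeasure lborel (A j))"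
  unfolding lborel_vec_def by (subst lborel_family.emeasure_PiM) auto

text \<open>Sign changes and permutations of the coordinates form a small group of isometries, yet
  one large enough to determine all second moments on the sphere; its effect on the product measure
  can be checked on boxes.\<close>

definition signed_perm :: "nat \<Rightarrow> (nat \<Rightarrow> real) \<Rightarrow> (nat \<Rightarrow> nat) \<Rightarrow> rvec \<Rightarrow> rvec" where
  "signed_perm p s \<pi> x = (\<lambda>j\<in>{..<p}. s j * x (\<pi> j))"

lemma emeasure_lborel_sign:
  assumes "\<bar>s\<bar> = (1::real)" "A \<in> sets borel"
  shows "emeasure lborel {r. s * r \<in> A} = emeasure lborel A" "{r. s * r \<in> A} \<in> sets borel"
proof -
  show "{r. s * r \<in> A} \<in> sets borel" using assms(2) measurable_sets_borel[of "\<lambda>r. s * r" borel A] by (simp add: vimage_def)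
  consider "s = 1" | "s = -1" using assms(1) by linarith
  then show "emeasure lborel {r. s * r \<in> A} = emeasure lborel A"
  proof cases
    case 2
    have "emeasure lborel A = emeasure (distr lborel borel uminus) A" by (simp add: lborel_distr_uminus)
    also have "\<dots> = emeasure lborel {r. s * r \<in> A}"
      using assms(2) 2 by (subst emeasure_distr) (auto simp: vimage_def)
    finally show ?thesis ..
  qed simp
qed

lemma signed_perm_measurable:
  assumes "\<pi> permutes {..<p}"
  shows "signed_perm p s \<pi> \<in> measurable (lborel_vec p) (lborel_vec p)"
  unfolding signed_perm_def
  using permutes_in_image[OF assms] by (intro measurable_lborel_vec_restrict borel_measurable_times measurable_nth_lborel_vec) auto

text \<open>It suffices to compare boxes. The preimage of a box is the box with its sides permuted
  by the inverse of \<pi> and possibly reflected, and neither operation changes the product of the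
  one-dimensional measures.\<close>

lemma distr_signed_perm:
  assumes \<pi>: "\<pi> permutes {..<p}" and s: "\<And>j. \<bar>s j\<bar> = 1"
  shows "distr (lborel_vec p) (lborel_vec p) (signed_perm p s \<pi>) = lborel_vec p" (is "?D = _")
proof -
  have "?D = PiM {..<p} (\<lambda>_. lborel)"
  proof (rule lborel_family.PiM_eqI)
    fix A :: "nat \<Rightarrow> real set" assume "\<And>i. i \<in> {..<p} \<Longrightarrow> A i \<in> sets lborel"
    then have A: "\<And>i. i < p \<Longrightarrow> A i \<in> sets borel" by simp
    define k where "k = Hilbert_Choice.inv \<pi>"
    have k: "k permutes {..<p}" unfolding k_def by (rule permutes_inv[OF \<pi>])
    have kp: "k (\<pi> j) = j" "\<pi> (k j) = j" for j unfolding k_def using permutes_inverses[OF \<pi>] by auto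
    have lt: "j < p \<Longrightarrow> k j < p" "j < p \<Longrightarrow> \<pi> j < p" for j
      using permutes_in_image[OF k, of j] permutes_in_image[OF \<pi>, of j] by auto
    have "Pi\<^sub>E {..<p} A \<in> sets (lborel_vec p)"
      unfolding lborel_vec_def using A by (intro sets_PiM_I_finite) auto
    then have "emeasure ?D (Pi\<^sub>E {..<p} A) = emeasure (lborel_vec p) (signed_perm p s \<pi> -` Pi\<^sub>E {..<p} A \<inter> Rn p)"
      by (subst emeasure_distr) (auto intro: signed_perm_measurable \<pi>)
    also have "signed_perm p s \<pi> -` Pi\<^sub>E {..<p} A \<inter> Rn p = Pi\<^sub>E {..<p} (\<lambda>j. {r. s (k j) * r \<in> A (k j)})" (is "?l = ?r")
    proof (intro equalityI subsetI)
      fix x assume x: "x \<in> ?l"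
      show "x \<in> ?r"
      proof (rule PiE_I)
        fix j assume j: "j \<in> {..<p}"
        then have "signed_perm p s \<pi> x (k j) \<in> A (k j)" using x lt by (auto simp: PiE_iff)
        then show "x j \<in> {r. s (k j) * r \<in> A (k j)}" using j lt by (simp add: signed_perm_def kp)
      qed (use x in \<open>auto simp: Rn_eq extensional_def\<close>)
    next
      fix x assume x: "x \<in> ?r"
      have "s j * x (\<pi> j) \<in> A j" if "j < p" for j
        using PiE_mem[OF x, of "\<pi> j"] lt that by (simp add: kp)
      then show "x \<in> ?l" using x by (auto simp: Rn_eq signed_perm_def PiE_iff)
    qed
    also have "emeasure (lborel_vec p) \<dots> = (\<Prod>j<p. emeasure lborel {r. s (k j) * r \<in> A (k j)})"
      using A s lt by (intro emeasure_lborel_vec_PiE emeasure_lborel_sign) auto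
    also have "\<dots> = (\<Prod>j<p. emeasure lborel (A (k j)))"
      using A s lt by (intro prod.cong emeasure_lborel_sign) auto
    also have "\<dots> = (\<Prod>j<p. emeasure lborel (A j))"
      using prod.permute[OF k, of "\<lambda>j. emeasure lborel (A j)"] by (simp add: comp_def)
    finally show "emeasure ?D (Pi\<^sub>E {..<p} A) = (\<Prod>j\<in>{..<p}. emeasure lborel (A j))" .
  qed (auto simp: lborel_vec_def)
  then show ?thesis by (simp add: lborel_vec_def)
qed

lemma vnorm_signed_perm:
  assumes \<pi>: "\<pi> permutes {..<p}" and s: "\<And>j. \<bar>s j\<bar> = 1"
  shows "vnorm p (signed_perm p s \<pi> x) = vnorm p x"
proof -
  have "(s j)\<^sup>2 = 1" for j using s[of j] by (simp add: power2_eq_1_iff abs_if split: if_splits)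
  then have "(\<Sum>j<p. (signed_perm p s \<pi> x j)\<^sup>2) = (\<Sum>j<p. (x (\<pi> j))\<^sup>2)"
    by (simp add: signed_perm_def power_mult_distrib)
  also have "\<dots> = (\<Sum>j<p. (x j)\<^sup>2)" using sum.permute[OF \<pi>, of "\<lambda>j. (x j)\<^sup>2"] by (simp add: comp_def)
  finally show ?thesis by (simp add: vnorm_def L2_set_def)
qed

section \<open>The unit ball and its radial projection\<close>

definition unit_ball :: "nat \<Rightarrow> rvec set" where "unit_ball p = {x \<in> Rn p. vnorm p x \<le> 1}"

lemma unit_ball_measurable: "unit_ball p \<in> sets (lborel_vec p)"
proof -
  note [measurable] = vnorm_measurable[of p]
  have "{x \<in> space (lborel_vec p). vnorm p x \<le> 1} \<in> sets (lborel_vec p)" by measurable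
  then show ?thesis by (simp add: unit_ball_def)
qed

text \<open>The ball lies between the cubes of half-width 1/p and 1; hence the uniform distribution
  on it is a probability measure.\<close>

lemma emeasure_unit_ball:
  assumes p: "p \<ge> 1"
  shows "emeasure (lborel_vec p) (unit_ball p) \<noteq> 0" "emeasure (lborel_vec p) (unit_ball p) \<noteq> \<infinity>"
proof -
  have "emeasure (lborel_vec p) (Pi\<^sub>E {..<p} (\<lambda>_. {- 1 / real p..1 / real p})) \<le> emeasure (lborel_vec p) (unit_ball p)"
  proof (intro emeasure_mono unit_ball_measurable subsetI)
    fix x :: rvec assume x: "x \<in> Pi\<^sub>E {..<p} (\<lambda>_. {- 1 / real p..1 / real p})"
    have "(x j)\<^sup>2 \<le> (1 / real p)\<^sup>2" if "j < p" for j
      using PiE_mem[OF x, of j] that by (intro abs_le_square_iff[THEN iffD1]) (auto simp: abs_le_iff)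
    then have "(\<Sum>j<p. (x j)\<^sup>2) \<le> (\<Sum>j<p. (1 / real p)\<^sup>2)" by (intro sum_mono) auto
    also have "\<dots> \<le> 1" using p by (simp add: power2_eq_square)
    finally show "x \<in> unit_ball p"
      using x by (simp add: unit_ball_def Rn_eq vnorm_def L2_set_def PiE_iff)
  qed
  moreover have "emeasure (lborel_vec p) (Pi\<^sub>E {..<p} (\<lambda>_. {- 1 / real p..1 / real p})) = ennreal (2 / real p) ^ p"
    by (subst emeasure_lborel_vec_PiE) (auto simp: minus_divide_left[symmetric] add_divide_distrib[symmetric])
  moreover have "ennreal (2 / real p) ^ p \<noteq> 0" using p by simp
  ultimately show "emeasure (lborel_vec p) (unit_ball p) \<noteq> 0" by (metis le_zero_eq)
  have "emeasure (lborel_vec p) (unit_ball p) \<le> emeasure (lborel_vec p) (Pi\<^sub>E {..<p} (\<lambda>_. {-1..1}))"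
  proof (intro emeasure_mono subsetI)
    fix x assume x: "x \<in> unit_ball p"
    have "x j \<in> {-1..1}" if "j < p" for j
    proof -
      have "(x j)\<^sup>2 \<le> (\<Sum>j<p. (x j)\<^sup>2)" using that by (intro member_le_sum) auto
      also have "\<dots> \<le> 1" using x by (simp add: unit_ball_def vnorm_def L2_set_def)
      finally show ?thesis using abs_square_le_1[of "x j"] by (auto simp: abs_le_iff)
    qed
    then show "x \<in> Pi\<^sub>E {..<p} (\<lambda>_. {-1..1})" using x by (simp add: unit_ball_def Rn_eq PiE_iff)
  qed (auto simp: lborel_vec_def intro!: sets_PiM_I_finite)
  also have "\<dots> < \<infinity>" by (subst emeasure_lborel_vec_PiE) (auto simp: power_less_top_ennreal)
  finally show "emeasure (lborel_vec p) (unit_ball p) \<noteq> \<infinity>" by simp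
qed

definition radial :: "nat \<Rightarrow> rvec \<Rightarrow> rvec" where
  "radial p x = (\<lambda>j\<in>{..<p}. x j / vnorm p x)"

lemma radial_measurable: "radial p \<in> measurable (lborel_vec p) (lborel_vec p)"
  unfolding radial_def
proof (rule measurable_lborel_vec_restrict)
  fix j assume "j < p"
  note [measurable] = measurable_nth_lborel_vec[OF this] vnorm_measurable[of p]
  show "(\<lambda>x. x j / vnorm p x) \<in> borel_measurable (lborel_vec p)" by measurable
qed

lemma uniform_sphere_eq:
  "uniform_sphere p = distr (uniform_measure (lborel_vec p) (unit_ball p)) (lborel_vec p) (radial p)"
  by (simp add: uniform_sphere_def unit_ball_def radial_def[abs_def])

lemma sets_uniform_sphere [measurable_cong, simp]: "sets (uniform_sphere p) = sets (lborel_vec p)"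
  by (simp add: uniform_sphere_def)

lemma space_uniform_sphere [simp]: "space (uniform_sphere p) = Rn p"
  by (simp add: uniform_sphere_def)

lemma measurable_uniform_sphere: "measurable (uniform_sphere p) N = measurable (lborel_vec p) N"
  by (rule measurable_cong_sets) simp_all

lemma prob_space_uniform_sphere: "p \<ge> 1 \<Longrightarrow> prob_space (uniform_sphere p)"
  unfolding uniform_sphere_eq
  using emeasure_unit_ball radial_measurable
  by (intro prob_space.prob_space_distr prob_space_uniform_measure) (auto simp: measurable_cong_sets[OF sets_uniform_measure refl])

text \<open>Only the origin fails: there the quotient by the norm is 0 / 0 = 0, which is not a unit
  vector. The origin is a null set since p \<ge> 1.\<close>

lemma AE_uniform_sphere_norm:
  assumes p: "p \<ge> 1"
  shows "AE u in uniform_sphere p. (\<Sum>j<p. (u j)\<^sup>2) = 1"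
proof -
  have m: "radial p \<in> measurable (uniform_measure (lborel_vec p) (unit_ball p)) (lborel_vec p)"
    using radial_measurable by (simp add: measurable_cong_sets[OF sets_uniform_measure refl])
  have [measurable]: "(\<lambda>u. u j) \<in> borel_measurable (lborel_vec p)" if "j \<in> {..<p}" for j
    using measurable_nth_lborel_vec that by simp
  have z: "emeasure (lborel_vec p) (Pi\<^sub>E {..<p} (\<lambda>_. {0})) = 0"
    using p by (subst emeasure_lborel_vec_PiE) auto
  have "AE x in lborel_vec p. vnorm p x \<noteq> 0"
  proof (rule AE_I[OF _ z])
    show "{x \<in> space (lborel_vec p). \<not> vnorm p x \<noteq> 0} \<subseteq> Pi\<^sub>E {..<p} (\<lambda>_. {0})"
    proof
      fix x assume "x \<in> {x \<in> space (lborel_vec p). \<not> vnorm p x \<noteq> 0}"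
      then have "x \<in> extensional {..<p}" "\<forall>j<p. x j = 0"
        by (auto simp: vnorm_def L2_set_def sum_nonneg_eq_0_iff Rn_eq)
      then show "x \<in> Pi\<^sub>E {..<p} (\<lambda>_. {0})" by (intro PiE_I) (auto simp: extensional_def)
    qed
    show "Pi\<^sub>E {..<p} (\<lambda>_. {0::real}) \<in> sets (lborel_vec p)"
      unfolding lborel_vec_def by (rule sets_PiM_I_finite) auto
  qed
  then have "AE x in lborel_vec p. x \<in> unit_ball p \<longrightarrow> (\<Sum>j<p. (radial p x j)\<^sup>2) = 1"
  proof eventually_elim
    case (elim x)
    have "(\<Sum>j<p. (radial p x j)\<^sup>2) = (\<Sum>j<p. (x j)\<^sup>2) / (vnorm p x)\<^sup>2"
      by (simp add: radial_def power_divide sum_divide_distrib)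
    then show ?case using elim by (simp add: vnorm_sq[symmetric])
  qed
  then have "AE x in uniform_measure (lborel_vec p) (unit_ball p). (\<Sum>j<p. (radial p x j)\<^sup>2) = 1"
    by (intro AE_uniform_measureI unit_ball_measurable)
  moreover have "{u \<in> space (lborel_vec p). (\<Sum>j<p. (u j)\<^sup>2) = 1} \<in> sets (lborel_vec p)"
    by measurable
  ultimately show ?thesis
    unfolding uniform_sphere_eq by (subst AE_distr_iff[OF m]) auto
qed

text \<open>Signed permutations preserve the norm, so they leave the ball invariant and commute with
  the radial projection; the invariance passes from Lebesgue measure to the sphere.\<close>

lemma distr_uniform_sphere_signed_perm:
  assumes \<pi>: "\<pi> permutes {..<p}" and s: "\<And>j. \<bar>s j\<bar> = 1"
  shows "distr (uniform_sphere p) (lborel_vec p) (signed_perm p s \<pi>) = uniform_sphere p"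
proof -
  let ?T = "signed_perm p s \<pi>" and ?\<nu> = "uniform_measure (lborel_vec p) (unit_ball p)"
  have sets_nu: "measurable ?\<nu> N = measurable (lborel_vec p) N" for N :: "'z measure"
    by (rule measurable_cong_sets) auto
  note T = signed_perm_measurable[OF \<pi>, of s]
  have lt: "j < p \<Longrightarrow> \<pi> j < p" for j using permutes_in_image[OF \<pi>, of j] by auto
  have nu: "distr ?\<nu> (lborel_vec p) ?T = ?\<nu>"
  proof (rule measure_eqI)
    fix A assume "A \<in> sets (distr ?\<nu> (lborel_vec p) ?T)"
    then have A: "A \<in> sets (lborel_vec p)" by simp
    have "emeasure (distr ?\<nu> (lborel_vec p) ?T) A = emeasure ?\<nu> (?T -` A \<inter> Rn p)"
      using A T by (subst emeasure_distr) (auto simp: sets_nu)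
    also have "\<dots> = emeasure (lborel_vec p) (unit_ball p \<inter> (?T -` A \<inter> Rn p)) / emeasure (lborel_vec p) (unit_ball p)"
      using measurable_sets[OF T A] unit_ball_measurable by (subst emeasure_uniform_measure) auto
    also have "unit_ball p \<inter> (?T -` A \<inter> Rn p) = ?T -` (unit_ball p \<inter> A) \<inter> Rn p"
      by (auto simp: unit_ball_def vnorm_signed_perm[OF \<pi> s]) (auto simp: signed_perm_def)
    also have "emeasure (lborel_vec p) \<dots> = emeasure (distr (lborel_vec p) (lborel_vec p) ?T) (unit_ball p \<inter> A)"
      using T A unit_ball_measurable by (subst emeasure_distr) auto
    also have "\<dots> = emeasure (lborel_vec p) (unit_ball p \<inter> A)" by (simp add: distr_signed_perm[OF \<pi> s])
    also have "\<dots> / emeasure (lborel_vec p) (unit_ball p) = emeasure ?\<nu> A"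
      using A unit_ball_measurable by (subst emeasure_uniform_measure) auto
    finally show "emeasure (distr ?\<nu> (lborel_vec p) ?T) A = emeasure ?\<nu> A" .
  qed simp
  have "?T \<circ> radial p = radial p \<circ> ?T"
    by (auto simp: fun_eq_iff radial_def vnorm_signed_perm[OF \<pi> s]) (auto simp: signed_perm_def lt)
  then have "distr (uniform_sphere p) (lborel_vec p) ?T = distr ?\<nu> (lborel_vec p) (radial p \<circ> ?T)"
    unfolding uniform_sphere_eq using T radial_measurable by (subst distr_distr) (auto simp: sets_nu)
  also have "\<dots> = distr (distr ?\<nu> (lborel_vec p) ?T) (lborel_vec p) (radial p)"
    using T radial_measurable by (subst distr_distr) (auto simp: sets_nu)
  finally show ?thesis by (simp add: nu uniform_sphere_eq)
qed

lemma integral_uniform_sphere_signed_perm: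
  fixes \<phi> :: "rvec \<Rightarrow> real"
  assumes \<pi>: "\<pi> permutes {..<p}" and s: "\<And>j. \<bar>s j\<bar> = 1" and \<phi>: "\<phi> \<in> borel_measurable (lborel_vec p)"
  shows "(\<integral>u. \<phi> (signed_perm p s \<pi> u) \<partial>uniform_sphere p) = (\<integral>u. \<phi> u \<partial>uniform_sphere p)"
proof -
  have "(\<integral>u. \<phi> u \<partial>uniform_sphere p) = (\<integral>u. \<phi> u \<partial>distr (uniform_sphere p) (lborel_vec p) (signed_perm p s \<pi>))"
    by (simp add: distr_uniform_sphere_signed_perm[OF \<pi> s])
  also have "\<dots> = (\<integral>u. \<phi> (signed_perm p s \<pi> u) \<partial>uniform_sphere p)"
    using signed_perm_measurable[OF \<pi>, of s] \<phi> by (subst integral_distr) (auto simp: measurable_uniform_sphere)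
  finally show ?thesis ..
qed

lemma uniform_sphere_nth_le:
  assumes p: "p \<ge> 1" and j: "j < p"
  shows "AE u in uniform_sphere p. \<bar>u j\<bar> \<le> 1"
  using AE_uniform_sphere_norm[OF p]
proof eventually_elim
  case (elim u)
  have "(u j)\<^sup>2 \<le> (\<Sum>j<p. (u j)\<^sup>2)" using j by (intro member_le_sum) auto
  then show ?case using elim abs_square_le_1[of "u j"] by simp
qed

text \<open>Off the diagonal, flipping the sign of coordinate \<open>i\<close> changes the sign of
  the integrand. On the diagonal, transpositions make all entries equal, and they add up to
  1.\<close>

lemma uniform_sphere_moments:
  assumes p: "p \<ge> 1" and i: "i < p" and j: "j < p"
  shows "integrable (uniform_sphere p) (\<lambda>u. u i * u j)"
    and "(\<integral>u. u i * u j \<partial>uniform_sphere p) = (if i = j then 1 / real p else 0)"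
proof -
  interpret U: prob_space "uniform_sphere p" by (rule prob_space_uniform_sphere[OF p])
  have m: "(\<lambda>u. u i * u j) \<in> borel_measurable (lborel_vec p)" if "i < p" "j < p" for i j
    using that by (intro borel_measurable_times measurable_nth_lborel_vec)
  have int: "integrable (uniform_sphere p) (\<lambda>u. u i * u j)" if "i < p" "j < p" for i j
  proof (rule U.integrable_const_bound[of _ 1])
    show "AE u in uniform_sphere p. norm (u i * u j) \<le> 1"
      using uniform_sphere_nth_le[OF p that(1)] uniform_sphere_nth_le[OF p that(2)]
      by eventually_elim (simp add: abs_mult mult_le_one)
  qed (use m[OF that] in \<open>simp add: measurable_uniform_sphere\<close>)
  then show "integrable (uniform_sphere p) (\<lambda>u. u i * u j)" using i j by blast
  show "(\<integral>u. u i * u j \<partial>uniform_sphere p) = (if i = j then 1 / real p else 0)"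
  proof (cases "i = j")
    case False
    define s where "s k = (if k = i then -1 else 1::real)" for k
    have "(\<integral>u. u i * u j \<partial>uniform_sphere p) = (\<integral>u. signed_perm p s id u i * signed_perm p s id u j \<partial>uniform_sphere p)"
      using m[OF i j] by (subst integral_uniform_sphere_signed_perm) (auto simp: s_def permutes_id)
    also have "\<dots> = (\<integral>u. - (u i * u j) \<partial>uniform_sphere p)"
      using i j False by (simp add: signed_perm_def s_def)
    finally show ?thesis using False by simp
  next
    case True
    have eq: "(\<integral>u. u k * u k \<partial>uniform_sphere p) = (\<integral>u. u i * u i \<partial>uniform_sphere p)" if k: "k < p" for k
    proof -
      have "(\<integral>u. u k * u k \<partial>uniform_sphere p) = (\<integral>u. signed_perm p (\<lambda>_. 1) (Transposition.transpose i k) u k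
          * signed_perm p (\<lambda>_. 1) (Transposition.transpose i k) u k \<partial>uniform_sphere p)"
        using m[OF k k] i k by (subst integral_uniform_sphere_signed_perm) (auto intro: permutes_swap_id)
      then show ?thesis using k by (simp add: signed_perm_def)
    qed
    have "1 = (\<integral>u. (\<Sum>k<p. u k * u k) \<partial>uniform_sphere p)"
    proof -
      have "(\<integral>u. (\<Sum>k<p. u k * u k) \<partial>uniform_sphere p) = (\<integral>u. 1 \<partial>uniform_sphere p)"
      proof (rule integral_cong_AE)
        show "AE u in uniform_sphere p. (\<Sum>k<p. u k * u k) = 1"
          using AE_uniform_sphere_norm[OF p] by (simp add: power2_eq_square)
        show "(\<lambda>u. \<Sum>k<p. u k * u k) \<in> borel_measurable (uniform_sphere p)"
          using m by (auto simp: measurable_uniform_sphere)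
      qed simp
      then show ?thesis using U.prob_space by simp
    qed
    also have "\<dots> = (\<Sum>k<p. \<integral>u. u k * u k \<partial>uniform_sphere p)"
      using int by (intro Bochner_Integration.integral_sum) auto
    also have "\<dots> = real p * (\<integral>u. u i * u i \<partial>uniform_sphere p)" by (simp add: eq)
    finally show ?thesis using True p by (simp add: field_simps)
  qed
qed

lemma uniform_sphere_inner:
  assumes p: "p \<ge> 1"
  shows "integrable (uniform_sphere p) (\<lambda>u. (\<Sum>j<p. v j * u j) * (\<Sum>j<p. w j * u j))"
    and "(\<integral>u. (\<Sum>j<p. v j * u j) * (\<Sum>j<p. w j * u j) \<partial>uniform_sphere p) = (\<Sum>j<p. v j * w j) / real p"
proof -
  have *: "(\<Sum>j<p. v j * u j) * (\<Sum>j<p. w j * u j) = (\<Sum>i<p. \<Sum>j<p. (v i * w j) * (u i * u j))" for u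
    by (simp add: sum_product mult_ac)
  show "integrable (uniform_sphere p) (\<lambda>u. (\<Sum>j<p. v j * u j) * (\<Sum>j<p. w j * u j))"
    unfolding * using uniform_sphere_moments(1)[OF p] by (intro Bochner_Integration.integrable_sum integrable_mult_right) auto
  have "(\<integral>u. (\<Sum>j<p. v j * u j) * (\<Sum>j<p. w j * u j) \<partial>uniform_sphere p) =
     (\<Sum>i<p. \<Sum>j<p. (v i * w j) * (\<integral>u. u i * u j \<partial>uniform_sphere p))"
    unfolding * using uniform_sphere_moments(1)[OF p]
    by (subst Bochner_Integration.integral_sum, force intro!: Bochner_Integration.integrable_sum integrable_mult_right)+
       (auto intro!: sum.cong)
  also have "\<dots> = (\<Sum>i<p. \<Sum>j<p. if i = j then (v i * w j) / real p else 0)"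
    using uniform_sphere_moments(2)[OF p] by (intro sum.cong refl) auto
  also have "\<dots> = (\<Sum>j<p. v j * w j) / real p"
    by (simp add: sum_divide_distrib)
  finally show "(\<integral>u. (\<Sum>j<p. v j * u j) * (\<Sum>j<p. w j * u j) \<partial>uniform_sphere p) = (\<Sum>j<p. v j * w j) / real p" .
qed

section \<open>The two-point gradient estimator\<close>

lemma abs_integral_le_AE:
  fixes f g :: "'z \<Rightarrow> real"
  assumes "integrable M f" "integrable M g" "AE x in M. \<bar>f x\<bar> \<le> g x"
  shows "\<bar>\<integral>x. f x \<partial>M\<bar> \<le> (\<integral>x. g x \<partial>M)"
proof -
  have "\<bar>\<integral>x. f x \<partial>M\<bar> \<le> (\<integral>x. \<bar>f x\<bar> \<partial>M)" by (rule integral_abs_bound)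
  also have "\<dots> \<le> (\<integral>x. g x \<partial>M)" using assms by (intro integral_mono_AE) auto
  finally show ?thesis .
qed

lemma measurable_move:
  assumes "X \<in> measurable N (lborel_vec p)" "Y \<in> measurable N (lborel_vec p)"
  shows "(\<lambda>\<omega>. move p (X \<omega>) t (Y \<omega>)) \<in> measurable N (lborel_vec p)"
  unfolding move_def
  by (intro measurable_lborel_vec_restrict borel_measurable_add borel_measurable_times borel_measurable_const
      measurable_lborel_vec_nth[OF assms(1)] measurable_lborel_vec_nth[OF assms(2)])

lemma zo_gradient_nth:
  "j < p \<Longrightarrow> zo_gradient p Fi \<delta> x u z j = real p * ((Fi (move p x \<delta> u) z - Fi x z) / \<delta>) * u j"
  by (simp add: zo_gradient_def move_def)

lemma zo_gradient_Rn [simp, intro]: "zo_gradient p Fi \<delta> x u z \<in> Rn p"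
  by (simp add: zo_gradient_def)

lemma measurable_zo_gradient:
  assumes F: "(\<lambda>(x, z). Fi x z) \<in> borel_measurable (lborel_vec p \<Otimes>\<^sub>M \<Xi>)"
    and X: "X \<in> measurable N (lborel_vec p)" and Y: "Y \<in> measurable N (lborel_vec p)" and Z: "Z \<in> measurable N \<Xi>"
  shows "(\<lambda>\<omega>. zo_gradient p Fi \<delta> (X \<omega>) (Y \<omega>) (Z \<omega>)) \<in> measurable N (lborel_vec p)"
proof -
  have "(\<lambda>\<omega>. Fi (X \<omega>) (Z \<omega>)) \<in> borel_measurable N" if "X \<in> measurable N (lborel_vec p)" for X
    using measurable_compose[OF measurable_Pair[OF that Z] F] by simp
  note F' = this[OF X] this[OF measurable_move[OF X Y]]
  have "(\<lambda>\<omega>. \<lambda>j\<in>{..<p}. real p * ((Fi (move p (X \<omega>) \<delta> (Y \<omega>)) (Z \<omega>) - Fi (X \<omega>) (Z \<omega>)) / \<delta>) * Y \<omega> j) \<in> measurable N (lborel_vec p)"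
    using F' by (intro measurable_lborel_vec_restrict borel_measurable_times borel_measurable_const borel_measurable_divide
      borel_measurable_diff measurable_lborel_vec_nth[OF Y]) auto
  then show ?thesis by (simp add: zo_gradient_def move_def)
qed

text \<open>One sample is frozen: \<open>h\<close> is a single realisation of the cost, and the
  direction is the only randomness. With the difference quotient \<open>D\<close>, the estimator has
  the entries \<open>real p * D u * u j\<close>.\<close>

locale sphere_estimator =
  fixes p :: nat and L \<delta> :: real and h :: "rvec \<Rightarrow> real" and x :: rvec
  assumes p: "p \<ge> 1" and L: "0 \<le> L" and \<delta>: "\<delta> > 0" and h: "lipschitz_grad p L h"
    and h_meas: "h \<in> borel_measurable (lborel_vec p)" and x: "x \<in> Rn p"
begin

abbreviation "U \<equiv> uniform_sphere p"
definition "D u = (h (move p x \<delta> u) - h x) / \<delta>"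
abbreviation "g \<equiv> grad p h x"

sublocale U: prob_space U by (rule prob_space_uniform_sphere[OF p])

lemma D_meas: "D \<in> borel_measurable U"
proof -
  have "(\<lambda>u. move p x \<delta> u) \<in> measurable (lborel_vec p) (lborel_vec p)"
    using x by (intro measurable_move) auto
  from measurable_compose[OF this h_meas] show ?thesis
    unfolding D_def by (simp add: measurable_uniform_sphere)
qed

lemma nth_meas: "j < p \<Longrightarrow> (\<lambda>u. u j) \<in> borel_measurable U"
  by (simp add: measurable_uniform_sphere measurable_nth_lborel_vec)

text \<open>A step of length exactly \<delta> has a first-order error of at most L \<delta>^2 / 2,
  and the quotient removes one factor \<delta>.\<close>

lemma D_approx: "AE u in U. \<bar>D u - (\<Sum>j<p. g j * u j)\<bar> \<le> L * \<delta> / 2 \<and> (\<Sum>j<p. (u j)\<^sup>2) = 1"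
  using AE_uniform_sphere_norm[OF p]
proof eventually_elim
  case (elim u)
  have "move p x 1 (\<lambda>j. \<delta> * u j) = move p x \<delta> u" by (simp add: move_def)
  moreover have "(vnorm p (\<lambda>j. \<delta> * u j))\<^sup>2 = \<delta>\<^sup>2"
    unfolding vnorm_scale power_mult_distrib vnorm_sq elim by simp
  moreover have "(\<Sum>j<p. g j * (\<delta> * u j)) = \<delta> * (\<Sum>j<p. g j * u j)" by (simp add: sum_distrib_left mult_ac)
  ultimately have "\<bar>h (move p x \<delta> u) - h x - \<delta> * (\<Sum>j<p. g j * u j)\<bar> \<le> L / 2 * \<delta>\<^sup>2"
    using smooth_bound[OF h x, of "\<lambda>j. \<delta> * u j"] by simp
  moreover have "h (move p x \<delta> u) - h x - \<delta> * (\<Sum>j<p. g j * u j) = \<delta> * (D u - (\<Sum>j<p. g j * u j))"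
    using \<delta> by (simp add: D_def field_simps)
  ultimately have "\<delta> * \<bar>D u - (\<Sum>j<p. g j * u j)\<bar> \<le> \<delta> * (L * \<delta> / 2)"
    using \<delta> by (simp add: abs_mult power2_eq_square mult_ac)
  then show ?case using \<delta> elim by simp
qed

text \<open>On the sphere the squared norm of the estimator is p^2 times the squared quotient, and
  the squared slope has mean equal to the squared gradient norm over p. So a single factor
  \<open>p\<close> survives on the gradient, while the smoothing error keeps p^2.\<close>

lemma second_moment:
  "(\<integral>\<^sup>+u. ennreal (\<Sum>j<p. (real p * D u * u j)\<^sup>2) \<partial>U) \<le> ennreal (2 * p * (vnorm p g)\<^sup>2 + p\<^sup>2 * L\<^sup>2 * \<delta>\<^sup>2 / 2)"
proof -
  define \<psi> where "\<psi> u = 2 * (real p)\<^sup>2 * ((\<Sum>j<p. g j * u j) * (\<Sum>j<p. g j * u j)) + p\<^sup>2 * L\<^sup>2 * \<delta>\<^sup>2 / 2" for u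
  have int: "integrable U \<psi>" unfolding \<psi>_def
    by (intro Bochner_Integration.integrable_add integrable_mult_right uniform_sphere_inner p) simp
  have "(\<integral>\<^sup>+u. ennreal (\<Sum>j<p. (real p * D u * u j)\<^sup>2) \<partial>U) \<le> (\<integral>\<^sup>+u. ennreal (\<psi> u) \<partial>U)"
  proof (rule nn_integral_mono_AE)
    show "AE u in U. ennreal (\<Sum>j<p. (real p * D u * u j)\<^sup>2) \<le> ennreal (\<psi> u)"
      using D_approx
    proof eventually_elim
      case (elim u)
      define q where "q = (\<Sum>j<p. g j * u j)"
      have "(D u)\<^sup>2 \<le> 2 * q\<^sup>2 + 2 * (D u - q)\<^sup>2"
        using zero_le_power2[of "2 * q - D u"] by (simp add: power2_eq_square algebra_simps)
      also have "(D u - q)\<^sup>2 \<le> (L * \<delta> / 2)\<^sup>2"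
        using elim L \<delta> by (intro abs_le_square_iff[THEN iffD1]) (simp add: q_def abs_mult)
      finally have "(real p)\<^sup>2 * (D u)\<^sup>2 \<le> (real p)\<^sup>2 * (2 * q\<^sup>2 + 2 * (L * \<delta> / 2)\<^sup>2)"
        by (intro mult_left_mono) auto
      also have "\<dots> = \<psi> u" by (simp add: \<psi>_def q_def power2_eq_square algebra_simps)
      also have "(real p)\<^sup>2 * (D u)\<^sup>2 = (\<Sum>j<p. (real p * D u * u j)\<^sup>2)"
        using elim by (simp add: power_mult_distrib flip: sum_distrib_left)
      finally show ?case by (rule ennreal_leI)
    qed
  qed
  also have "\<dots> = ennreal (\<integral>u. \<psi> u \<partial>U)"
  proof (rule nn_integral_eq_integral[OF int])
    have "0 \<le> \<psi> u" for u unfolding \<psi>_def power2_eq_square[symmetric] by (intro add_nonneg_nonneg) auto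
    then show "AE u in U. 0 \<le> \<psi> u" by simp
  qed
  also have "(\<integral>u. \<psi> u \<partial>U) = 2 * (real p)\<^sup>2 * ((\<Sum>j<p. g j * g j) / real p) + p\<^sup>2 * L\<^sup>2 * \<delta>\<^sup>2 / 2"
    unfolding \<psi>_def using uniform_sphere_inner[OF p, of g g]
    by (subst Bochner_Integration.integral_add) (auto simp: U.prob_space[simplified] intro!: integrable_mult_right)
  also have "\<dots> = 2 * p * (vnorm p g)\<^sup>2 + p\<^sup>2 * L\<^sup>2 * \<delta>\<^sup>2 / 2"
    using p unfolding vnorm_sq by (simp add: power2_eq_square)
  finally show ?thesis .
qed

lemma nth_integrable:
  assumes j: "j < p" shows "integrable U (\<lambda>u. real p * D u * u j)"
proof (rule U.integrable_const_bound)
  show "AE u in U. norm (real p * D u * u j) \<le> real p * (vnorm p g + L * \<delta> / 2) * 1"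
    using D_approx uniform_sphere_nth_le[OF p j]
  proof eventually_elim
    case (elim u)
    have "vnorm p u = 1" using elim by (simp add: vnorm_def L2_set_def)
    then have "\<bar>\<Sum>j<p. g j * u j\<bar> \<le> vnorm p g" using inner_le_vnorm[where x = g and y = u and p = p] by simp
    then have "\<bar>D u\<bar> \<le> vnorm p g + L * \<delta> / 2" using elim by linarith
    then have "real p * \<bar>D u\<bar> * \<bar>u j\<bar> \<le> real p * (vnorm p g + L * \<delta> / 2) * 1"
      using elim by (intro mult_mono mult_left_mono) auto
    then show ?case by (simp add: abs_mult)
  qed
  show "(\<lambda>u. real p * D u * u j) \<in> borel_measurable U"
    using D_meas nth_meas[OF j] by auto
qed

text \<open>The bias is only of order \<open>\<surd>p\<close>, because a fixed direction \<open>v\<close> has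
  \<open>\<langle>v, u\<rangle>\<^sup>2\<close> of mean \<open>\<parallel>v\<parallel>\<^sup>2 / p\<close> on the sphere.\<close>

lemma bias:
  "\<bar>(\<Sum>j<p. v j * (\<integral>u. real p * D u * u j \<partial>U)) - (\<Sum>j<p. v j * g j)\<bar> \<le> sqrt p * (L * \<delta> / 2) * vnorm p v"
proof -
  define q where "q u = (\<Sum>j<p. g j * u j)" for u
  define w where "w u = (\<Sum>j<p. v j * u j)" for u
  have int1: "integrable U (\<lambda>u. real p * D u * w u)"
  proof -
    have *: "(\<lambda>u. real p * D u * w u) = (\<lambda>u. \<Sum>j<p. v j * (real p * D u * u j))"
      by (simp add: w_def sum_distrib_left mult_ac)
    show ?thesis unfolding * by (intro Bochner_Integration.integrable_sum integrable_mult_right nth_integrable) auto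
  qed
  have int2: "integrable U (\<lambda>u. q u * w u)" "(\<integral>u. q u * w u \<partial>U) = (\<Sum>j<p. g j * v j) / real p"
    unfolding q_def w_def by (rule uniform_sphere_inner[OF p])+
  have int3: "integrable U (\<lambda>u. (w u)\<^sup>2)" "(\<integral>u. (w u)\<^sup>2 \<partial>U) = (vnorm p v)\<^sup>2 / real p"
    unfolding w_def power2_eq_square vnorm_sq using uniform_sphere_inner[OF p, of v v]
    by (auto simp: vnorm_sq[unfolded power2_eq_square])
  have eq: "(\<Sum>j<p. v j * (\<integral>u. real p * D u * u j \<partial>U)) - (\<Sum>j<p. v j * g j) = (\<integral>u. real p * (D u - q u) * w u \<partial>U)"
  proof -
    have "(\<Sum>j<p. v j * (\<integral>u. real p * D u * u j \<partial>U)) = (\<integral>u. (\<Sum>j<p. v j * (real p * D u * u j)) \<partial>U)"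
      by (subst Bochner_Integration.integral_sum) (auto intro!: nth_integrable)
    also have "\<dots> = (\<integral>u. real p * D u * w u \<partial>U)" by (simp add: w_def sum_distrib_left mult_ac)
    finally have 1: "(\<Sum>j<p. v j * (\<integral>u. real p * D u * u j \<partial>U)) = (\<integral>u. real p * D u * w u \<partial>U)" .
    have 2: "(\<Sum>j<p. v j * g j) = (\<integral>u. real p * (q u * w u) \<partial>U)"
      using p by (simp add: int2 mult.commute)
    have "(\<integral>u. real p * D u * w u \<partial>U) - (\<integral>u. real p * (q u * w u) \<partial>U) = (\<integral>u. real p * D u * w u - real p * (q u * w u) \<partial>U)"
      using int1 int2(1) by (subst Bochner_Integration.integral_diff) auto
    then show ?thesis unfolding 1 2 by (simp add: algebra_simps)
  qed
  show ?thesis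
  proof (cases "vnorm p v = 0")
    case True
    then have "v j = 0" if "j < p" for j
      using that by (simp add: vnorm_def L2_set_def sum_nonneg_eq_0_iff)
    then show ?thesis using True by simp
  next
    case False
    define N where "N = vnorm p v"
    have N: "N > 0" using False by (simp add: N_def order_less_le)
    have sp: "sqrt p > 0" using p by simp
    define K where "K = real p * (L * \<delta> / 2)"
    have K0: "K \<ge> 0" using L \<delta> by (simp add: K_def)
    \<comment> \<open>The majorant linearises |w| by c w^2 / 2 + 1 / (2 c) with c = sqrt p / N. This
      is the optimal choice, as w^2 has mean N^2 / p, and it delivers the constant of the
      Cauchy-Schwarz inequality.\<close>
    have int4: "integrable U (\<lambda>u. K * (sqrt p / N * (w u)\<^sup>2 / 2 + N / (2 * sqrt p)))"
      using int3(1) by (intro integrable_mult_right Bochner_Integration.integrable_add) auto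
    have bd: "AE u in U. norm (real p * (D u - q u) * w u) \<le> K * (sqrt p / N * (w u)\<^sup>2 / 2 + N / (2 * sqrt p))"
      using D_approx
    proof eventually_elim
      case (elim u)
      have "\<bar>w u\<bar> \<le> sqrt p / N * (w u)\<^sup>2 / 2 + N / (2 * sqrt p)"
      proof -
        define c where "c = sqrt p / N"
        have c: "c > 0" using N sp by (simp add: c_def)
        have "0 \<le> (c * \<bar>w u\<bar> - 1)\<^sup>2 / (2 * c)" using c by simp
        also have "\<dots> = c * (w u)\<^sup>2 / 2 + 1 / (2 * c) - \<bar>w u\<bar>"
          using c by (simp add: power2_diff power_mult_distrib field_simps) (simp add: power2_eq_square)
        finally have "\<bar>w u\<bar> \<le> c * (w u)\<^sup>2 / 2 + 1 / (2 * c)" by simp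
        then show ?thesis by (simp add: c_def)
      qed
      moreover have "\<bar>D u - q u\<bar> \<le> L * \<delta> / 2" using elim by (simp add: q_def)
      ultimately have "real p * \<bar>D u - q u\<bar> * \<bar>w u\<bar> \<le> real p * (L * \<delta> / 2) * (sqrt p / N * (w u)\<^sup>2 / 2 + N / (2 * sqrt p))"
        using L \<delta> by (intro mult_mono mult_left_mono) auto
      then show ?case by (simp add: abs_mult K_def)
    qed
    have "\<bar>\<integral>u. real p * (D u - q u) * w u \<partial>U\<bar> \<le> (\<integral>u. K * (sqrt p / N * (w u)\<^sup>2 / 2 + N / (2 * sqrt p)) \<partial>U)"
    proof (rule abs_integral_le_AE[OF _ int4 bd[unfolded real_norm_def]])
      have "integrable U (\<lambda>u. real p * D u * w u - real p * (q u * w u))"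
        using int1 int2(1) by (intro Bochner_Integration.integrable_diff) auto
      then show "integrable U (\<lambda>u. real p * (D u - q u) * w u)" by (simp add: algebra_simps)
    qed
    also have "\<dots> = K * (sqrt p / N * (N\<^sup>2 / real p) / 2 + N / (2 * sqrt p))"
      using int3 by (subst integral_mult_right_zero) (auto simp: N_def U.prob_space[simplified])
    also have "\<dots> = K * (N / sqrt p)"
    proof -
      have "c / N * (N\<^sup>2 / (c * c)) = N / c" if "c > 0" for c
        using N that by (simp add: power2_eq_square)
      from this[OF sp] have "sqrt p / N * (N\<^sup>2 / real p) = N / sqrt p" by simp
      then show ?thesis by (simp add: field_simps)
    qed
    also have "\<dots> = sqrt p * (L * \<delta> / 2) * N"
    proof -
      have *: "c * (c * d) * (N / c) = c * d * N" if "c > 0" for c d using that by simp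
      have "K = sqrt p * (sqrt p * (L * \<delta> / 2))" by (simp add: K_def)
      then show ?thesis by (simp only: *[OF sp])
    qed
    finally show ?thesis unfolding eq N_def .
  qed
qed

end

text \<open>The mean of the estimator as a function of the point. Evaluated at an iterate it plays
  the role of the conditional expectation given the past, the new samples being independent of that
  iterate; no conditional expectation operator is formed.\<close>

definition mean_estimate :: "nat \<Rightarrow> 'b measure \<Rightarrow> (rvec \<Rightarrow> 'b \<Rightarrow> real) \<Rightarrow> real \<Rightarrow> rvec \<Rightarrow> rvec" where
  "mean_estimate p \<Xi> Fi \<delta> x = (\<lambda>j\<in>{..<p}. \<integral>(z, u). zo_gradient p Fi \<delta> x u z j \<partial>(\<Xi> \<Otimes>\<^sub>M uniform_sphere p))"

locale stochastic_estimator =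
  fixes p :: nat and L :: real and \<Xi> :: "'b measure" and Fi :: "rvec \<Rightarrow> 'b \<Rightarrow> real"
  assumes p: "p \<ge> 1" and L: "0 \<le> L" and prob: "prob_space \<Xi>"
    and F_meas: "(\<lambda>(x, z). Fi x z) \<in> borel_measurable (lborel_vec p \<Otimes>\<^sub>M \<Xi>)"
    and F_int: "\<And>x. x \<in> Rn p \<Longrightarrow> integrable \<Xi> (Fi x)"
    and F_smooth: "AE z in \<Xi>. lipschitz_grad p L (\<lambda>x. Fi x z)"
begin

sublocale X: prob_space \<Xi> by (rule prob)
sublocale U: prob_space "uniform_sphere p" by (rule prob_space_uniform_sphere[OF p])
sublocale XU: pair_prob_space \<Xi> "uniform_sphere p" ..

abbreviation f :: "rvec \<Rightarrow> real" where "f \<equiv> (\<lambda>x. \<integral>z. Fi x z \<partial>\<Xi>)"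

text \<open>Agrees with the partial derivative for almost every sample. As a limit of measurable
  functions it is measurable in \<open>z\<close>, and it replaces \<open>grad\<close> where an
  integral over the sample has to be split.\<close>

definition dF :: "nat \<Rightarrow> rvec \<Rightarrow> 'b \<Rightarrow> real" where "dF j x z = lim (diff_quot p (\<lambda>y. Fi y z) j x)"

lemma F_meas1: "x \<in> Rn p \<Longrightarrow> Fi x \<in> borel_measurable \<Xi>"
  using F_int by blast

lemma F_meas2: "z \<in> space \<Xi> \<Longrightarrow> (\<lambda>x. Fi x z) \<in> borel_measurable (lborel_vec p)"
  using measurable_compose[OF measurable_Pair2' F_meas, of z] by simp

lemma dF_meas: "x \<in> Rn p \<Longrightarrow> dF j x \<in> borel_measurable \<Xi>"
proof -
  assume x: "x \<in> Rn p"
  have "(\<lambda>z. diff_quot p (\<lambda>y. Fi y z) j x m) \<in> borel_measurable \<Xi>" for m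
    unfolding diff_quot_def using F_meas1[OF x] F_meas1[OF move_Rn] by measurable
  then show ?thesis unfolding dF_def by (rule borel_measurable_lim_metric)
qed

lemma dF_grad: "AE z in \<Xi>. \<forall>x\<in>Rn p. \<forall>j<p. dF j x z = grad p (\<lambda>x. Fi x z) x j"
  using F_smooth by eventually_elim (auto simp: dF_def lim_diff_quot)

text \<open>The quadratic remainder along a unit step bounds the partial derivative by two
  integrable values of the cost and a constant.\<close>

lemma dF_int:
  assumes x: "x \<in> Rn p" and j: "j < p"
  shows "integrable \<Xi> (dF j x)"
proof (rule Bochner_Integration.integrable_bound)
  show "integrable \<Xi> (\<lambda>z. \<bar>Fi (move p x 1 (axis_vec j)) z\<bar> + \<bar>Fi x z\<bar> + L / 2 * (vnorm p (axis_vec j))\<^sup>2)"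
    using F_int[OF x] F_int[OF move_Rn] by (intro Bochner_Integration.integrable_add integrable_abs) auto
  show "AE z in \<Xi>. norm (dF j x z) \<le> norm (\<bar>Fi (move p x 1 (axis_vec j)) z\<bar> + \<bar>Fi x z\<bar> + L / 2 * (vnorm p (axis_vec j))\<^sup>2)"
    using F_smooth dF_grad
  proof eventually_elim
    case (elim z)
    have "\<bar>Fi (move p x 1 (axis_vec j)) z - Fi x z - dF j x z\<bar> \<le> L / 2 * (vnorm p (axis_vec j))\<^sup>2"
      using smooth_bound[OF elim(1) x, of "axis_vec j"] elim(2) x j by (simp add: sum_unit)
    moreover have "0 \<le> L / 2 * (vnorm p (axis_vec j))\<^sup>2" using L by simp
    ultimately show ?case unfolding real_norm_def by linarith
  qed
qed (rule dF_meas[OF x])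

text \<open>Differentiation under the integral sign without dominated convergence: the quadratic
  remainder bound and the dual Lipschitz bound hold for almost every sample with a deterministic
  right side, so both pass to the expectation.\<close>

lemma f_smooth: "lipschitz_grad p L f"
  and f_grad: "x \<in> Rn p \<Longrightarrow> grad p f x = (\<lambda>j\<in>{..<p}. \<integral>z. dF j x z \<partial>\<Xi>)"
proof -
  let ?g = "\<lambda>x. (\<lambda>j\<in>{..<p}. \<integral>z. dF j x z \<partial>\<Xi>)"
  have b: "\<bar>f (move p x 1 d) - f x - (\<Sum>j<p. ?g x j * d j)\<bar> \<le> L / 2 * (vnorm p d)\<^sup>2" if x: "x \<in> Rn p" for x d
  proof -
    have int: "integrable \<Xi> (\<lambda>z. Fi (move p x 1 d) z - Fi x z - (\<Sum>j<p. dF j x z * d j))"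
      using x by (intro Bochner_Integration.integrable_diff Bochner_Integration.integrable_sum integrable_mult_left F_int dF_int) auto
    have "f (move p x 1 d) - f x - (\<Sum>j<p. ?g x j * d j) = (\<integral>z. Fi (move p x 1 d) z - Fi x z - (\<Sum>j<p. dF j x z * d j) \<partial>\<Xi>)"
      using x F_int dF_int
      by (subst Bochner_Integration.integral_diff,
          auto intro!: Bochner_Integration.integrable_diff Bochner_Integration.integrable_sum)
    also have "\<bar>\<dots>\<bar> \<le> (\<integral>z. L / 2 * (vnorm p d)\<^sup>2 \<partial>\<Xi>)"
    proof (rule abs_integral_le_AE[OF int])
      show "AE z in \<Xi>. \<bar>Fi (move p x 1 d) z - Fi x z - (\<Sum>j<p. dF j x z * d j)\<bar> \<le> L / 2 * (vnorm p d)\<^sup>2"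
        using F_smooth dF_grad
      proof eventually_elim
        case (elim z)
        then show ?case using smooth_bound[OF elim(1) x, of d] x by simp
      qed
    qed simp
    finally show ?thesis by (simp add: X.prob_space)
  qed
  have lip: "(\<Sum>j<p. v j * (?g x j - ?g y j)) \<le> L * vnorm p (vdiff p x y) * vnorm p v"
    if x: "x \<in> Rn p" and y: "y \<in> Rn p" for x y v
  proof -
    have int: "integrable \<Xi> (\<lambda>z. \<Sum>j<p. v j * (dF j x z - dF j y z))"
      using x y by (intro Bochner_Integration.integrable_diff Bochner_Integration.integrable_sum integrable_mult_right dF_int) auto
    have "(\<Sum>j<p. v j * (?g x j - ?g y j)) = (\<Sum>j<p. \<integral>z. v j * (dF j x z - dF j y z) \<partial>\<Xi>)"
      using x y dF_int by (intro sum.cong) auto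
    also have "\<dots> = (\<integral>z. (\<Sum>j<p. v j * (dF j x z - dF j y z)) \<partial>\<Xi>)"
      using x y dF_int by (subst Bochner_Integration.integral_sum) auto
    also have "\<dots> \<le> (\<integral>z. L * vnorm p (vdiff p x y) * vnorm p v \<partial>\<Xi>)"
    proof (rule integral_mono_AE[OF int])
      show "AE z in \<Xi>. (\<Sum>j<p. v j * (dF j x z - dF j y z)) \<le> L * vnorm p (vdiff p x y) * vnorm p v"
        using F_smooth dF_grad
      proof eventually_elim
        case (elim z)
        have "(\<Sum>j<p. v j * (dF j x z - dF j y z)) = (\<Sum>j<p. v j * (grad p (\<lambda>x. Fi x z) x j - grad p (\<lambda>x. Fi x z) y j))"
          using elim x y by simp
        then show ?case using lipschitz_grad_inner[OF elim(1) x y, of v] by linarith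
      qed
    qed simp
    finally show ?thesis by (simp add: X.prob_space)
  qed
  show "lipschitz_grad p L f" "x \<in> Rn p \<Longrightarrow> grad p f x = ?g x"
    using lipschitz_gradI[of L p ?g f, OF L _ b lip] by auto
qed

lemma zo_meas:
  assumes "x \<in> Rn p" "j < p"
  shows "(\<lambda>(z, u). zo_gradient p Fi \<delta> x u z j) \<in> borel_measurable (\<Xi> \<Otimes>\<^sub>M uniform_sphere p)"
proof -
  have "snd \<in> measurable (\<Xi> \<Otimes>\<^sub>M uniform_sphere p) (lborel_vec p)"
    using measurable_snd[of \<Xi> "uniform_sphere p"] by (simp add: measurable_cong_sets[OF refl sets_uniform_sphere])
  then show ?thesis
    unfolding case_prod_unfold using assms
    by (intro measurable_lborel_vec_nth[where p = p] measurable_zo_gradient[where \<Xi> = \<Xi>] F_meas) auto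
qed

lemma estimator_at:
  assumes "x \<in> Rn p" "\<delta> > 0" "lipschitz_grad p L (\<lambda>x. Fi x z)" "z \<in> space \<Xi>"
  shows "sphere_estimator p L \<delta> (\<lambda>x. Fi x z) x"
  using assms p L F_meas2 by unfold_locales auto

text \<open>The direction is integrated first, for a fixed sample, and leaves 2 p times the squared
  sample gradient; splitting that gradient around its mean doubles the constant and brings in the
  noise hypothesis. Nonnegative integrals are used, so finiteness is a result rather than a
  premise.\<close>

lemma zo_second_moment:
  assumes x: "x \<in> Rn p" and \<delta>: "\<delta> > 0"
    and noise: "(\<integral>\<^sup>+z. ennreal ((vnorm p (vdiff p (grad p (\<lambda>y. Fi y z) x) (grad p f x)))\<^sup>2) \<partial>\<Xi>)
        \<le> ennreal (\<sigma>\<^sub>0\<^sup>2 * (vnorm p (grad p f x))\<^sup>2 + \<sigma>\<^sub>1\<^sup>2)"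
  shows "(\<integral>\<^sup>+(z, u). ennreal (\<Sum>j<p. (zo_gradient p Fi \<delta> x u z j)\<^sup>2) \<partial>(\<Xi> \<Otimes>\<^sub>M uniform_sphere p))
     \<le> ennreal (4 * p * ((1 + \<sigma>\<^sub>0\<^sup>2) * (vnorm p (grad p f x))\<^sup>2 + \<sigma>\<^sub>1\<^sup>2) + p\<^sup>2 * L\<^sup>2 * \<delta>\<^sup>2 / 2)"
proof -
  let ?N = "\<lambda>z. (vnorm p (vdiff p (grad p (\<lambda>y. Fi y z) x) (grad p f x)))\<^sup>2"
  define c where "c = 4 * p * (vnorm p (grad p f x))\<^sup>2 + p\<^sup>2 * L\<^sup>2 * \<delta>\<^sup>2 / 2"
  have c: "c \<ge> 0" by (simp add: c_def)
  note [measurable] = zo_meas[OF x]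
  have "(\<lambda>w. \<Sum>j<p. ((\<lambda>(z, u). zo_gradient p Fi \<delta> x u z j) w)\<^sup>2) \<in> borel_measurable (\<Xi> \<Otimes>\<^sub>M uniform_sphere p)"
    by (intro borel_measurable_sum borel_measurable_power zo_meas x) simp
  then have [measurable]: "(\<lambda>(z, u). ennreal (\<Sum>j<p. (zo_gradient p Fi \<delta> x u z j)\<^sup>2)) \<in> borel_measurable (\<Xi> \<Otimes>\<^sub>M uniform_sphere p)"
    unfolding case_prod_unfold by (intro measurable_compose[OF _ measurable_ennreal]) simp
  have "(\<integral>\<^sup>+(z, u). ennreal (\<Sum>j<p. (zo_gradient p Fi \<delta> x u z j)\<^sup>2) \<partial>(\<Xi> \<Otimes>\<^sub>M uniform_sphere p))
     = (\<integral>\<^sup>+z. \<integral>\<^sup>+u. ennreal (\<Sum>j<p. (zo_gradient p Fi \<delta> x u z j)\<^sup>2) \<partial>uniform_sphere p \<partial>\<Xi>)"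
    by (subst U.nn_integral_fst[symmetric]) auto
  also have "\<dots> \<le> (\<integral>\<^sup>+z. ennreal (4 * p) * ennreal (?N z) + ennreal c \<partial>\<Xi>)"
  proof (rule nn_integral_mono_AE)
    show "AE z in \<Xi>. (\<integral>\<^sup>+u. ennreal (\<Sum>j<p. (zo_gradient p Fi \<delta> x u z j)\<^sup>2) \<partial>uniform_sphere p)
        \<le> ennreal (4 * p) * ennreal (?N z) + ennreal c"
      using F_smooth AE_space
    proof eventually_elim
      case (elim z)
      interpret S: sphere_estimator p L \<delta> "\<lambda>x. Fi x z" x by (rule estimator_at[OF x \<delta> elim])
      let ?g = "grad p (\<lambda>y. Fi y z) x" and ?f = "grad p f x"
      have "(\<integral>\<^sup>+u. ennreal (\<Sum>j<p. (zo_gradient p Fi \<delta> x u z j)\<^sup>2) \<partial>uniform_sphere p)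
        = (\<integral>\<^sup>+u. ennreal (\<Sum>j<p. (real p * S.D u * u j)\<^sup>2) \<partial>uniform_sphere p)"
        by (simp add: zo_gradient_nth S.D_def)
      also have "\<dots> \<le> ennreal (2 * p * (vnorm p ?g)\<^sup>2 + p\<^sup>2 * L\<^sup>2 * \<delta>\<^sup>2 / 2)" by (rule S.second_moment)
      also have "\<dots> \<le> ennreal (4 * p * ?N z + c)"
      proof (rule ennreal_leI)
        have "(?g j)\<^sup>2 \<le> 2 * (vdiff p ?g ?f j)\<^sup>2 + 2 * (?f j)\<^sup>2" if "j < p" for j
          using that zero_le_power2[of "?g j - 2 * ?f j"] by (simp add: power2_eq_square algebra_simps)
        then have "(vnorm p ?g)\<^sup>2 \<le> 2 * ?N z + 2 * (vnorm p ?f)\<^sup>2"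
          unfolding vnorm_sq sum_distrib_left sum.distrib[symmetric] by (intro sum_mono) auto
        from mult_left_mono[OF this, of "2 * p"]
        show "2 * p * (vnorm p ?g)\<^sup>2 + p\<^sup>2 * L\<^sup>2 * \<delta>\<^sup>2 / 2 \<le> 4 * p * ?N z + c"
          by (simp add: c_def algebra_simps)
      qed
      also have "\<dots> = ennreal (4 * p) * ennreal (?N z) + ennreal c"
        using c by (simp add: ennreal_plus ennreal_mult)
      finally show ?case .
    qed
  qed
  \<comment> \<open>Passing to \<open>dF\<close> makes the integrand visibly measurable, which is
    what allows the integral to be split.\<close>
  also have "\<dots> = (\<integral>\<^sup>+z. ennreal (4 * p) * ennreal (\<Sum>j<p. (dF j x z - grad p f x j)\<^sup>2) + ennreal c \<partial>\<Xi>)"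
    by (intro nn_integral_cong_AE eventually_mono[OF dF_grad]) (simp add: vnorm_sq x)
  also have "\<dots> = ennreal (4 * p) * (\<integral>\<^sup>+z. ennreal (\<Sum>j<p. (dF j x z - grad p f x j)\<^sup>2) \<partial>\<Xi>) + ennreal c"
  proof -
    have [measurable]: "(\<lambda>z. \<Sum>j<p. (dF j x z - grad p f x j)\<^sup>2) \<in> borel_measurable \<Xi>"
      by (intro borel_measurable_sum borel_measurable_power borel_measurable_diff dF_meas[OF x]) auto
    show ?thesis by (simp add: nn_integral_add nn_integral_cmult X.emeasure_space_1)
  qed
  also have "(\<integral>\<^sup>+z. ennreal (\<Sum>j<p. (dF j x z - grad p f x j)\<^sup>2) \<partial>\<Xi>) = (\<integral>\<^sup>+z. ennreal (?N z) \<partial>\<Xi>)"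
    by (intro nn_integral_cong_AE eventually_mono[OF dF_grad]) (simp add: vnorm_sq x)
  also have "ennreal (4 * p) * (\<integral>\<^sup>+z. ennreal (?N z) \<partial>\<Xi>) + ennreal c \<le>
      ennreal (4 * p) * ennreal (\<sigma>\<^sub>0\<^sup>2 * (vnorm p (grad p f x))\<^sup>2 + \<sigma>\<^sub>1\<^sup>2) + ennreal c"
    by (intro add_right_mono mult_left_mono noise) simp
  also have "\<dots> = ennreal (4 * p * (\<sigma>\<^sub>0\<^sup>2 * (vnorm p (grad p f x))\<^sup>2 + \<sigma>\<^sub>1\<^sup>2) + c)"
    using c by (subst ennreal_mult[symmetric]) (auto simp: ennreal_plus[symmetric] simp del: ennreal_plus)
  also have "4 * p * (\<sigma>\<^sub>0\<^sup>2 * (vnorm p (grad p f x))\<^sup>2 + \<sigma>\<^sub>1\<^sup>2) + c =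
     4 * p * ((1 + \<sigma>\<^sub>0\<^sup>2) * (vnorm p (grad p f x))\<^sup>2 + \<sigma>\<^sub>1\<^sup>2) + p\<^sup>2 * L\<^sup>2 * \<delta>\<^sup>2 / 2"
    by (simp add: c_def algebra_simps)
  finally show ?thesis .
qed

text \<open>A finite second moment on a probability space gives integrability.\<close>

lemma zo_integrable:
  assumes x: "x \<in> Rn p" and \<delta>: "\<delta> > 0" and j: "j < p"
    and noise: "(\<integral>\<^sup>+z. ennreal ((vnorm p (vdiff p (grad p (\<lambda>y. Fi y z) x) (grad p f x)))\<^sup>2) \<partial>\<Xi>)
        \<le> ennreal (\<sigma>\<^sub>0\<^sup>2 * (vnorm p (grad p f x))\<^sup>2 + \<sigma>\<^sub>1\<^sup>2)"
  shows "integrable (\<Xi> \<Otimes>\<^sub>M uniform_sphere p) (\<lambda>(z, u). zo_gradient p Fi \<delta> x u z j)"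
proof -
  let ?\<phi> = "\<lambda>w. zo_gradient p Fi \<delta> x (snd w) (fst w) j"
  have m: "?\<phi> \<in> borel_measurable (\<Xi> \<Otimes>\<^sub>M uniform_sphere p)"
    using zo_meas[OF x j] by (simp add: case_prod_unfold)
  have "(\<integral>\<^sup>+w. ennreal ((?\<phi> w)\<^sup>2) \<partial>(\<Xi> \<Otimes>\<^sub>M uniform_sphere p))
     \<le> (\<integral>\<^sup>+(z, u). ennreal (\<Sum>j<p. (zo_gradient p Fi \<delta> x u z j)\<^sup>2) \<partial>(\<Xi> \<Otimes>\<^sub>M uniform_sphere p))"
    unfolding case_prod_unfold using j by (intro nn_integral_mono ennreal_leI member_le_sum) auto
  also have "\<dots> < \<infinity>" using zo_second_moment[OF x \<delta> noise] by (simp add: order_le_less_trans)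
  finally have "integrable (\<Xi> \<Otimes>\<^sub>M uniform_sphere p) (\<lambda>w. (?\<phi> w)\<^sup>2)"
    using m by (intro integrableI_nonneg) auto
  from XU.square_integrable_imp_integrable[OF m this] show ?thesis by (simp add: case_prod_unfold)
qed

text \<open>In dual form the claim is linear in the estimator, so Fubini reduces it to the bias for
  a fixed sample, whose bound does not depend on the sample.\<close>

lemma mean_estimate_bias:
  assumes x: "x \<in> Rn p" and \<delta>: "\<delta> > 0"
    and noise: "(\<integral>\<^sup>+z. ennreal ((vnorm p (vdiff p (grad p (\<lambda>y. Fi y z) x) (grad p f x)))\<^sup>2) \<partial>\<Xi>)
        \<le> ennreal (\<sigma>\<^sub>0\<^sup>2 * (vnorm p (grad p f x))\<^sup>2 + \<sigma>\<^sub>1\<^sup>2)"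
  shows "vnorm p (vdiff p (mean_estimate p \<Xi> Fi \<delta> x) (grad p f x)) \<le> sqrt p * (L * \<delta> / 2)"
proof (rule vnorm_le_dual)
  fix v
  note int = zo_integrable[OF x \<delta> _ noise]
  have inner: "integrable \<Xi> (\<lambda>z. \<integral>u. zo_gradient p Fi \<delta> x u z j \<partial>uniform_sphere p)" if "j < p" for j
    using XU.integrable_fst[OF int[OF that]] by simp
  have "(\<Sum>j<p. v j * vdiff p (mean_estimate p \<Xi> Fi \<delta> x) (grad p f x) j)
     = (\<Sum>j<p. v j * ((\<integral>z. \<integral>u. zo_gradient p Fi \<delta> x u z j \<partial>uniform_sphere p \<partial>\<Xi>) - (\<integral>z. dF j x z \<partial>\<Xi>)))"
  proof (intro sum.cong refl)
    fix j assume "j \<in> {..<p}"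
    then have j: "j < p" by simp
    show "v j * vdiff p (mean_estimate p \<Xi> Fi \<delta> x) (grad p f x) j =
      v j * ((\<integral>z. \<integral>u. zo_gradient p Fi \<delta> x u z j \<partial>uniform_sphere p \<partial>\<Xi>) - (\<integral>z. dF j x z \<partial>\<Xi>))"
      using j XU.integral_fst[OF int[OF j]] by (simp add: mean_estimate_def f_grad[OF x])
  qed
  also have "\<dots> = (\<integral>z. (\<Sum>j<p. v j * ((\<integral>u. zo_gradient p Fi \<delta> x u z j \<partial>uniform_sphere p) - dF j x z)) \<partial>\<Xi>)"
    using inner dF_int[OF x] by (subst Bochner_Integration.integral_sum) (auto intro!: sum.cong)
  also have "\<dots> \<le> (\<integral>z. sqrt p * (L * \<delta> / 2) * vnorm p v \<partial>\<Xi>)"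
  proof (rule integral_mono_AE)
    show "integrable \<Xi> (\<lambda>z. \<Sum>j<p. v j * ((\<integral>u. zo_gradient p Fi \<delta> x u z j \<partial>uniform_sphere p) - dF j x z))"
      using inner dF_int[OF x] by (intro Bochner_Integration.integrable_sum integrable_mult_right Bochner_Integration.integrable_diff) auto
    show "AE z in \<Xi>. (\<Sum>j<p. v j * ((\<integral>u. zo_gradient p Fi \<delta> x u z j \<partial>uniform_sphere p) - dF j x z))
        \<le> sqrt p * (L * \<delta> / 2) * vnorm p v"
      using F_smooth AE_space dF_grad
    proof eventually_elim
      case (elim z)
      interpret S: sphere_estimator p L \<delta> "\<lambda>x. Fi x z" x by (rule estimator_at[OF x \<delta> elim(1,2)])
      have "(\<Sum>j<p. v j * ((\<integral>u. zo_gradient p Fi \<delta> x u z j \<partial>uniform_sphere p) - dF j x z))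
        = (\<Sum>j<p. v j * (\<integral>u. real p * S.D u * u j \<partial>uniform_sphere p)) - (\<Sum>j<p. v j * grad p (\<lambda>x. Fi x z) x j)"
        using elim x by (simp add: zo_gradient_nth S.D_def right_diff_distrib sum_subtractf)
      then show ?case using S.bias[of v] by linarith
    qed
  qed simp
  finally show "(\<Sum>j<p. v j * vdiff p (mean_estimate p \<Xi> Fi \<delta> x) (grad p f x) j) \<le> sqrt p * (L * \<delta> / 2) * vnorm p v"
    by (simp add: X.prob_space)
qed (use L \<delta> in simp)

end

section \<open>Independence of the samples\<close>

text \<open>The event systems of \<open>zo_sampling\<close> as a named family, so that
  sigma-algebras over arbitrary sets of samples can be formed.\<close>

definition sample_events ::
  "'w measure \<Rightarrow> nat \<Rightarrow> (nat \<Rightarrow> 'b measure) \<Rightarrow> (nat \<Rightarrow> nat \<Rightarrow> 'w \<Rightarrow> rvec) \<Rightarrow> (nat \<Rightarrow> nat \<Rightarrow> 'w \<Rightarrow> 'b) \<Rightarrow>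
    (nat \<times> nat) + (nat \<times> nat) \<Rightarrow> 'w set set" where
  "sample_events M p \<Xi> u \<xi> = (\<lambda>s. case s of
          Inl (i, k) \<Rightarrow> {u i k -` A \<inter> space M |A. A \<in> sets (lborel_vec p)}
        | Inr (i, k) \<Rightarrow> {\<xi> i k -` A \<inter> space M |A. A \<in> sets (\<Xi> i)})"

locale zo_noise =
  fixes M :: "'w measure" and n p :: nat and \<Xi> :: "nat \<Rightarrow> 'b measure"
    and u :: "nat \<Rightarrow> nat \<Rightarrow> 'w \<Rightarrow> rvec" and \<xi> :: "nat \<Rightarrow> nat \<Rightarrow> 'w \<Rightarrow> 'b"
  assumes sampling: "zo_sampling M n p \<Xi> u \<xi>" and p: "p \<ge> 1"
    and prob_Xi: "\<And>i. i < n \<Longrightarrow> prob_space (\<Xi> i)"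
begin

sublocale prob_space M using sampling by (simp add: zo_sampling_def)

definition "idx = ({..<n} \<times> (UNIV :: nat set)) <+> ({..<n} \<times> (UNIV :: nat set))"

abbreviation "Ev \<equiv> sample_events M p \<Xi> u \<xi>"

lemma u_meas: "i < n \<Longrightarrow> u i k \<in> measurable M (lborel_vec p)"
  and u_distr: "i < n \<Longrightarrow> distr M (lborel_vec p) (u i k) = uniform_sphere p"
  and xi_meas: "i < n \<Longrightarrow> \<xi> i k \<in> measurable M (\<Xi> i)"
  and xi_distr: "i < n \<Longrightarrow> distr M (\<Xi> i) (\<xi> i k) = \<Xi> i"
  using sampling by (auto simp: zo_sampling_def)

lemma indep_Ev: "indep_sets Ev idx"
  using sampling by (simp add: zo_sampling_def sample_events_def idx_def)

lemma Ev_events: "s \<in> idx \<Longrightarrow> Ev s \<subseteq> events"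
  using indep_Ev by (auto simp: indep_sets_def)

lemma Ev_Int_stable: "Int_stable (Ev s)"
proof (rule Int_stableI)
  fix a b assume "a \<in> Ev s" "b \<in> Ev s"
  then show "a \<inter> b \<in> Ev s"
  proof (cases s)
    case (Inl ik)
    obtain i k where ik: "ik = (i, k)" by force
    from \<open>a \<in> Ev s\<close> \<open>b \<in> Ev s\<close> obtain A B where "a = u i k -` A \<inter> space M" "A \<in> sets (lborel_vec p)"
      "b = u i k -` B \<inter> space M" "B \<in> sets (lborel_vec p)"
      by (auto simp: Inl ik sample_events_def)
    then show ?thesis by (auto simp: Inl ik sample_events_def intro!: exI[of _ "A \<inter> B"])
  next
    case (Inr ik)
    obtain i k where ik: "ik = (i, k)" by force
    from \<open>a \<in> Ev s\<close> \<open>b \<in> Ev s\<close> obtain A B where "a = \<xi> i k -` A \<inter> space M" "A \<in> sets (\<Xi> i)"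
      "b = \<xi> i k -` B \<inter> space M" "B \<in> sets (\<Xi> i)"
      by (auto simp: Inr ik sample_events_def)
    then show ?thesis by (auto simp: Inr ik sample_events_def intro!: exI[of _ "A \<inter> B"])
  qed
qed

text \<open>Generated by a set of samples, not by a time: comparing two agents in the same iteration
  needs the past enlarged by the samples of just one of them.\<close>

definition Fil :: "((nat \<times> nat) + (nat \<times> nat)) set \<Rightarrow> 'w measure" where
  "Fil S = sigma (space M) (\<Union>s\<in>S. Ev s)"

lemma Ev_Pow: "(\<Union>s\<in>S. Ev s) \<subseteq> Pow (space M)"
  by (auto simp: sample_events_def split: sum.splits)

lemma space_Fil [simp]: "space (Fil S) = space M"
  by (simp add: Fil_def space_measure_of[OF Ev_Pow])

lemma sets_Fil: "sets (Fil S) = sigma_sets (space M) (\<Union>s\<in>S. Ev s)"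
  by (simp add: Fil_def sets_measure_of[OF Ev_Pow])

lemma Fil_subset: "S \<subseteq> idx \<Longrightarrow> Y \<in> measurable (Fil S) N \<Longrightarrow> Y \<in> measurable M N"
proof -
  assume S: "S \<subseteq> idx" and Y: "Y \<in> measurable (Fil S) N"
  have "sets (Fil S) \<subseteq> sets M"
    unfolding sets_Fil by (rule sets.sigma_sets_subset) (use S Ev_events in blast)
  then show ?thesis using Y by (auto simp: measurable_def)
qed

lemma Fil_mono: "S \<subseteq> S' \<Longrightarrow> Y \<in> measurable (Fil S) N \<Longrightarrow> Y \<in> measurable (Fil S') N"
proof -
  assume S: "S \<subseteq> S'" and Y: "Y \<in> measurable (Fil S) N"
  have "sets (Fil S) \<subseteq> sets (Fil S')"
    unfolding sets_Fil by (rule sigma_sets_subseteq) (use S in blast)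
  then show ?thesis using Y by (auto simp: measurable_def)
qed

lemma u_Fil: "i < n \<Longrightarrow> Inl (i, k) \<in> S \<Longrightarrow> u i k \<in> measurable (Fil S) (lborel_vec p)"
  using measurable_space[OF u_meas, of i]
  by (intro measurableI) (auto simp: sets_Fil sample_events_def intro!: sigma_sets.Basic bexI[of _ "Inl (i, k)"], blast)

lemma xi_Fil: "i < n \<Longrightarrow> Inr (i, k) \<in> S \<Longrightarrow> \<xi> i k \<in> measurable (Fil S) (\<Xi> i)"
  using measurable_space[OF xi_meas, of i]
  by (intro measurableI) (auto simp: sets_Fil sample_events_def intro!: sigma_sets.Basic bexI[of _ "Inr (i, k)"], blast)

text \<open>Disjoint blocks of an independent family of intersection-stable systems generate
  independent sigma-algebras; \<open>bool\<close> indexes the two blocks.\<close>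

lemma Fil_indep:
  assumes S: "S \<subseteq> idx" "S' \<subseteq> idx" "S \<inter> S' = {}" and a: "a \<in> sets (Fil S)" and b: "b \<in> sets (Fil S')"
  shows "prob (a \<inter> b) = prob a * prob b"
proof -
  have "indep_sets (\<lambda>j. sigma_sets (space M) (\<Union>s\<in>(case j of True \<Rightarrow> S | False \<Rightarrow> S'). Ev s)) (UNIV :: bool set)"
  proof (rule indep_sets_collect_sigma)
    show "indep_sets Ev (\<Union>j\<in>UNIV. case j of True \<Rightarrow> S | False \<Rightarrow> S')"
      using S by (intro indep_sets_mono_index[OF _ indep_Ev]) (auto split: bool.splits)
    show "disjoint_family_on (\<lambda>j. case j of True \<Rightarrow> S | False \<Rightarrow> S') UNIV"
      using S by (auto simp: disjoint_family_on_def split: bool.splits)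
  qed (rule Ev_Int_stable)
  from indep_setsD[OF this, of UNIV "\<lambda>j. case j of True \<Rightarrow> a | False \<Rightarrow> b"]
  show ?thesis using a b by (simp add: UNIV_bool sets_Fil Int_commute mult.commute)
qed

lemma distr_pair_indep:
  assumes S: "S \<subseteq> idx" "S' \<subseteq> idx" "S \<inter> S' = {}"
    and Y: "Y \<in> measurable (Fil S) N" and Z: "Z \<in> measurable (Fil S') K"
  shows "distr M (N \<Otimes>\<^sub>M K) (\<lambda>\<omega>. (Y \<omega>, Z \<omega>)) = distr M N Y \<Otimes>\<^sub>M distr M K Z"
proof -
  note Ym = Fil_subset[OF S(1) Y] note Zm = Fil_subset[OF S(2) Z]
  interpret DY: prob_space "distr M N Y" by (rule prob_space_distr[OF Ym])
  interpret DZ: prob_space "distr M K Z" by (rule prob_space_distr[OF Zm])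
  have "distr M N Y \<Otimes>\<^sub>M distr M K Z = distr M (N \<Otimes>\<^sub>M K) (\<lambda>\<omega>. (Y \<omega>, Z \<omega>))"
  proof (rule pair_measure_eqI)
    show "sets (distr M N Y \<Otimes>\<^sub>M distr M K Z) = sets (distr M (N \<Otimes>\<^sub>M K) (\<lambda>\<omega>. (Y \<omega>, Z \<omega>)))"
      by (simp cong: sets_pair_measure_cong)
    fix A B assume "A \<in> sets (distr M N Y)" "B \<in> sets (distr M K Z)"
    then have A: "A \<in> sets N" and B: "B \<in> sets K" by auto
    have a: "Y -` A \<inter> space M \<in> sets (Fil S)" using measurable_sets[OF Y A] by simp
    have b: "Z -` B \<inter> space M \<in> sets (Fil S')" using measurable_sets[OF Z B] by simp
    have "emeasure (distr M (N \<Otimes>\<^sub>M K) (\<lambda>\<omega>. (Y \<omega>, Z \<omega>))) (A \<times> B) = emeasure M ((Y -` A \<inter> space M) \<inter> (Z -` B \<inter> space M))"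
      using A B Ym Zm by (subst emeasure_distr) (auto intro!: arg_cong[of _ _ "emeasure M"] measurable_Pair)
    also have "\<dots> = emeasure M (Y -` A \<inter> space M) * emeasure M (Z -` B \<inter> space M)"
      by (simp add: emeasure_eq_measure Fil_indep[OF S a b] ennreal_mult)
    also have "\<dots> = emeasure (distr M N Y) A * emeasure (distr M K Z) B"
      using A B Ym Zm by (simp add: emeasure_distr)
    finally show "emeasure (distr M N Y) A * emeasure (distr M K Z) B = emeasure (distr M (N \<Otimes>\<^sub>M K) (\<lambda>\<omega>. (Y \<omega>, Z \<omega>))) (A \<times> B)" ..
  qed unfold_locales
  then show ?thesis ..
qed

section \<open>Integrating out a fresh sample\<close>

definition fresh :: "((nat \<times> nat) + (nat \<times> nat)) set \<Rightarrow> nat \<Rightarrow> nat \<Rightarrow> bool" where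
  "fresh S i k \<longleftrightarrow> S \<subseteq> idx \<and> i < n \<and> Inl (i, k) \<notin> S \<and> Inr (i, k) \<notin> S"

lemma sample_meas: "i < n \<Longrightarrow> (\<lambda>\<omega>. (\<xi> i k \<omega>, u i k \<omega>)) \<in> measurable (Fil {Inl (i, k), Inr (i, k)}) (\<Xi> i \<Otimes>\<^sub>M lborel_vec p)"
  by (intro measurable_Pair u_Fil xi_Fil) auto

lemma idxI: "i < n \<Longrightarrow> Inl (i, k) \<in> idx" "i < n \<Longrightarrow> Inr (i, k) \<in> idx"
  by (auto simp: idx_def)

lemma distr_fresh:
  assumes S: "fresh S i k" and Y: "Y \<in> measurable (Fil S) N"
  shows "distr M (N \<Otimes>\<^sub>M (\<Xi> i \<Otimes>\<^sub>M uniform_sphere p)) (\<lambda>\<omega>. (Y \<omega>, (\<xi> i k \<omega>, u i k \<omega>))) = distr M N Y \<Otimes>\<^sub>M (\<Xi> i \<Otimes>\<^sub>M uniform_sphere p)"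
proof -
  have i: "i < n" using S by (simp add: fresh_def)
  have 1: "distr M (\<Xi> i \<Otimes>\<^sub>M lborel_vec p) (\<lambda>\<omega>. (\<xi> i k \<omega>, u i k \<omega>)) = \<Xi> i \<Otimes>\<^sub>M uniform_sphere p"
    using distr_pair_indep[of "{Inr (i, k)}" "{Inl (i, k)}" "\<xi> i k" "\<Xi> i" "u i k" "lborel_vec p"]
    by (simp add: i idxI xi_Fil u_Fil xi_distr u_distr)
  have 2: "sets (\<Xi> i \<Otimes>\<^sub>M uniform_sphere p) = sets (\<Xi> i \<Otimes>\<^sub>M lborel_vec p)"
    by (rule sets_pair_measure_cong) auto
  \<comment> \<open>Only the sigma-algebra of the target matters to \<open>distr\<close>, and
    \<open>uniform_sphere p\<close> has that of \<open>lborel_vec p\<close>.\<close>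
  have "distr M (N \<Otimes>\<^sub>M (\<Xi> i \<Otimes>\<^sub>M uniform_sphere p)) (\<lambda>\<omega>. (Y \<omega>, (\<xi> i k \<omega>, u i k \<omega>)))
     = distr M (N \<Otimes>\<^sub>M (\<Xi> i \<Otimes>\<^sub>M lborel_vec p)) (\<lambda>\<omega>. (Y \<omega>, (\<xi> i k \<omega>, u i k \<omega>)))"
    by (rule distr_cong) (auto intro!: sets_pair_measure_cong)
  also have "\<dots> = distr M N Y \<Otimes>\<^sub>M distr M (\<Xi> i \<Otimes>\<^sub>M lborel_vec p) (\<lambda>\<omega>. (\<xi> i k \<omega>, u i k \<omega>))"
    using S by (intro distr_pair_indep[of S "{Inl (i, k), Inr (i, k)}"] Y sample_meas) (auto simp: fresh_def idxI)
  finally show ?thesis by (simp add: 1)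
qed

lemma sample_meas_M: "i < n \<Longrightarrow> (\<lambda>\<omega>. (\<xi> i k \<omega>, u i k \<omega>)) \<in> measurable M (\<Xi> i \<Otimes>\<^sub>M uniform_sphere p)"
  by (intro measurable_Pair xi_meas) (auto simp: measurable_cong_sets[OF refl sets_uniform_sphere] u_meas)

lemma prob_space_sample: "i < n \<Longrightarrow> prob_space (\<Xi> i \<Otimes>\<^sub>M uniform_sphere p)"
proof -
  assume "i < n"
  interpret A: prob_space "\<Xi> i" by (rule prob_Xi) fact
  interpret B: prob_space "uniform_sphere p" by (rule prob_space_uniform_sphere[OF p])
  interpret pair_prob_space "\<Xi> i" "uniform_sphere p" ..
  show ?thesis by unfold_locales
qed

text \<open>The freezing principle: what is known from \<open>S\<close> may be held fixed while a
  sample outside \<open>S\<close> is integrated out. It takes the place of conditioning.\<close>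

lemma nn_integral_fresh:
  assumes S: "fresh S i k" and Y: "Y \<in> measurable (Fil S) N"
    and \<phi>: "\<phi> \<in> borel_measurable (N \<Otimes>\<^sub>M (\<Xi> i \<Otimes>\<^sub>M uniform_sphere p))"
  shows "(\<integral>\<^sup>+\<omega>. \<phi> (Y \<omega>, (\<xi> i k \<omega>, u i k \<omega>)) \<partial>M) = (\<integral>\<^sup>+\<omega>. (\<integral>\<^sup>+w. \<phi> (Y \<omega>, w) \<partial>(\<Xi> i \<Otimes>\<^sub>M uniform_sphere p)) \<partial>M)"
proof -
  have i: "i < n" and Ym: "Y \<in> measurable M N" using S Fil_subset[OF _ Y] by (auto simp: fresh_def)
  interpret XU: prob_space "\<Xi> i \<Otimes>\<^sub>M uniform_sphere p" by (rule prob_space_sample[OF i])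
  have m: "(\<lambda>\<omega>. (Y \<omega>, (\<xi> i k \<omega>, u i k \<omega>))) \<in> measurable M (N \<Otimes>\<^sub>M (\<Xi> i \<Otimes>\<^sub>M uniform_sphere p))"
    by (intro measurable_Pair Ym sample_meas_M i)
  have \<phi>': "\<phi> \<in> borel_measurable (distr M N Y \<Otimes>\<^sub>M (\<Xi> i \<Otimes>\<^sub>M uniform_sphere p))"
    using \<phi> by (simp cong: measurable_cong_sets sets_pair_measure_cong)
  have "(\<integral>\<^sup>+\<omega>. \<phi> (Y \<omega>, (\<xi> i k \<omega>, u i k \<omega>)) \<partial>M) = (\<integral>\<^sup>+w. \<phi> w \<partial>(distr M N Y \<Otimes>\<^sub>M (\<Xi> i \<Otimes>\<^sub>M uniform_sphere p)))"
    unfolding distr_fresh[OF S Y, symmetric] by (rule nn_integral_distr[OF m, symmetric]) (use \<phi> in simp)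
  also have "\<dots> = (\<integral>\<^sup>+y. (\<integral>\<^sup>+w. \<phi> (y, w) \<partial>(\<Xi> i \<Otimes>\<^sub>M uniform_sphere p)) \<partial>distr M N Y)"
    by (rule XU.nn_integral_fst[OF \<phi>', symmetric])
  also have "\<dots> = (\<integral>\<^sup>+\<omega>. (\<integral>\<^sup>+w. \<phi> (Y \<omega>, w) \<partial>(\<Xi> i \<Otimes>\<^sub>M uniform_sphere p)) \<partial>M)"
    by (rule nn_integral_distr[OF Ym]) (use XU.borel_measurable_nn_integral_fst[OF \<phi>] in simp)
  finally show ?thesis .
qed

lemma integral_fresh:
  fixes \<phi> :: "_ \<Rightarrow> real"
  assumes S: "fresh S i k" and Y: "Y \<in> measurable (Fil S) N"
    and \<phi>: "\<phi> \<in> borel_measurable (N \<Otimes>\<^sub>M (\<Xi> i \<Otimes>\<^sub>M uniform_sphere p))"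
    and int: "integrable M (\<lambda>\<omega>. \<phi> (Y \<omega>, (\<xi> i k \<omega>, u i k \<omega>)))"
  shows "(\<integral>\<omega>. \<phi> (Y \<omega>, (\<xi> i k \<omega>, u i k \<omega>)) \<partial>M) = (\<integral>\<omega>. (\<integral>w. \<phi> (Y \<omega>, w) \<partial>(\<Xi> i \<Otimes>\<^sub>M uniform_sphere p)) \<partial>M)"
proof -
  have i: "i < n" and Ym: "Y \<in> measurable M N" using S Fil_subset[OF _ Y] by (auto simp: fresh_def)
  interpret XU: prob_space "\<Xi> i \<Otimes>\<^sub>M uniform_sphere p" by (rule prob_space_sample[OF i])
  interpret DY: prob_space "distr M N Y" by (rule prob_space_distr[OF Ym])
  interpret PP: pair_prob_space "distr M N Y" "\<Xi> i \<Otimes>\<^sub>M uniform_sphere p" ..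
  have m: "(\<lambda>\<omega>. (Y \<omega>, (\<xi> i k \<omega>, u i k \<omega>))) \<in> measurable M (N \<Otimes>\<^sub>M (\<Xi> i \<Otimes>\<^sub>M uniform_sphere p))"
    by (intro measurable_Pair Ym sample_meas_M i)
  have int': "integrable (distr M N Y \<Otimes>\<^sub>M (\<Xi> i \<Otimes>\<^sub>M uniform_sphere p)) \<phi>"
    unfolding distr_fresh[OF S Y, symmetric] using int by (simp add: integrable_distr_eq[OF m \<phi>])
  have "(\<integral>\<omega>. \<phi> (Y \<omega>, (\<xi> i k \<omega>, u i k \<omega>)) \<partial>M) = (\<integral>w. \<phi> w \<partial>(distr M N Y \<Otimes>\<^sub>M (\<Xi> i \<Otimes>\<^sub>M uniform_sphere p)))"
    unfolding distr_fresh[OF S Y, symmetric] by (rule integral_distr[OF m \<phi>, symmetric])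
  also have "\<dots> = (\<integral>y. (\<integral>w. \<phi> (y, w) \<partial>(\<Xi> i \<Otimes>\<^sub>M uniform_sphere p)) \<partial>distr M N Y)"
    by (rule PP.integral_fst'[OF int', symmetric])
  also have "\<dots> = (\<integral>\<omega>. (\<integral>w. \<phi> (Y \<omega>, w) \<partial>(\<Xi> i \<Otimes>\<^sub>M uniform_sphere p)) \<partial>M)"
    by (rule integral_distr[OF Ym XU.borel_measurable_lebesgue_integral]) (use \<phi> in simp)
  finally show ?thesis .
qed

end

section \<open>One step of the algorithm\<close>

lemma average_nth [simp]: "j < p \<Longrightarrow> average n p x j = (\<Sum>i<n. x i j) / real n"
  by (simp add: average_def)

lemma average_Rn [simp, intro]: "average n p x \<in> Rn p"
  by (simp add: average_def)

lemma consensus_error_eq: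
  "consensus_error n p x = (\<Sum>j<p. \<Sum>i<n. (x i j - (\<Sum>i<n. x i j) / real n)\<^sup>2) / real n"
  unfolding consensus_error_def vnorm_sq by (subst sum.swap) simp

lemma consensus_error_nonneg: "0 \<le> consensus_error n p x"
  unfolding consensus_error_def by (simp add: sum_nonneg)

lemma young_square:
  fixes x y :: real
  assumes "0 < \<alpha>"
  shows "(x + y)\<^sup>2 \<le> (1 + \<alpha>) * x\<^sup>2 + (1 + 1 / \<alpha>) * y\<^sup>2"
proof -
  have "0 \<le> (\<alpha> * x - y)\<^sup>2 / \<alpha>" using assms by simp
  also have "\<dots> = \<alpha> * x\<^sup>2 - 2 * x * y + y\<^sup>2 / \<alpha>"
    using assms by (simp add: power2_eq_square field_simps)
  finally show ?thesis by (simp add: power2_sum algebra_simps)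
qed

lemma sum_square_deviation_le:
  fixes g :: "nat \<Rightarrow> real"
  assumes "n \<ge> 1"
  shows "(\<Sum>i<n. (g i - (\<Sum>i<n. g i) / real n)\<^sup>2) \<le> (\<Sum>i<n. (g i)\<^sup>2)"
proof -
  define m where "m = (\<Sum>i<n. g i) / real n"
  have "(\<Sum>i<n. (g i - m)\<^sup>2) = (\<Sum>i<n. (g i)\<^sup>2) - 2 * m * (\<Sum>i<n. g i) + real n * m\<^sup>2"
    by (simp add: power2_diff sum.distrib sum_subtractf sum_distrib_left mult_ac)
  also have "(\<Sum>i<n. g i) = real n * m" using assms by (simp add: m_def)
  finally have "(\<Sum>i<n. (g i - m)\<^sup>2) = (\<Sum>i<n. (g i)\<^sup>2) - 2 * m * (real n * m) + real n * m\<^sup>2" .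
  moreover have "2 * m * (real n * m) = 2 * (real n * m\<^sup>2)" by (simp add: power2_eq_square)
  moreover have "0 \<le> real n * m\<^sup>2" by simp
  ultimately show ?thesis unfolding m_def[symmetric] by linarith
qed

lemma mean_square_le:
  fixes a :: "nat \<Rightarrow> real"
  assumes "n \<ge> 1"
  shows "((\<Sum>i<n. a i) / real n)\<^sup>2 \<le> (\<Sum>i<n. (a i)\<^sup>2) / real n"
proof -
  define m where "m = (\<Sum>i<n. a i) / real n"
  have "0 \<le> (\<Sum>i<n. (a i - m)\<^sup>2)" by (rule sum_nonneg) simp
  also have "\<dots> = (\<Sum>i<n. (a i)\<^sup>2) - 2 * m * (\<Sum>i<n. a i) + real n * m\<^sup>2"
    by (simp add: power2_diff sum.distrib sum_subtractf sum_distrib_left mult_ac)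
  also have "(\<Sum>i<n. a i) = real n * m" using assms by (simp add: m_def)
  also have "2 * m * (real n * m) = 2 * (real n * m\<^sup>2)" by (simp add: power2_eq_square)
  finally have "real n * m\<^sup>2 \<le> (\<Sum>i<n. (a i)\<^sup>2)" by simp
  then show ?thesis unfolding m_def[symmetric] using assms by (simp add: field_simps)
qed

section \<open>Contraction by the Laplacian step\<close>

context
  fixes n :: nat and E a and \<gamma> :: real
  assumes n: "n \<ge> 1" and graph: "weighted_graph n E a" "connected_graph n E"
    and \<gamma>: "0 < \<gamma>" "\<gamma> < const_d1 (laplacian n a)"
begin

text \<open>Positivity is extracted from the existence of an admissible \<gamma>: division by zero
  yields 0, so 0 < \<gamma> < \<open>const_d1\<close> excludes a vanishing spectral radius, and the
  single-agent graph with it.\<close>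

lemma step_size:
  shows "0 < rho2 (laplacian n a)" "2 * \<gamma> * rho (laplacian n a * laplacian n a) < rho2 (laplacian n a)"
    "0 < rho (laplacian n a * laplacian n a)"
proof -
  define R where "R = rho (laplacian n a * laplacian n a)"
  \<comment> \<open>Testing with one unit vector shows that \<open>R\<close> is nonnegative.\<close>
  have "(\<Sum>i<n. (\<Sum>j<n. laplacian n a $$ (i, j) * axis_vec 0 j)\<^sup>2) \<le> R * (\<Sum>i<n. (axis_vec 0 i)\<^sup>2)"
    unfolding R_def by (rule Lap_bounded[OF graph])
  moreover have "(\<Sum>i<n. (axis_vec 0 i)\<^sup>2) = 1"
    using n sum_unit[of 0 n "axis_vec 0"] unfolding power2_eq_square by (simp add: axis_vec_def)
  moreover have "0 \<le> (\<Sum>i<n. (\<Sum>j<n. laplacian n a $$ (i, j) * axis_vec 0 j)\<^sup>2)" by (intro sum_nonneg) simp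
  ultimately have R: "0 \<le> R" by simp
  have d: "\<gamma> < rho2 (laplacian n a) / (2 * R)" using \<gamma>(2) by (simp add: const_d1_def R_def)
  have "R \<noteq> 0"
  proof
    assume "R = 0"
    then show False using d \<gamma>(1) by simp
  qed
  then have R0: "R > 0" using R by simp
  then show "0 < rho (laplacian n a * laplacian n a)" by (simp add: R_def)
  show *: "2 * \<gamma> * rho (laplacian n a * laplacian n a) < rho2 (laplacian n a)"
    using d R0 by (simp add: R_def[symmetric] field_simps)
  have "0 < 2 * \<gamma> * R" using \<gamma>(1) R0 by simp
  then show "0 < rho2 (laplacian n a)" using * by (simp add: R_def)
qed

text \<open>The coordinates of the state decouple under the Laplacian, so scalars suffice. With
  \<alpha> = \<gamma> \<open>rho2\<close>, coercivity gains 2 \<alpha> and the squared Laplacian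
  costs at most \<alpha>/2 by the bound on \<gamma>, leaving 1 - 3/2 \<alpha>; the Young factor 1 +
  \<alpha> turns this into at most 1 - \<alpha>/2.\<close>

lemma consensus_scalar:
  fixes y g :: "nat \<Rightarrow> real" and \<eta> :: real
  defines "y' \<equiv> \<lambda>i. y i - \<gamma> * (\<Sum>m<n. laplacian n a $$ (i, m) * y m) - \<eta> * g i"
  shows "(\<Sum>i<n. y' i) / real n = (\<Sum>i<n. y i) / real n - \<eta> * ((\<Sum>i<n. g i) / real n)"
    and "(\<Sum>i<n. (y' i - (\<Sum>i<n. y' i) / real n)\<^sup>2) \<le>
      (1 - (\<gamma> * rho2 (laplacian n a)) / 2) * (\<Sum>i<n. (y i - (\<Sum>i<n. y i) / real n)\<^sup>2) + (1 + 1 / (\<gamma> * rho2 (laplacian n a))) * \<eta>\<^sup>2 * (\<Sum>i<n. (g i)\<^sup>2)"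
proof -
  define yb where "yb = (\<Sum>i<n. y i) / real n"
  define gb where "gb = (\<Sum>i<n. g i) / real n"
  define L where "L i z = (\<Sum>m<n. laplacian n a $$ (i, m) * z m)" for i z
  define c where "c i = y i - yb" for i
  define R where "R = rho (laplacian n a * laplacian n a)"
  define r2 where "r2 = rho2 (laplacian n a)"
  have ss: "0 < r2" "2 * \<gamma> * R < r2" "0 < R" using step_size by (auto simp: R_def r2_def)
  have "(\<Sum>i<n. y' i) = (\<Sum>i<n. y i) - \<gamma> * (\<Sum>i<n. L i y) - \<eta> * (\<Sum>i<n. g i)"
    by (simp add: y'_def L_def sum_subtractf sum_distrib_left)
  also have "(\<Sum>i<n. L i y) = 0" unfolding L_def by (rule Lap_sum_zero[OF graph])
  finally show avg: "(\<Sum>i<n. y' i) / real n = (\<Sum>i<n. y i) / real n - \<eta> * ((\<Sum>i<n. g i) / real n)"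
    by (simp add: diff_divide_distrib)
  have Lc: "L i c = L i y" if "i < n" for i
    using that by (simp add: L_def Lap_apply[OF graph] c_def)
  have c0: "(\<Sum>i<n. c i) = 0" using n by (simp add: c_def sum_subtractf yb_def)
  have w: "(\<Sum>i<n. (c i - \<gamma> * L i c)\<^sup>2) \<le> (1 - 3/2 * (\<gamma> * r2)) * (\<Sum>i<n. (c i)\<^sup>2)"
  proof -
    have "(\<Sum>i<n. (c i - \<gamma> * L i c)\<^sup>2) = (\<Sum>i<n. (c i)\<^sup>2) - 2 * \<gamma> * (\<Sum>i<n. c i * L i c) + \<gamma>\<^sup>2 * (\<Sum>i<n. (L i c)\<^sup>2)"
      by (simp add: power2_diff power_mult_distrib sum.distrib sum_subtractf sum_distrib_left mult_ac)
    moreover have "2 * \<gamma> * (r2 * (\<Sum>i<n. (c i)\<^sup>2)) \<le> 2 * \<gamma> * (\<Sum>i<n. c i * L i c)"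
      using \<gamma> Lap_coercive[OF graph c0] by (intro mult_left_mono) (auto simp: L_def r2_def)
    moreover have "\<gamma>\<^sup>2 * (\<Sum>i<n. (L i c)\<^sup>2) \<le> \<gamma>\<^sup>2 * (R * (\<Sum>i<n. (c i)\<^sup>2))"
      using Lap_bounded[OF graph, of c] by (intro mult_left_mono) (auto simp: L_def R_def)
    moreover have "\<gamma>\<^sup>2 * (R * (\<Sum>i<n. (c i)\<^sup>2)) \<le> \<gamma> * r2 / 2 * (\<Sum>i<n. (c i)\<^sup>2)"
    proof -
      have "\<gamma> * (\<gamma> * R) \<le> \<gamma> * (r2 / 2)" using ss \<gamma> by (intro mult_left_mono) auto
      then have "\<gamma>\<^sup>2 * R \<le> \<gamma> * r2 / 2" by (simp add: power2_eq_square mult.assoc)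
      from mult_right_mono[OF this, of "\<Sum>i<n. (c i)\<^sup>2"] show ?thesis by (simp add: sum_nonneg mult.assoc)
    qed
    ultimately show ?thesis by (simp add: algebra_simps)
  qed
  have al: "0 < \<gamma> * r2" using \<gamma> ss by simp
  have "(\<Sum>i<n. (y' i - (\<Sum>i<n. y' i) / real n)\<^sup>2) = (\<Sum>i<n. ((c i - \<gamma> * L i c) + (- \<eta> * (g i - gb)))\<^sup>2)"
    unfolding avg by (intro sum.cong refl) (simp add: Lc, simp add: y'_def c_def L_def yb_def gb_def algebra_simps)
  also have "\<dots> \<le> (\<Sum>i<n. (1 + \<gamma> * r2) * (c i - \<gamma> * L i c)\<^sup>2 + (1 + 1 / (\<gamma> * r2)) * (- \<eta> * (g i - gb))\<^sup>2)"
    by (intro sum_mono young_square al)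
  also have "\<dots> = (1 + \<gamma> * r2) * (\<Sum>i<n. (c i - \<gamma> * L i c)\<^sup>2) + (1 + 1 / (\<gamma> * r2)) * \<eta>\<^sup>2 * (\<Sum>i<n. (g i - gb)\<^sup>2)"
    unfolding sum.distrib sum_distrib_left power_mult_distrib by (simp add: mult.assoc)
  also have "\<dots> \<le> (1 + \<gamma> * r2) * ((1 - 3/2 * (\<gamma> * r2)) * (\<Sum>i<n. (c i)\<^sup>2)) + (1 + 1 / (\<gamma> * r2)) * \<eta>\<^sup>2 * (\<Sum>i<n. (g i)\<^sup>2)"
    using w sum_square_deviation_le[OF n, of g] al by (intro add_mono mult_left_mono) (auto simp: gb_def)
  also have "(1 + \<gamma> * r2) * ((1 - 3/2 * (\<gamma> * r2)) * (\<Sum>i<n. (c i)\<^sup>2)) \<le> (1 - \<gamma> * r2 / 2) * (\<Sum>i<n. (c i)\<^sup>2)"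
  proof -
    have "(1 + t) * (1 - 3/2 * t) \<le> 1 - t / 2" for t :: real
      using zero_le_power2[of t] by (simp add: power2_eq_square algebra_simps)
    from mult_right_mono[OF this[of "\<gamma> * r2"], of "\<Sum>i<n. (c i)\<^sup>2"]
    show ?thesis by (simp add: sum_nonneg mult.assoc)
  qed
  finally show "(\<Sum>i<n. (y' i - (\<Sum>i<n. y' i) / real n)\<^sup>2) \<le>
      (1 - (\<gamma> * rho2 (laplacian n a)) / 2) * (\<Sum>i<n. (y i - (\<Sum>i<n. y i) / real n)\<^sup>2) + (1 + 1 / (\<gamma> * rho2 (laplacian n a))) * \<eta>\<^sup>2 * (\<Sum>i<n. (g i)\<^sup>2)"
    by (simp add: c_def yb_def r2_def)
qed

lemma consensus_error_update:
  assumes x': "\<And>i j. i < n \<Longrightarrow> j < p \<Longrightarrow> x' i j = x i j - \<gamma> * (\<Sum>m<n. laplacian n a $$ (i, m) * x m j) - \<eta> * g i j"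
  shows "consensus_error n p x' \<le> (1 - (\<gamma> * rho2 (laplacian n a)) / 2) * consensus_error n p x
      + (1 + 1 / (\<gamma> * rho2 (laplacian n a))) * \<eta>\<^sup>2 * ((\<Sum>i<n. \<Sum>j<p. (g i j)\<^sup>2) / real n)"
    and "average n p x' = move p (average n p x) 1 (\<lambda>j. - \<eta> * ((\<Sum>i<n. g i j) / real n))"
proof -
  have *: "(\<Sum>i<n. (x' i j - (\<Sum>i<n. x' i j) / real n)\<^sup>2) \<le>
      (1 - (\<gamma> * rho2 (laplacian n a)) / 2) * (\<Sum>i<n. (x i j - (\<Sum>i<n. x i j) / real n)\<^sup>2) + (1 + 1 / (\<gamma> * rho2 (laplacian n a))) * \<eta>\<^sup>2 * (\<Sum>i<n. (g i j)\<^sup>2)"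
    if "j < p" for j
    using consensus_scalar(2)[of "\<lambda>i. x i j" \<eta> "\<lambda>i. g i j"] by (simp add: x' that)
  have "(\<Sum>j<p. \<Sum>i<n. (x' i j - (\<Sum>i<n. x' i j) / real n)\<^sup>2) \<le> (\<Sum>j<p. (1 - (\<gamma> * rho2 (laplacian n a)) / 2) * (\<Sum>i<n. (x i j - (\<Sum>i<n. x i j) / real n)\<^sup>2) + (1 + 1 / (\<gamma> * rho2 (laplacian n a))) * \<eta>\<^sup>2 * (\<Sum>i<n. (g i j)\<^sup>2))"
    by (intro sum_mono *) simp
  also have "\<dots> = (1 - (\<gamma> * rho2 (laplacian n a)) / 2) * (\<Sum>j<p. \<Sum>i<n. (x i j - (\<Sum>i<n. x i j) / real n)\<^sup>2) + (1 + 1 / (\<gamma> * rho2 (laplacian n a))) * \<eta>\<^sup>2 * (\<Sum>j<p. \<Sum>i<n. (g i j)\<^sup>2)"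
    by (simp only: sum.distrib sum_distrib_left)
  also have "(\<Sum>j<p. \<Sum>i<n. (g i j)\<^sup>2) = (\<Sum>i<n. \<Sum>j<p. (g i j)\<^sup>2)" by (rule sum.swap)
  finally have "consensus_error n p x' \<le> ((1 - (\<gamma> * rho2 (laplacian n a)) / 2) * (\<Sum>j<p. \<Sum>i<n. (x i j - (\<Sum>i<n. x i j) / real n)\<^sup>2) + (1 + 1 / (\<gamma> * rho2 (laplacian n a))) * \<eta>\<^sup>2 * (\<Sum>i<n. \<Sum>j<p. (g i j)\<^sup>2)) / real n"
    unfolding consensus_error_eq by (rule divide_right_mono) simp
  then show "consensus_error n p x' \<le> (1 - (\<gamma> * rho2 (laplacian n a)) / 2) * consensus_error n p x
      + (1 + 1 / (\<gamma> * rho2 (laplacian n a))) * \<eta>\<^sup>2 * ((\<Sum>i<n. \<Sum>j<p. (g i j)\<^sup>2) / real n)"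
    unfolding consensus_error_eq[of n p x] add_divide_distrib times_divide_eq_right[symmetric] .
  show "average n p x' = move p (average n p x) 1 (\<lambda>j. - \<eta> * ((\<Sum>i<n. g i j) / real n))"
  proof (rule Rn_eqI[of _ p])
    fix j assume j: "j < p"
    show "average n p x' j = move p (average n p x) 1 (\<lambda>j. - \<eta> * ((\<Sum>i<n. g i j) / real n)) j"
      using consensus_scalar(1)[of "\<lambda>i. x i j" \<eta> "\<lambda>i. g i j"] j by (simp add: x')
  qed auto
qed

end

section \<open>Bias, variance and descent for the averaged gradient\<close>

lemma sum_square_add_le:
  fixes x y :: "nat \<Rightarrow> real"
  shows "(\<Sum>j<p. (x j + y j)\<^sup>2) \<le> 2 * (\<Sum>j<p. (x j)\<^sup>2) + 2 * (\<Sum>j<p. (y j)\<^sup>2)"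
  unfolding sum_distrib_left sum.distrib[symmetric]
  using young_square[of 1] by (intro sum_mono) simp

context
  fixes n p :: nat and L :: real and F :: "nat \<Rightarrow> rvec \<Rightarrow> real" and f :: "rvec \<Rightarrow> real"
  assumes n: "n \<ge> 1" and L: "0 \<le> L" and F: "\<And>i. i < n \<Longrightarrow> lipschitz_grad p L (F i)"
    and f: "f = (\<lambda>x. (\<Sum>i<n. F i x) / real n)"
begin

text \<open>Each agent errs in two ways, by the bias of its estimator and by using the gradient at
  its own point instead of the average. Splitting the square costs a factor 2 on both, and Jensen's
  inequality passes to the mean.\<close>

lemma mean_gradient_error:
  fixes x b :: "nat \<Rightarrow> rvec"
  assumes x: "\<And>i. i < n \<Longrightarrow> x i \<in> Rn p" and D: "0 \<le> D"
    and b: "\<And>i. i < n \<Longrightarrow> (vnorm p (vdiff p (b i) (grad p (F i) (x i))))\<^sup>2 \<le> real p * L\<^sup>2 * D / 4"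
  shows "(\<Sum>j<p. ((\<Sum>i<n. b i j) / real n - grad p f (average n p x) j)\<^sup>2) \<le> 2 * L\<^sup>2 * consensus_error n p x + real p * L\<^sup>2 * D / 2"
proof -
  define y where "y = average n p x"
  have y: "y \<in> Rn p" by (simp add: y_def)
  have gf: "grad p f y = (\<lambda>j\<in>{..<p}. (\<Sum>i<n. grad p (F i) y j) / real n)"
    unfolding f by (rule lipschitz_grad_mean(2)[OF L n F y])
  have "(\<Sum>j<p. ((\<Sum>i<n. b i j) / real n - grad p f y j)\<^sup>2) = (\<Sum>j<p. ((\<Sum>i<n. b i j - grad p (F i) y j) / real n)\<^sup>2)"
    by (intro sum.cong refl) (simp add: gf sum_subtractf diff_divide_distrib)
  also have "\<dots> \<le> (\<Sum>j<p. (\<Sum>i<n. (b i j - grad p (F i) y j)\<^sup>2) / real n)"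
    by (intro sum_mono mean_square_le n)
  also have "\<dots> = (\<Sum>i<n. \<Sum>j<p. (b i j - grad p (F i) y j)\<^sup>2) / real n"
    by (subst sum.swap) (simp add: sum_divide_distrib)
  also have "\<dots> \<le> (\<Sum>i<n. real p * L\<^sup>2 * D / 2 + 2 * L\<^sup>2 * (vnorm p (vdiff p (x i) y))\<^sup>2) / real n"
  proof (intro divide_right_mono sum_mono)
    fix i assume "i \<in> {..<n}" then have i: "i < n" by simp
    have "(\<Sum>j<p. (b i j - grad p (F i) y j)\<^sup>2) = (\<Sum>j<p. (vdiff p (b i) (grad p (F i) (x i)) j + vdiff p (grad p (F i) (x i)) (grad p (F i) y) j)\<^sup>2)"
      by (intro sum.cong refl) simp
    also have "\<dots> \<le> 2 * (vnorm p (vdiff p (b i) (grad p (F i) (x i))))\<^sup>2 + 2 * (vnorm p (vdiff p (grad p (F i) (x i)) (grad p (F i) y)))\<^sup>2"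
      unfolding vnorm_sq by (rule sum_square_add_le)
    also have "(vnorm p (vdiff p (grad p (F i) (x i)) (grad p (F i) y)))\<^sup>2 \<le> (L * vnorm p (vdiff p (x i) y))\<^sup>2"
      by (intro power_mono lipschitz_gradD[OF x[OF i] y F[OF i]]) simp
    finally show "(\<Sum>j<p. (b i j - grad p (F i) y j)\<^sup>2) \<le> real p * L\<^sup>2 * D / 2 + 2 * L\<^sup>2 * (vnorm p (vdiff p (x i) y))\<^sup>2"
      using b[OF i] by (simp add: power_mult_distrib)
  qed simp
  also have "\<dots> = 2 * L\<^sup>2 * consensus_error n p x + real p * L\<^sup>2 * D / 2"
    using n by (simp add: consensus_error_def y_def sum.distrib add_divide_distrib flip: sum_distrib_left)
  finally show ?thesis by (simp add: y_def)
qed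

text \<open>Two splittings lead from the gradient of agent \<open>i\<close> at its own point, over
  its gradient at the average, to the gradient of \<open>f\<close>; with the initial 4 this gives 4
  * 2 * 2 = 16.\<close>

lemma mean_variance_bound:
  fixes x :: "nat \<Rightarrow> rvec" and \<sigma>\<^sub>0 \<sigma>\<^sub>1 \<sigma>t\<^sub>0 \<sigma>\<^sub>2 :: real
  assumes x: "\<And>i. i < n \<Longrightarrow> x i \<in> Rn p" and d: "\<And>i. i < n \<Longrightarrow> (d i)\<^sup>2 \<le> D"
    and dis: "\<And>i x. i < n \<Longrightarrow> x \<in> Rn p \<Longrightarrow> (vnorm p (vdiff p (grad p (F i) x) (grad p f x)))\<^sup>2
        \<le> \<sigma>t\<^sub>0\<^sup>2 * (vnorm p (grad p f x))\<^sup>2 + \<sigma>\<^sub>2\<^sup>2"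
  shows "(\<Sum>i<n. 4 * p * ((1 + \<sigma>\<^sub>0\<^sup>2) * (vnorm p (grad p (F i) (x i)))\<^sup>2 + \<sigma>\<^sub>1\<^sup>2) + p\<^sup>2 * L\<^sup>2 * (d i)\<^sup>2 / 2) / real n
    \<le> 16 * p * ((1 + \<sigma>\<^sub>0\<^sup>2) * (1 + \<sigma>t\<^sub>0\<^sup>2)) * (vnorm p (grad p f (average n p x)))\<^sup>2
      + 8 * p * (\<sigma>\<^sub>1\<^sup>2 + 2 * (1 + \<sigma>\<^sub>0\<^sup>2) * \<sigma>\<^sub>2\<^sup>2) + 8 * p * (1 + \<sigma>\<^sub>0\<^sup>2) * L\<^sup>2 * consensus_error n p x + p\<^sup>2 * L\<^sup>2 * D / 2"
proof -
  define y where "y = average n p x"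
  have y: "y \<in> Rn p" by (simp add: y_def)
  define G where "G = (vnorm p (grad p f y))\<^sup>2"
  define c where "c = 16 * p * ((1 + \<sigma>\<^sub>0\<^sup>2) * (1 + \<sigma>t\<^sub>0\<^sup>2)) * G + 8 * p * (\<sigma>\<^sub>1\<^sup>2 + 2 * (1 + \<sigma>\<^sub>0\<^sup>2) * \<sigma>\<^sub>2\<^sup>2) + p\<^sup>2 * L\<^sup>2 * D / 2"
  have "(\<Sum>i<n. 4 * p * ((1 + \<sigma>\<^sub>0\<^sup>2) * (vnorm p (grad p (F i) (x i)))\<^sup>2 + \<sigma>\<^sub>1\<^sup>2) + p\<^sup>2 * L\<^sup>2 * (d i)\<^sup>2 / 2)
     \<le> (\<Sum>i<n. c + 8 * p * (1 + \<sigma>\<^sub>0\<^sup>2) * L\<^sup>2 * (vnorm p (vdiff p (x i) y))\<^sup>2)"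
  proof (rule sum_mono)
    fix i assume "i \<in> {..<n}" then have i: "i < n" by simp
    define r where "r = (vnorm p (vdiff p (x i) y))\<^sup>2"
    have "(vnorm p (grad p (F i) (x i)))\<^sup>2 = (\<Sum>j<p. (grad p (F i) y j + vdiff p (grad p (F i) (x i)) (grad p (F i) y) j)\<^sup>2)"
      unfolding vnorm_sq by (intro sum.cong refl) simp
    also have "\<dots> \<le> 2 * (vnorm p (grad p (F i) y))\<^sup>2 + 2 * (vnorm p (vdiff p (grad p (F i) (x i)) (grad p (F i) y)))\<^sup>2"
      unfolding vnorm_sq by (rule sum_square_add_le)
    also have "(vnorm p (vdiff p (grad p (F i) (x i)) (grad p (F i) y)))\<^sup>2 \<le> (L * vnorm p (vdiff p (x i) y))\<^sup>2"
      by (intro power_mono lipschitz_gradD[OF x[OF i] y F[OF i]]) simp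
    also have "(vnorm p (grad p (F i) y))\<^sup>2 = (\<Sum>j<p. (grad p f y j + vdiff p (grad p (F i) y) (grad p f y) j)\<^sup>2)"
      unfolding vnorm_sq by (intro sum.cong refl) simp
    also have "\<dots> \<le> 2 * G + 2 * (vnorm p (vdiff p (grad p (F i) y) (grad p f y)))\<^sup>2"
      unfolding vnorm_sq G_def by (rule sum_square_add_le)
    also have "(vnorm p (vdiff p (grad p (F i) y) (grad p f y)))\<^sup>2 \<le> \<sigma>t\<^sub>0\<^sup>2 * G + \<sigma>\<^sub>2\<^sup>2"
      unfolding G_def by (rule dis[OF i y])
    finally have le: "(vnorm p (grad p (F i) (x i)))\<^sup>2 \<le> 4 * (1 + \<sigma>t\<^sub>0\<^sup>2) * G + 4 * \<sigma>\<^sub>2\<^sup>2 + 2 * L\<^sup>2 * r"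
      by (simp add: r_def power_mult_distrib algebra_simps)
    \<comment> \<open>The summand with \<open>\<sigma>\<^sub>1\<close> is doubled so that 8 p times
      the noise level of the theorem can be factored out.\<close>
    have "4 * p * ((1 + \<sigma>\<^sub>0\<^sup>2) * (vnorm p (grad p (F i) (x i)))\<^sup>2 + \<sigma>\<^sub>1\<^sup>2) \<le> 4 * p * ((1 + \<sigma>\<^sub>0\<^sup>2) * (4 * (1 + \<sigma>t\<^sub>0\<^sup>2) * G + 4 * \<sigma>\<^sub>2\<^sup>2 + 2 * L\<^sup>2 * r) + 2 * \<sigma>\<^sub>1\<^sup>2)"
      by (intro mult_left_mono add_mono le) auto
    moreover have "p\<^sup>2 * L\<^sup>2 * (d i)\<^sup>2 / 2 \<le> p\<^sup>2 * L\<^sup>2 * D / 2"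
      using d[OF i] by (intro divide_right_mono mult_left_mono) auto
    ultimately show "4 * p * ((1 + \<sigma>\<^sub>0\<^sup>2) * (vnorm p (grad p (F i) (x i)))\<^sup>2 + \<sigma>\<^sub>1\<^sup>2) + p\<^sup>2 * L\<^sup>2 * (d i)\<^sup>2 / 2 \<le> c + 8 * p * (1 + \<sigma>\<^sub>0\<^sup>2) * L\<^sup>2 * (vnorm p (vdiff p (x i) y))\<^sup>2"
      unfolding r_def[symmetric] c_def by (simp add: algebra_simps)
  qed
  also have "\<dots> = real n * (c + 8 * p * (1 + \<sigma>\<^sub>0\<^sup>2) * L\<^sup>2 * consensus_error n p x)"
    using n by (simp add: consensus_error_def y_def sum.distrib distrib_left flip: sum_distrib_left)
  finally show ?thesis using n by (simp add: c_def G_def y_def divide_le_eq mult.commute[of "real n"] add_ac)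
qed

lemma descent_step:
  assumes x: "x \<in> Rn p" and \<eta>: "0 \<le> \<eta>"
  shows "f (move p x 1 (\<lambda>j. - \<eta> * g j)) \<le> f x - \<eta> * (\<Sum>j<p. grad p f x j * g j) + L * \<eta>\<^sup>2 / 2 * (\<Sum>j<p. (g j)\<^sup>2)"
proof -
  have fs: "lipschitz_grad p L f" unfolding f by (rule lipschitz_grad_mean(1)[OF L n F])
  have "(\<Sum>j<p. grad p f x j * (- \<eta> * g j)) = - \<eta> * (\<Sum>j<p. grad p f x j * g j)"
    by (simp add: sum_distrib_left mult_ac sum_negf)
  moreover have "(vnorm p (\<lambda>j. - \<eta> * g j))\<^sup>2 = \<eta>\<^sup>2 * (\<Sum>j<p. (g j)\<^sup>2)"
    unfolding vnorm_scale power_mult_distrib vnorm_sq by simp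
  ultimately show ?thesis
    using smooth_bound[OF fs x, of "\<lambda>j. - \<eta> * g j"] unfolding abs_le_iff by (simp add: algebra_simps)
qed

end

text \<open>By polarisation - x b is half of (b - x)^2 - x^2 - b^2, and the term in b^2 absorbs the
  quadratic term since L \<eta> \<le> 1.\<close>

lemma descent_inner:
  fixes x b :: "nat \<Rightarrow> real"
  assumes "0 \<le> \<eta>" "L * \<eta> \<le> 1"
  shows "- \<eta> * (\<Sum>j<p. x j * b j) + L * \<eta>\<^sup>2 / 2 * (\<Sum>j<p. (b j)\<^sup>2) \<le> - (\<eta> / 2) * (\<Sum>j<p. (x j)\<^sup>2) + \<eta> / 2 * (\<Sum>j<p. (b j - x j)\<^sup>2)"
proof -
  have "- \<eta> * (x j * b j) + L * \<eta>\<^sup>2 / 2 * (b j)\<^sup>2 \<le> - (\<eta> / 2) * (x j)\<^sup>2 + \<eta> / 2 * (b j - x j)\<^sup>2" for j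
  proof -
    have "(L * \<eta>) * (\<eta> / 2 * (b j)\<^sup>2) \<le> 1 * (\<eta> / 2 * (b j)\<^sup>2)"
      using assms by (intro mult_right_mono) auto
    then show ?thesis by (simp add: power2_eq_square algebra_simps)
  qed
  then have "(\<Sum>j<p. - \<eta> * (x j * b j) + L * \<eta>\<^sup>2 / 2 * (b j)\<^sup>2) \<le> (\<Sum>j<p. - (\<eta> / 2) * (x j)\<^sup>2 + \<eta> / 2 * (b j - x j)\<^sup>2)"
    by (intro sum_mono) simp
  then show ?thesis by (simp only: sum.distrib sum_distrib_left)
qed

section \<open>Moments of the iterates\<close>

lemma (in stochastic_estimator) f_meas: "f \<in> borel_measurable (lborel_vec p)"
  by (rule X.borel_measurable_lebesgue_integral) (rule F_meas)

lemma (in stochastic_estimator) mean_estimate_meas: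
  "mean_estimate p \<Xi> Fi \<delta> \<in> measurable (lborel_vec p) (lborel_vec p)"
  unfolding mean_estimate_def
proof (rule measurable_lborel_vec_restrict)
  fix j assume j: "j < p"
  have 1: "(\<lambda>w. snd (snd w)) \<in> measurable (lborel_vec p \<Otimes>\<^sub>M (\<Xi> \<Otimes>\<^sub>M uniform_sphere p)) (lborel_vec p)"
    using measurable_compose[OF measurable_snd measurable_snd, of "lborel_vec p" \<Xi> "uniform_sphere p"]
    by (simp add: measurable_cong_sets[OF refl sets_uniform_sphere])
  have "(\<lambda>w. zo_gradient p Fi \<delta> (fst w) (snd (snd w)) (fst (snd w)) j) \<in> borel_measurable (lborel_vec p \<Otimes>\<^sub>M (\<Xi> \<Otimes>\<^sub>M uniform_sphere p))"
    using 1 j by (intro measurable_lborel_vec_nth[where p = p] measurable_zo_gradient[where \<Xi> = \<Xi>] F_meas) auto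
  then have "(\<lambda>(x, w). (\<lambda>(z, u). zo_gradient p Fi \<delta> x u z j) w) \<in> borel_measurable (lborel_vec p \<Otimes>\<^sub>M (\<Xi> \<Otimes>\<^sub>M uniform_sphere p))"
    by (simp add: case_prod_unfold)
  from XU.P.borel_measurable_lebesgue_integral[OF this]
  show "(\<lambda>x. \<integral>(z, u). zo_gradient p Fi \<delta> x u z j \<partial>(\<Xi> \<Otimes>\<^sub>M uniform_sphere p)) \<in> borel_measurable (lborel_vec p)"
    by simp
qed

lemma grad_measurable:
  assumes h: "h \<in> borel_measurable (lborel_vec p)" "lipschitz_grad p L h" and j: "j < p"
  shows "(\<lambda>x. grad p h x j) \<in> borel_measurable (lborel_vec p)"
proof -
  have "(\<lambda>x. move p x t d) \<in> measurable (lborel_vec p) (lborel_vec p)" for t d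
    unfolding move_def by (intro measurable_lborel_vec_restrict borel_measurable_add measurable_nth_lborel_vec) auto
  from measurable_compose[OF this h(1)]
  have "(\<lambda>x. diff_quot p h j x m) \<in> borel_measurable (lborel_vec p)" for m
    unfolding diff_quot_def using h(1) by measurable
  then have "(\<lambda>x. lim (diff_quot p h j x)) \<in> borel_measurable (lborel_vec p)"
    by (rule borel_measurable_lim_metric)
  then show ?thesis
    by (rule measurable_cong[THEN iffD1, rotated]) (simp add: lim_diff_quot[OF _ h(2) j])
qed

text \<open>Second moments are tracked because the expectations to be split involve products of two
  such variables or functions of at most quadratic growth.\<close>

definition square_integrable :: "'w measure \<Rightarrow> ('w \<Rightarrow> real) \<Rightarrow> bool" where
  "square_integrable M Y \<longleftrightarrow> Y \<in> borel_measurable M \<and> integrable M (\<lambda>\<omega>. (Y \<omega>)\<^sup>2)"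

lemma square_integrable_sq: "square_integrable M Y \<Longrightarrow> integrable M (\<lambda>\<omega>. (Y \<omega>)\<^sup>2)"
  by (simp add: square_integrable_def)

lemma square_integrable_mult_integrable:
  assumes "square_integrable M Y" "square_integrable M Z"
  shows "integrable M (\<lambda>\<omega>. Y \<omega> * Z \<omega>)"
proof (rule Bochner_Integration.integrable_bound)
  show "integrable M (\<lambda>\<omega>. (Y \<omega>)\<^sup>2 + (Z \<omega>)\<^sup>2)" using assms by (auto simp: square_integrable_def)
  show "AE \<omega> in M. norm (Y \<omega> * Z \<omega>) \<le> norm ((Y \<omega>)\<^sup>2 + (Z \<omega>)\<^sup>2)"
  proof (rule AE_I2)
    fix \<omega>
    have "2 * (\<bar>Y \<omega>\<bar> * \<bar>Z \<omega>\<bar>) \<le> (Y \<omega>)\<^sup>2 + (Z \<omega>)\<^sup>2"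
      using zero_le_power2[of "\<bar>Y \<omega>\<bar> - \<bar>Z \<omega>\<bar>"] by (simp add: power2_diff mult.assoc)
    moreover have "0 \<le> \<bar>Y \<omega>\<bar> * \<bar>Z \<omega>\<bar>" by simp
    ultimately show "norm (Y \<omega> * Z \<omega>) \<le> norm ((Y \<omega>)\<^sup>2 + (Z \<omega>)\<^sup>2)"
      unfolding real_norm_def abs_mult by linarith
  qed
  show "(\<lambda>\<omega>. Y \<omega> * Z \<omega>) \<in> borel_measurable M"
    using assms by (auto simp: square_integrable_def)
qed

lemma square_integrable_add:
  assumes "square_integrable M Y" "square_integrable M Z"
  shows "square_integrable M (\<lambda>\<omega>. Y \<omega> + Z \<omega>)"
  unfolding square_integrable_def power2_sum
  using assms square_integrable_mult_integrable[OF assms]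
  by (auto simp: square_integrable_def mult.assoc intro!: Bochner_Integration.integrable_add)

lemma square_integrable_cmult:
  "square_integrable M Y \<Longrightarrow> square_integrable M (\<lambda>\<omega>. c * Y \<omega>)"
  by (auto simp: square_integrable_def power_mult_distrib)

lemma square_integrable_diff:
  assumes "square_integrable M Y" "square_integrable M Z"
  shows "square_integrable M (\<lambda>\<omega>. Y \<omega> - Z \<omega>)"
  using square_integrable_add[OF assms(1) square_integrable_cmult[OF assms(2), of "-1"]] by simp

lemma square_integrable_divide:
  "square_integrable M Y \<Longrightarrow> square_integrable M (\<lambda>\<omega>. Y \<omega> / c)"
  using square_integrable_cmult[of M Y "1 / c"] by simp

lemma (in prob_space) square_integrable_const: "square_integrable M (\<lambda>_. c)"
  by (simp add: square_integrable_def)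

lemma square_integrable_sum:
  "(\<And>i. i \<in> I \<Longrightarrow> square_integrable M (Y i)) \<Longrightarrow> square_integrable M (\<lambda>\<omega>. \<Sum>i\<in>I. Y i \<omega>)"
proof (induction I rule: infinite_finite_induct)
  case (insert x F)
  then show ?case by (simp add: square_integrable_add)
qed (simp_all add: square_integrable_def)

lemma square_integrable_bound:
  assumes "square_integrable M Z" "Y \<in> borel_measurable M" "\<And>\<omega>. \<omega> \<in> space M \<Longrightarrow> \<bar>Y \<omega>\<bar> \<le> \<bar>Z \<omega>\<bar>"
  shows "square_integrable M Y"
  unfolding square_integrable_def
proof
  show "integrable M (\<lambda>\<omega>. (Y \<omega>)\<^sup>2)"
  proof (rule Bochner_Integration.integrable_bound[OF square_integrable_sq[OF assms(1)]])
    show "AE \<omega> in M. norm ((Y \<omega>)\<^sup>2) \<le> norm ((Z \<omega>)\<^sup>2)"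
      using assms(3) by (intro AE_I2) (simp add: abs_le_square_iff)
  qed (use assms(2) in auto)
qed (rule assms(2))

lemma square_integrable_vnorm:
  assumes Y: "Y \<in> measurable M (lborel_vec p)" and sq: "\<And>j. j < p \<Longrightarrow> square_integrable M (\<lambda>\<omega>. Y \<omega> j)"
  shows "square_integrable M (\<lambda>\<omega>. vnorm p (Y \<omega>))"
  unfolding square_integrable_def vnorm_sq
  using borel_measurable_vnorm[OF Y] square_integrable_sq[OF sq] by (auto intro!: Bochner_Integration.integrable_sum)

lemma nth_le_vnorm: "j < p \<Longrightarrow> \<bar>x j\<bar> \<le> vnorm p x"
  unfolding vnorm_def L2_set_def by (rule real_le_rsqrt) (auto intro!: member_le_sum[of j _ "\<lambda>j. (x j)\<^sup>2"])

section \<open>The process and its filtration\<close>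

locale zo_run = zo_noise M n p \<Xi> u \<xi>
  for M :: "'w measure" and n p :: nat and \<Xi> :: "nat \<Rightarrow> 'b measure"
    and u :: "nat \<Rightarrow> nat \<Rightarrow> 'w \<Rightarrow> rvec" and \<xi> :: "nat \<Rightarrow> nat \<Rightarrow> 'w \<Rightarrow> 'b" +
  fixes E a F x0 \<delta> and \<eta> \<gamma> Lf \<sigma>\<^sub>0 \<sigma>\<^sub>1 \<sigma>t\<^sub>0 \<sigma>\<^sub>2 \<kappa> \<epsilon>t :: real
  assumes n: "n \<ge> 1" and graph: "weighted_graph n E a" "connected_graph n E"
    and Lf: "Lf > 0" and costs: "stochastic_costs n p \<Xi> F"
    and bdd: "bdd_below (global_cost n \<Xi> F ` Rn p)"
    and smooth: "\<And>i. i < n \<Longrightarrow> AE z in \<Xi> i. lipschitz_grad p Lf (\<lambda>x. F i x z)"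
    and noise: "gradient_noise n p \<Xi> F \<sigma>\<^sub>0 \<sigma>\<^sub>1"
    and dissimilarity: "gradient_dissimilarity n p \<Xi> F \<sigma>t\<^sub>0 \<sigma>\<^sub>2"
    and x0: "\<And>i. i < n \<Longrightarrow> x0 i \<in> Rn p"
    and \<gamma>: "0 < \<gamma>" "\<gamma> < const_d1 (laplacian n a)"
    and \<eta>: "0 < \<eta>" "Lf * \<eta> \<le> 1" and et: "0 < \<epsilon>t" "\<epsilon>t < 1"
    and \<delta>: "\<And>i k. i < n \<Longrightarrow> 0 < \<delta> i k" "\<And>i k. i < n \<Longrightarrow> \<delta> i k \<le> \<kappa> * \<epsilon>t ^ k"
begin

abbreviation "f \<equiv> global_cost n \<Xi> F"
abbreviation "fi i \<equiv> local_cost \<Xi> F i"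
abbreviation "X \<equiv> zo_iterate n p (laplacian n a) \<gamma> (\<lambda>k. \<eta>) \<delta> F u \<xi> x0"
abbreviation "xb k \<omega> \<equiv> average n p (X k \<omega>)"
definition "g i k \<omega> = zo_gradient p (F i) (\<delta> i k) (X k \<omega> i) (u i k \<omega>) (\<xi> i k \<omega>)"
text \<open>In effect the conditional mean of \<open>g i k\<close> given the samples before
  iteration \<open>k\<close>.\<close>

definition "b i k \<omega> = mean_estimate p (\<Xi> i) (F i) (\<delta> i k) (X k \<omega> i)"
text \<open>Strictly earlier samples: the state at iteration \<open>k\<close> is a function of these
  alone.\<close>

definition "past k = {s \<in> idx. case s of Inl (i, l) \<Rightarrow> l < k | Inr (i, l) \<Rightarrow> l < k}"

lemma fi_eq: "fi i = (\<lambda>x. \<integral>z. F i x z \<partial>\<Xi> i)"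
  by (simp add: local_cost_def[abs_def])

lemma f_eq: "f = (\<lambda>x. (\<Sum>i<n. fi i x) / real n)"
  by (simp add: global_cost_def[abs_def])

lemma F_meas: "i < n \<Longrightarrow> (\<lambda>(x, z). F i x z) \<in> borel_measurable (lborel_vec p \<Otimes>\<^sub>M \<Xi> i)"
  using costs by (simp add: stochastic_costs_def)

lemma local_estimator: "i < n \<Longrightarrow> stochastic_estimator p Lf (\<Xi> i) (F i)"
proof (rule stochastic_estimator.intro)
  assume i: "i < n"
  show "AE z in \<Xi> i. lipschitz_grad p Lf (\<lambda>x. F i x z)" by (rule smooth[OF i])
  show "0 \<le> Lf" using Lf by simp
  show "\<And>x. x \<in> Rn p \<Longrightarrow> integrable (\<Xi> i) (F i x)"
    using costs i unfolding stochastic_costs_def by blast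
  show "p \<ge> 1" by (rule p)
qed (auto intro: prob_Xi F_meas)

lemma fi_smooth: "i < n \<Longrightarrow> lipschitz_grad p Lf (fi i)"
  unfolding fi_eq by (rule stochastic_estimator.f_smooth[OF local_estimator])

lemma fi_meas: "i < n \<Longrightarrow> fi i \<in> borel_measurable (lborel_vec p)"
  unfolding fi_eq by (rule stochastic_estimator.f_meas[OF local_estimator])

lemma f_smooth: "lipschitz_grad p Lf f"
  unfolding f_eq using Lf by (intro lipschitz_grad_mean(1) n fi_smooth) auto

lemma f_meas: "f \<in> borel_measurable (lborel_vec p)"
  unfolding f_eq by (intro borel_measurable_divide borel_measurable_sum fi_meas) auto

lemma X_Suc: "X (Suc k) \<omega> i = (\<lambda>j\<in>{..<p}. X k \<omega> i j - \<gamma> * (\<Sum>m<n. laplacian n a $$ (i, m) * X k \<omega> m j) - \<eta> * g i k \<omega> j)"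
  by (simp add: g_def Let_def)

lemma X_Rn: "i < n \<Longrightarrow> X k \<omega> i \<in> Rn p"
  by (cases k) (auto simp: x0 X_Suc simp del: zo_iterate.simps(2))

lemma noise_at: "i < n \<Longrightarrow> x \<in> Rn p \<Longrightarrow>
   (\<integral>\<^sup>+z. ennreal ((vnorm p (vdiff p (grad p (\<lambda>y. F i y z) x) (grad p (\<lambda>x. \<integral>z. F i x z \<partial>\<Xi> i) x)))\<^sup>2) \<partial>\<Xi> i)
        \<le> ennreal (\<sigma>\<^sub>0\<^sup>2 * (vnorm p (grad p (\<lambda>x. \<integral>z. F i x z \<partial>\<Xi> i) x))\<^sup>2 + \<sigma>\<^sub>1\<^sup>2)"
  using noise unfolding gradient_noise_def fi_eq[symmetric] by blast

lemma past_idx: "past k \<subseteq> idx" by (auto simp: past_def)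

lemma past_fresh: "i < n \<Longrightarrow> fresh (past k) i k"
  by (auto simp: fresh_def past_def)

text \<open>Measurability of the estimators and of the iterates is interleaved, since each iterate
  is built from the previous estimators. The set \<open>S\<close> is left free in
  \<open>g_past\<close> so that it may contain the samples of a single agent at iteration
  \<open>k\<close>.\<close>

lemma X_past: "i < n \<Longrightarrow> (\<lambda>\<omega>. X k \<omega> i) \<in> measurable (Fil (past k)) (lborel_vec p)"
  and g_past: "i < n \<Longrightarrow> past k \<subseteq> S \<Longrightarrow> Inl (i, k) \<in> S \<Longrightarrow> Inr (i, k) \<in> S \<Longrightarrow> g i k \<in> measurable (Fil S) (lborel_vec p)"
proof -
  have g: "g i k \<in> measurable (Fil S) (lborel_vec p)"
    if "i < n" "past k \<subseteq> S" "Inl (i, k) \<in> S" "Inr (i, k) \<in> S"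
      and X: "\<And>i. i < n \<Longrightarrow> (\<lambda>\<omega>. X k \<omega> i) \<in> measurable (Fil (past k)) (lborel_vec p)" for i k S
    unfolding g_def[abs_def]
    by (rule measurable_zo_gradient[OF F_meas Fil_mono[OF _ X] u_Fil xi_Fil]) (use that in auto)
  have X: "i < n \<Longrightarrow> (\<lambda>\<omega>. X k \<omega> i) \<in> measurable (Fil (past k)) (lborel_vec p)" for i k
  proof (induction k arbitrary: i)
    case 0
    then show ?case using x0 by simp
  next
    case (Suc k)
    have sub: "past k \<subseteq> past (Suc k)" by (auto simp: past_def split: sum.splits)
    have X: "(\<lambda>\<omega>. X k \<omega> i) \<in> measurable (Fil (past (Suc k))) (lborel_vec p)" if "i < n" for i
      by (rule Fil_mono[OF sub Suc.IH[OF that]])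
    have g: "g i k \<in> measurable (Fil (past (Suc k))) (lborel_vec p)"
      using Suc.prems sub by (intro g Suc.IH) (auto simp: past_def idxI)
    show ?case unfolding X_Suc
      using Suc.prems by (intro measurable_lborel_vec_restrict borel_measurable_diff borel_measurable_times borel_measurable_sum
          borel_measurable_const measurable_lborel_vec_nth[OF X] measurable_lborel_vec_nth[OF g]) auto
  qed
  show "i < n \<Longrightarrow> (\<lambda>\<omega>. X k \<omega> i) \<in> measurable (Fil (past k)) (lborel_vec p)" by (rule X)
  show "i < n \<Longrightarrow> past k \<subseteq> S \<Longrightarrow> Inl (i, k) \<in> S \<Longrightarrow> Inr (i, k) \<in> S \<Longrightarrow> g i k \<in> measurable (Fil S) (lborel_vec p)"
    by (rule g) (auto intro: X)
qed

lemma X_meas: "i < n \<Longrightarrow> (\<lambda>\<omega>. X k \<omega> i) \<in> measurable M (lborel_vec p)"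
  by (rule Fil_subset[OF past_idx X_past])

lemma g_meas: "i < n \<Longrightarrow> g i k \<in> measurable M (lborel_vec p)"
  by (rule Fil_subset[OF order_refl g_past]) (auto simp: past_idx idxI)

lemma b_past: "i < n \<Longrightarrow> b i k \<in> measurable (Fil (past k)) (lborel_vec p)"
  unfolding b_def[abs_def]
  by (rule measurable_compose[OF X_past stochastic_estimator.mean_estimate_meas[OF local_estimator]])

lemma b_meas: "i < n \<Longrightarrow> b i k \<in> measurable M (lborel_vec p)"
  by (rule Fil_subset[OF past_idx b_past])

lemma xb_past: "xb k \<in> measurable (Fil (past k)) (lborel_vec p)"
  unfolding average_def[abs_def]
  by (intro measurable_lborel_vec_restrict borel_measurable_divide borel_measurable_sum borel_measurable_const
      measurable_lborel_vec_nth[OF X_past]) auto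

lemma xb_meas: "xb k \<in> measurable M (lborel_vec p)"
  by (rule Fil_subset[OF past_idx xb_past])

lemma grad_xb_past: "j < p \<Longrightarrow> (\<lambda>\<omega>. grad p f (xb k \<omega>) j) \<in> borel_measurable (Fil (past k))"
  by (rule measurable_compose[OF xb_past grad_measurable[OF f_meas f_smooth]])

lemma grad_fi_meas: "i < n \<Longrightarrow> j < p \<Longrightarrow> (\<lambda>\<omega>. grad p (fi i) (X k \<omega> i) j) \<in> borel_measurable M"
  by (rule measurable_compose[OF X_meas grad_measurable[OF fi_meas fi_smooth]])

text \<open>A Lipschitz gradient grows at most linearly from its value at the origin.\<close>

lemma grad_square_integrable:
  assumes h: "lipschitz_grad p Lf h" "h \<in> borel_measurable (lborel_vec p)"
    and Y: "Y \<in> measurable M (lborel_vec p)" "\<And>j. j < p \<Longrightarrow> square_integrable M (\<lambda>\<omega>. Y \<omega> j)" and j: "j < p"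
  shows "square_integrable M (\<lambda>\<omega>. grad p h (Y \<omega>) j)"
proof -
  obtain w where w: "w \<in> Rn p" "\<And>j. j < p \<Longrightarrow> w j = 0"
    by (rule that[of "\<lambda>j\<in>{..<p}. 0"]) auto
  show ?thesis
  proof (rule square_integrable_bound)
    show "square_integrable M (\<lambda>\<omega>. vnorm p (grad p h w) + Lf * vnorm p (Y \<omega>))"
      by (intro square_integrable_add square_integrable_const square_integrable_cmult square_integrable_vnorm Y)
    show "(\<lambda>\<omega>. grad p h (Y \<omega>) j) \<in> borel_measurable M"
      by (rule measurable_compose[OF Y(1) grad_measurable[OF h(2,1) j]])
    fix \<omega> assume "\<omega> \<in> space M"
    then have y: "Y \<omega> \<in> Rn p" using measurable_space[OF Y(1)] by simp
    have "\<bar>vdiff p (grad p h (Y \<omega>)) (grad p h w) j\<bar> \<le> vnorm p (vdiff p (grad p h (Y \<omega>)) (grad p h w))"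
      by (rule nth_le_vnorm[OF j])
    also have "\<dots> \<le> Lf * vnorm p (vdiff p (Y \<omega>) w)" by (rule lipschitz_gradD[OF y w(1) h(1)])
    also have "vnorm p (vdiff p (Y \<omega>) w) = vnorm p (Y \<omega>)" by (rule vnorm_cong) (simp add: w)
    finally have "\<bar>grad p h (Y \<omega>) j - grad p h w j\<bar> \<le> Lf * vnorm p (Y \<omega>)" using j by simp
    moreover have "\<bar>grad p h w j\<bar> \<le> vnorm p (grad p h w)" by (rule nth_le_vnorm[OF j])
    moreover have "0 \<le> Lf * vnorm p (Y \<omega>)" using Lf by simp
    ultimately show "\<bar>grad p h (Y \<omega>) j\<bar> \<le> \<bar>vnorm p (grad p h w) + Lf * vnorm p (Y \<omega>)\<bar>"
      by linarith
  qed
qed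

definition "Vb i k \<omega> = 4 * p * ((1 + \<sigma>\<^sub>0\<^sup>2) * (vnorm p (grad p (fi i) (X k \<omega> i)))\<^sup>2 + \<sigma>\<^sub>1\<^sup>2) + p\<^sup>2 * Lf\<^sup>2 * (\<delta> i k)\<^sup>2 / 2"

lemma Vb_nonneg: "0 \<le> Vb i k \<omega>" by (simp add: Vb_def)

lemma g_nn_integral: "i < n \<Longrightarrow> (\<integral>\<^sup>+\<omega>. ennreal (\<Sum>j<p. (g i k \<omega> j)\<^sup>2) \<partial>M) \<le> (\<integral>\<^sup>+\<omega>. ennreal (Vb i k \<omega>) \<partial>M)"
proof -
  assume i: "i < n"
  let ?\<phi> = "\<lambda>w. ennreal (\<Sum>j<p. (zo_gradient p (F i) (\<delta> i k) (fst w) (snd (snd w)) (fst (snd w)) j)\<^sup>2)"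
  have 1: "(\<lambda>w. snd (snd w)) \<in> measurable (lborel_vec p \<Otimes>\<^sub>M (\<Xi> i \<Otimes>\<^sub>M uniform_sphere p)) (lborel_vec p)"
    using measurable_compose[OF measurable_snd measurable_snd, of "lborel_vec p" "\<Xi> i" "uniform_sphere p"]
    by (simp add: measurable_cong_sets[OF refl sets_uniform_sphere])
  have "(\<lambda>w. zo_gradient p (F i) (\<delta> i k) (fst w) (snd (snd w)) (fst (snd w)) j) \<in> borel_measurable (lborel_vec p \<Otimes>\<^sub>M (\<Xi> i \<Otimes>\<^sub>M uniform_sphere p))" if "j < p" for j
    using 1 that i by (intro measurable_lborel_vec_nth[where p = p] measurable_zo_gradient[where \<Xi> = "\<Xi> i"] F_meas) auto
  then have m: "?\<phi> \<in> borel_measurable (lborel_vec p \<Otimes>\<^sub>M (\<Xi> i \<Otimes>\<^sub>M uniform_sphere p))"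
    by (intro measurable_compose[OF _ measurable_ennreal] borel_measurable_sum borel_measurable_power) auto
  have "(\<integral>\<^sup>+\<omega>. ennreal (\<Sum>j<p. (g i k \<omega> j)\<^sup>2) \<partial>M) = (\<integral>\<^sup>+\<omega>. (\<integral>\<^sup>+w. ?\<phi> (X k \<omega> i, w) \<partial>(\<Xi> i \<Otimes>\<^sub>M uniform_sphere p)) \<partial>M)"
    using nn_integral_fresh[OF past_fresh[OF i] X_past[OF i] m] by (simp add: g_def)
  also have "\<dots> \<le> (\<integral>\<^sup>+\<omega>. ennreal (Vb i k \<omega>) \<partial>M)"
  proof (rule nn_integral_mono)
    fix \<omega>
    show "(\<integral>\<^sup>+w. ?\<phi> (X k \<omega> i, w) \<partial>(\<Xi> i \<Otimes>\<^sub>M uniform_sphere p)) \<le> ennreal (Vb i k \<omega>)"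
      using stochastic_estimator.zo_second_moment[OF local_estimator[OF i] X_Rn[OF i] \<delta>(1)[OF i] noise_at[OF i X_Rn[OF i]]]
      by (simp add: Vb_def fi_eq case_prod_unfold)
  qed
  finally show ?thesis .
qed

text \<open>One induction serves all four: square integrable iterates have square integrable
  gradients, these bound the second moment of the estimators, and the next iterate is a linear
  combination of iterates and estimators.\<close>

lemma X_square_integrable: "i < n \<Longrightarrow> j < p \<Longrightarrow> square_integrable M (\<lambda>\<omega>. X k \<omega> i j)"
  and g_square_sum: "i < n \<Longrightarrow> integrable M (\<lambda>\<omega>. \<Sum>j<p. (g i k \<omega> j)\<^sup>2)"
  and Vb_integrable: "i < n \<Longrightarrow> integrable M (Vb i k)"
  and g_square_integrable: "i < n \<Longrightarrow> j < p \<Longrightarrow> square_integrable M (\<lambda>\<omega>. g i k \<omega> j)"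
proof -
  have step: "integrable M (Vb i k) \<and> integrable M (\<lambda>\<omega>. \<Sum>j<p. (g i k \<omega> j)\<^sup>2) \<and> (\<forall>j<p. square_integrable M (\<lambda>\<omega>. g i k \<omega> j))"
    if i: "i < n" and X: "\<And>j. j < p \<Longrightarrow> square_integrable M (\<lambda>\<omega>. X k \<omega> i j)" for i k
  proof -
    have "square_integrable M (\<lambda>\<omega>. grad p (fi i) (X k \<omega> i) j)" if "j < p" for j
      by (rule grad_square_integrable[OF fi_smooth[OF i] fi_meas[OF i] X_meas[OF i] X that])
    then have V: "integrable M (Vb i k)"
      unfolding Vb_def[abs_def] vnorm_sq
      by (intro Bochner_Integration.integrable_add integrable_mult_right Bochner_Integration.integrable_sum square_integrable_sq square_integrable_const) auto
    note gm = measurable_lborel_vec_nth[OF g_meas[OF i]]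
    have "(\<integral>\<^sup>+\<omega>. ennreal (\<Sum>j<p. (g i k \<omega> j)\<^sup>2) \<partial>M) < \<infinity>"
      using order_le_less_trans[OF g_nn_integral[OF i]] V Vb_nonneg by (simp add: nn_integral_eq_integral)
    then have s: "integrable M (\<lambda>\<omega>. \<Sum>j<p. (g i k \<omega> j)\<^sup>2)"
      using gm by (intro integrableI_nonneg AE_I2 sum_nonneg) auto
    have "integrable M (\<lambda>\<omega>. (g i k \<omega> j)\<^sup>2)" if j: "j < p" for j
    proof (rule Bochner_Integration.integrable_bound[OF s])
      show "(\<lambda>\<omega>. (g i k \<omega> j)\<^sup>2) \<in> borel_measurable M" using gm[OF j] by auto
      show "AE \<omega> in M. norm ((g i k \<omega> j)\<^sup>2) \<le> norm (\<Sum>j<p. (g i k \<omega> j)\<^sup>2)"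
        using j by (intro AE_I2) (auto simp: sum_nonneg intro!: member_le_sum)
    qed
    then show ?thesis using V s gm by (auto simp: square_integrable_def)
  qed
  have X: "square_integrable M (\<lambda>\<omega>. X k \<omega> i j)" if "i < n" "j < p" for i j k
    using that
  proof (induction k arbitrary: i j)
    case 0
    then show ?case by (simp add: square_integrable_const)
  next
    case (Suc k)
    have "square_integrable M (\<lambda>\<omega>. X k \<omega> i j - \<gamma> * (\<Sum>m<n. laplacian n a $$ (i, m) * X k \<omega> m j) - \<eta> * g i k \<omega> j)"
      using Suc step[of i k] by (intro square_integrable_diff square_integrable_cmult square_integrable_sum) auto
    then show ?case unfolding X_Suc using Suc.prems by simp
  qed
  show "i < n \<Longrightarrow> j < p \<Longrightarrow> square_integrable M (\<lambda>\<omega>. X k \<omega> i j)"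
    "i < n \<Longrightarrow> integrable M (\<lambda>\<omega>. \<Sum>j<p. (g i k \<omega> j)\<^sup>2)"
    "i < n \<Longrightarrow> integrable M (Vb i k)"
    "i < n \<Longrightarrow> j < p \<Longrightarrow> square_integrable M (\<lambda>\<omega>. g i k \<omega> j)"
    using X step[of i k] by auto
qed

lemma g_second_moment: "i < n \<Longrightarrow> (\<integral>\<omega>. (\<Sum>j<p. (g i k \<omega> j)\<^sup>2) \<partial>M) \<le> (\<integral>\<omega>. Vb i k \<omega> \<partial>M)"
proof -
  assume i: "i < n"
  have "ennreal (\<integral>\<omega>. (\<Sum>j<p. (g i k \<omega> j)\<^sup>2) \<partial>M) \<le> ennreal (\<integral>\<omega>. Vb i k \<omega> \<partial>M)"
    using g_nn_integral[OF i, of k] g_square_sum[OF i, of k] Vb_integrable[OF i, of k] Vb_nonneg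
    by (simp add: nn_integral_eq_integral sum_nonneg)
  moreover have "0 \<le> (\<integral>\<omega>. Vb i k \<omega> \<partial>M)" by (rule Bochner_Integration.integral_nonneg) (rule Vb_nonneg)
  ultimately show ?thesis by (simp only: ennreal_le_iff)
qed

lemma b_bias: "i < n \<Longrightarrow> vnorm p (vdiff p (b i k \<omega>) (grad p (fi i) (X k \<omega> i))) \<le> sqrt p * (Lf * \<delta> i k / 2)"
  using stochastic_estimator.mean_estimate_bias[OF local_estimator X_Rn \<delta>(1) noise_at[OF _ X_Rn]] by (simp add: b_def fi_eq)

lemma grad_fi_square_integrable: "i < n \<Longrightarrow> j < p \<Longrightarrow> square_integrable M (\<lambda>\<omega>. grad p (fi i) (X k \<omega> i) j)"
  by (rule grad_square_integrable[OF fi_smooth fi_meas X_meas X_square_integrable])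

text \<open>The distance to the square integrable true gradient is at most the bias, a deterministic
  number.\<close>

lemma b_square_integrable: "i < n \<Longrightarrow> j < p \<Longrightarrow> square_integrable M (\<lambda>\<omega>. b i k \<omega> j)"
proof -
  assume i: "i < n" and j: "j < p"
  have "square_integrable M (\<lambda>\<omega>. b i k \<omega> j - grad p (fi i) (X k \<omega> i) j)"
  proof (rule square_integrable_bound[OF square_integrable_const])
    show "(\<lambda>\<omega>. b i k \<omega> j - grad p (fi i) (X k \<omega> i) j) \<in> borel_measurable M"
      by (intro borel_measurable_diff measurable_lborel_vec_nth[OF b_meas[OF i] j] grad_fi_meas i j)
    fix \<omega>
    have "\<bar>vdiff p (b i k \<omega>) (grad p (fi i) (X k \<omega> i)) j\<bar> \<le> sqrt p * (Lf * \<delta> i k / 2)"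
      by (rule order_trans[OF nth_le_vnorm[OF j] b_bias[OF i]])
    then show "\<bar>b i k \<omega> j - grad p (fi i) (X k \<omega> i) j\<bar> \<le> \<bar>sqrt p * (Lf * \<delta> i k / 2)\<bar>" using j by simp
  qed
  from square_integrable_add[OF this grad_fi_square_integrable[OF i j, of k]] show ?thesis by simp
qed

text \<open>The iterate and the factor \<open>Y\<close> are frozen together as a pair, after which
  the centred estimator has mean zero by the definition of \<open>mean_estimate\<close>. The set
  \<open>S\<close> may go beyond the past, so \<open>Y\<close> may involve another agent's samples
  of the same iteration.\<close>

lemma noise_orthogonal:
  assumes S: "past k \<subseteq> S" "fresh S i k" and Y: "Y \<in> borel_measurable (Fil S)" "square_integrable M Y" and j: "j < p"
  shows "(\<integral>\<omega>. Y \<omega> * (g i k \<omega> j - b i k \<omega> j) \<partial>M) = 0"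
proof -
  have i: "i < n" using S by (simp add: fresh_def)
  interpret Est: stochastic_estimator p Lf "\<Xi> i" "F i" by (rule local_estimator[OF i])
  let ?N = "borel \<Otimes>\<^sub>M lborel_vec p :: (real \<times> rvec) measure"
  let ?P = "?N \<Otimes>\<^sub>M (\<Xi> i \<Otimes>\<^sub>M uniform_sphere p)"
  let ?Y = "\<lambda>\<omega>. (Y \<omega>, X k \<omega> i)"
  let ?\<phi> = "\<lambda>w. fst (fst w) * (zo_gradient p (F i) (\<delta> i k) (snd (fst w)) (snd (snd w)) (fst (snd w)) j
      - mean_estimate p (\<Xi> i) (F i) (\<delta> i k) (snd (fst w)) j)"
  have YS: "?Y \<in> measurable (Fil S) ?N"
    by (intro measurable_Pair Y(1) Fil_mono[OF S(1) X_past[OF i]])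
  have 1: "(\<lambda>w. snd (snd w)) \<in> measurable ?P (lborel_vec p)"
    using measurable_compose[OF measurable_snd measurable_snd, of ?N "\<Xi> i" "uniform_sphere p"]
    by (simp add: measurable_cong_sets[OF refl sets_uniform_sphere])
  have 2: "(\<lambda>w. snd (fst w)) \<in> measurable ?P (lborel_vec p)"
    by (rule measurable_compose[OF measurable_fst measurable_snd])
  have 3: "(\<lambda>w. fst (snd w)) \<in> measurable ?P (\<Xi> i)"
    by (rule measurable_compose[OF measurable_snd measurable_fst])
  have 4: "(\<lambda>w. fst (fst w)) \<in> measurable ?P borel"
    by (rule measurable_compose[OF measurable_fst measurable_fst])
  have \<phi>: "?\<phi> \<in> borel_measurable ?P"
    by (intro borel_measurable_times borel_measurable_diff 4
      measurable_lborel_vec_nth[OF measurable_zo_gradient[OF F_meas[OF i] 2 1 3] j]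
      measurable_lborel_vec_nth[OF measurable_compose[OF 2 Est.mean_estimate_meas] j])
  have int: "integrable M (\<lambda>\<omega>. Y \<omega> * (g i k \<omega> j - b i k \<omega> j))"
    by (intro square_integrable_mult_integrable Y square_integrable_diff g_square_integrable b_square_integrable i j)
  then have int': "integrable M (\<lambda>\<omega>. ?\<phi> (?Y \<omega>, (\<xi> i k \<omega>, u i k \<omega>)))" by (simp add: g_def b_def)
  have z: "(\<integral>w. ?\<phi> (?Y \<omega>, w) \<partial>(\<Xi> i \<Otimes>\<^sub>M uniform_sphere p)) = 0" for \<omega>
  proof -
    have zi: "integrable (\<Xi> i \<Otimes>\<^sub>M uniform_sphere p) (\<lambda>w. zo_gradient p (F i) (\<delta> i k) (X k \<omega> i) (snd w) (fst w) j)"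
      using Est.zo_integrable[OF X_Rn[OF i] \<delta>(1)[OF i] j noise_at[OF i X_Rn[OF i]]] by (simp add: case_prod_unfold)
    have "(\<integral>w. ?\<phi> (?Y \<omega>, w) \<partial>(\<Xi> i \<Otimes>\<^sub>M uniform_sphere p)) = Y \<omega> *
      ((\<integral>w. zo_gradient p (F i) (\<delta> i k) (X k \<omega> i) (snd w) (fst w) j \<partial>(\<Xi> i \<Otimes>\<^sub>M uniform_sphere p))
       - mean_estimate p (\<Xi> i) (F i) (\<delta> i k) (X k \<omega> i) j)"
      using zi by (simp add: prob_space.prob_space[OF prob_space_sample[OF i]])
    then show ?thesis using j by (simp add: mean_estimate_def case_prod_unfold)
  qed
  have "(\<integral>\<omega>. Y \<omega> * (g i k \<omega> j - b i k \<omega> j) \<partial>M) = (\<integral>\<omega>. ?\<phi> (?Y \<omega>, (\<xi> i k \<omega>, u i k \<omega>)) \<partial>M)"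
    by (simp add: g_def b_def)
  also have "\<dots> = 0" unfolding integral_fresh[OF S(2) YS \<phi> int'] z by simp
  finally show ?thesis .
qed

end

section \<open>The recursions in expectation\<close>

context zo_run
begin

definition "ce k = (\<integral>\<omega>. consensus_error n p (X k \<omega>) \<partial>M)"
definition "gap k = (\<integral>\<omega>. f (xb k \<omega>) - min_value p f \<partial>M)"
definition "gsq k = (\<integral>\<omega>. (vnorm p (grad p f (xb k \<omega>)))\<^sup>2 \<partial>M)"
definition "gm k \<omega> j = (\<Sum>i<n. g i k \<omega> j) / real n"
definition "bm k \<omega> j = (\<Sum>i<n. b i k \<omega> j) / real n"
text \<open>The centred part of the averaged estimator \<open>gm\<close>, with \<open>bm\<close> as
  its predictable part.\<close>

definition "zm k \<omega> j = (\<Sum>i<n. g i k \<omega> j - b i k \<omega> j) / real n"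

lemma gm_split: "gm k \<omega> j = bm k \<omega> j + zm k \<omega> j"
  by (simp add: gm_def bm_def zm_def sum_subtractf add_divide_distrib[symmetric])

lemma bm_past: "j < p \<Longrightarrow> (\<lambda>\<omega>. bm k \<omega> j) \<in> borel_measurable (Fil (past k))"
  unfolding bm_def by (intro borel_measurable_divide borel_measurable_sum measurable_lborel_vec_nth[OF b_past] borel_measurable_const) auto

lemma bm_square_integrable: "j < p \<Longrightarrow> square_integrable M (\<lambda>\<omega>. bm k \<omega> j)"
  unfolding bm_def by (intro square_integrable_divide square_integrable_sum b_square_integrable) auto

lemma dev_square_integrable: "i < n \<Longrightarrow> j < p \<Longrightarrow> square_integrable M (\<lambda>\<omega>. g i k \<omega> j - b i k \<omega> j)"
  by (intro square_integrable_diff g_square_integrable b_square_integrable)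

lemma zm_square_integrable: "j < p \<Longrightarrow> square_integrable M (\<lambda>\<omega>. zm k \<omega> j)"
  unfolding zm_def by (intro square_integrable_divide square_integrable_sum dev_square_integrable) auto

lemma gm_square_integrable: "j < p \<Longrightarrow> square_integrable M (\<lambda>\<omega>. gm k \<omega> j)"
  unfolding gm_def by (intro square_integrable_divide square_integrable_sum g_square_integrable) auto

lemma xb_square_integrable: "j < p \<Longrightarrow> square_integrable M (\<lambda>\<omega>. xb k \<omega> j)"
  by (simp, intro square_integrable_divide square_integrable_sum X_square_integrable) auto

lemma grad_xb_square_integrable: "j < p \<Longrightarrow> square_integrable M (\<lambda>\<omega>. grad p f (xb k \<omega>) j)"
  by (rule grad_square_integrable[OF f_smooth f_meas xb_meas xb_square_integrable])

lemma consensus_integrable: "integrable M (\<lambda>\<omega>. consensus_error n p (X k \<omega>))"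
proof -
  have "square_integrable M (\<lambda>\<omega>. X k \<omega> i j - (\<Sum>i<n. X k \<omega> i j) / real n)" if "i < n" "j < p" for i j
    using that by (intro square_integrable_diff square_integrable_divide square_integrable_sum X_square_integrable) auto
  then show ?thesis
    unfolding consensus_error_eq
    by (intro integrable_divide Bochner_Integration.integrable_sum square_integrable_sq) auto
qed

lemma gsq_integrable: "integrable M (\<lambda>\<omega>. (vnorm p (grad p f (xb k \<omega>)))\<^sup>2)"
  unfolding vnorm_sq by (intro Bochner_Integration.integrable_sum square_integrable_sq grad_xb_square_integrable) auto

text \<open>The quadratic remainder at the origin compares \<open>f\<close> with an affine function,
  so square integrability of the averaged iterate suffices.\<close>

lemma f_xb_integrable: "integrable M (\<lambda>\<omega>. f (xb k \<omega>))"
proof -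
  obtain w where w: "w \<in> Rn p" "\<And>j. j < p \<Longrightarrow> w j = 0"
    by (rule that[of "\<lambda>j\<in>{..<p}. 0"]) auto
  let ?q = "\<lambda>\<omega>. f w + (\<Sum>j<p. grad p f w j * xb k \<omega> j)"
  have int: "integrable M (\<lambda>\<omega>. xb k \<omega> j)" if "j < p" for j
    using square_integrable_mult_integrable[OF xb_square_integrable[OF that] square_integrable_const[of 1]] by simp
  have q: "integrable M ?q"
    by (intro Bochner_Integration.integrable_add Bochner_Integration.integrable_sum integrable_mult_right int) auto
  have r: "integrable M (\<lambda>\<omega>. Lf / 2 * (vnorm p (xb k \<omega>))\<^sup>2)"
    unfolding vnorm_sq by (intro integrable_mult_right Bochner_Integration.integrable_sum square_integrable_sq xb_square_integrable) auto
  have "integrable M (\<lambda>\<omega>. f (xb k \<omega>) - ?q \<omega>)"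
  proof (rule Bochner_Integration.integrable_bound[OF r])
    show "(\<lambda>\<omega>. f (xb k \<omega>) - ?q \<omega>) \<in> borel_measurable M"
      using measurable_compose[OF xb_meas f_meas] borel_measurable_integrable[OF q] by (rule borel_measurable_diff)
    show "AE \<omega> in M. norm (f (xb k \<omega>) - ?q \<omega>) \<le> norm (Lf / 2 * (vnorm p (xb k \<omega>))\<^sup>2)"
    proof (rule AE_I2)
      fix \<omega>
      have "move p w 1 (xb k \<omega>) = xb k \<omega>" by (rule Rn_eqI[of _ p]) (auto simp: w)
      then show "norm (f (xb k \<omega>) - ?q \<omega>) \<le> norm (Lf / 2 * (vnorm p (xb k \<omega>))\<^sup>2)"
        using smooth_bound[OF f_smooth w(1), of "xb k \<omega>"] Lf by (simp add: diff_diff_add)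
    qed
  qed
  from Bochner_Integration.integrable_add[OF this q] show ?thesis by simp
qed

lemma gap_nonneg: "0 \<le> f (xb k \<omega>) - min_value p f"
  using min_value_le[OF bdd, of "xb k \<omega>"] by simp

lemma deviation_orthogonal:
  assumes Y: "Y \<in> borel_measurable (Fil (past k))" "square_integrable M Y" and j: "j < p"
  shows "(\<integral>\<omega>. Y \<omega> * zm k \<omega> j \<partial>M) = 0"
proof -
  have eq: "Y \<omega> * zm k \<omega> j = (\<Sum>i<n. Y \<omega> * (g i k \<omega> j - b i k \<omega> j)) / real n" for \<omega>
    by (simp add: zm_def sum_distrib_left)
  have "(\<integral>\<omega>. Y \<omega> * zm k \<omega> j \<partial>M) = (\<Sum>i<n. \<integral>\<omega>. Y \<omega> * (g i k \<omega> j - b i k \<omega> j) \<partial>M) / real n"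
    unfolding eq using j
    by (subst integral_divide_zero, subst Bochner_Integration.integral_sum)
       (auto intro!: square_integrable_mult_integrable Y dev_square_integrable)
  also have "\<dots> = 0"
    using noise_orthogonal[OF order_refl past_fresh Y j] by simp
  finally show ?thesis .
qed

text \<open>The cross term vanishes, so this is the inequality between variance and second
  moment.\<close>

lemma deviation_square:
  assumes i: "i < n" and j: "j < p"
  shows "(\<integral>\<omega>. (g i k \<omega> j - b i k \<omega> j)\<^sup>2 \<partial>M) \<le> (\<integral>\<omega>. (g i k \<omega> j)\<^sup>2 \<partial>M)"
proof -
  let ?z = "\<lambda>\<omega>. g i k \<omega> j - b i k \<omega> j"
  note z = dev_square_integrable[OF i j, of k] and b = b_square_integrable[OF i j, of k]
  have eq: "(g i k \<omega> j)\<^sup>2 = (?z \<omega>)\<^sup>2 + (b i k \<omega> j)\<^sup>2 + 2 * (b i k \<omega> j * ?z \<omega>)" for \<omega>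
    by (simp add: power2_eq_square algebra_simps)
  have "(\<integral>\<omega>. (g i k \<omega> j)\<^sup>2 \<partial>M) = (\<integral>\<omega>. (?z \<omega>)\<^sup>2 \<partial>M) + (\<integral>\<omega>. (b i k \<omega> j)\<^sup>2 \<partial>M) + 2 * (\<integral>\<omega>. b i k \<omega> j * ?z \<omega> \<partial>M)"
    unfolding eq using square_integrable_sq[OF z] square_integrable_sq[OF b] square_integrable_mult_integrable[OF b z]
    by (subst Bochner_Integration.integral_add, (auto intro!: Bochner_Integration.integrable_add)[2],
        subst Bochner_Integration.integral_add) auto
  also have "(\<integral>\<omega>. b i k \<omega> j * ?z \<omega> \<partial>M) = 0"
    by (rule noise_orthogonal[OF order_refl past_fresh[OF i] measurable_lborel_vec_nth[OF b_past[OF i] j] b j])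
  finally show ?thesis by simp
qed

text \<open>Enlarging the past by the samples of agent \<open>i\<close> makes its deviation known,
  while the samples of agent \<open>i'\<close> remain fresh.\<close>

lemma deviation_cross:
  assumes i: "i < n" "i' < n" "i \<noteq> i'" and j: "j < p"
  shows "(\<integral>\<omega>. (g i k \<omega> j - b i k \<omega> j) * (g i' k \<omega> j - b i' k \<omega> j) \<partial>M) = 0"
proof (rule noise_orthogonal[OF _ _ _ dev_square_integrable[OF i(1) j] j])
  let ?S = "past k \<union> {Inl (i, k), Inr (i, k)}"
  show "past k \<subseteq> ?S" by auto
  show "fresh ?S i' k" using past_fresh[OF i(2), of k] i by (auto simp: fresh_def idxI)
  have g: "g i k \<in> measurable (Fil ?S) (lborel_vec p)" by (rule g_past[OF i(1)]) auto
  have b: "b i k \<in> measurable (Fil ?S) (lborel_vec p)" by (rule Fil_mono[OF _ b_past[OF i(1)]]) auto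
  show "(\<lambda>\<omega>. g i k \<omega> j - b i k \<omega> j) \<in> borel_measurable (Fil ?S)"
    by (intro borel_measurable_diff measurable_lborel_vec_nth[OF g j] measurable_lborel_vec_nth[OF b j])
qed

text \<open>Independence across the agents is what produces the factor \<open>1 / n\<close> in the variance of the mean.\<close>

lemma mean_deviation_square:
  assumes j: "j < p"
  shows "(\<integral>\<omega>. (zm k \<omega> j)\<^sup>2 \<partial>M) \<le> (\<Sum>i<n. \<integral>\<omega>. (g i k \<omega> j)\<^sup>2 \<partial>M) / (real n)\<^sup>2"
proof -
  let ?z = "\<lambda>i \<omega>. g i k \<omega> j - b i k \<omega> j"
  have eq: "(zm k \<omega> j)\<^sup>2 = (\<Sum>i<n. \<Sum>i'<n. ?z i \<omega> * ?z i' \<omega>) / (real n)\<^sup>2" for \<omega>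
    by (simp add: zm_def power2_eq_square sum_product)
  have int: "integrable M (\<lambda>\<omega>. ?z i \<omega> * ?z i' \<omega>)" if "i < n" "i' < n" for i i'
    using that j by (intro square_integrable_mult_integrable dev_square_integrable)
  have "(\<integral>\<omega>. (zm k \<omega> j)\<^sup>2 \<partial>M) = (\<Sum>i<n. \<Sum>i'<n. \<integral>\<omega>. ?z i \<omega> * ?z i' \<omega> \<partial>M) / (real n)\<^sup>2"
  proof -
    have "(\<integral>\<omega>. (\<Sum>i<n. \<Sum>i'<n. ?z i \<omega> * ?z i' \<omega>) \<partial>M) = (\<Sum>i<n. \<integral>\<omega>. (\<Sum>i'<n. ?z i \<omega> * ?z i' \<omega>) \<partial>M)"
      by (rule Bochner_Integration.integral_sum) (auto intro!: Bochner_Integration.integrable_sum int)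
    also have "\<dots> = (\<Sum>i<n. \<Sum>i'<n. \<integral>\<omega>. ?z i \<omega> * ?z i' \<omega> \<partial>M)"
      by (intro sum.cong[OF refl] Bochner_Integration.integral_sum) (auto intro!: int)
    finally show ?thesis unfolding eq by simp
  qed
  also have "(\<Sum>i<n. \<Sum>i'<n. \<integral>\<omega>. ?z i \<omega> * ?z i' \<omega> \<partial>M) = (\<Sum>i<n. \<Sum>i'<n. if i = i' then \<integral>\<omega>. (?z i \<omega>)\<^sup>2 \<partial>M else 0)"
  proof (intro sum.cong[OF refl])
    fix i i' assume "i \<in> {..<n}" "i' \<in> {..<n}"
    then show "(\<integral>\<omega>. ?z i \<omega> * ?z i' \<omega> \<partial>M) = (if i = i' then \<integral>\<omega>. (?z i \<omega>)\<^sup>2 \<partial>M else 0)"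
      using deviation_cross[of i i' j k] j by (auto simp: power2_eq_square)
  qed
  also have "\<dots> = (\<Sum>i<n. \<integral>\<omega>. (?z i \<omega>)\<^sup>2 \<partial>M)" by (simp add: sum.delta)
  also have "\<dots> / (real n)\<^sup>2 \<le> (\<Sum>i<n. \<integral>\<omega>. (g i k \<omega> j)\<^sup>2 \<partial>M) / (real n)\<^sup>2"
    by (intro divide_right_mono sum_mono deviation_square j) auto
  finally show ?thesis .
qed

definition "D k = \<kappa>\<^sup>2 * (\<epsilon>t\<^sup>2) ^ k"

lemma \<delta>_sq: "i < n \<Longrightarrow> (\<delta> i k)\<^sup>2 \<le> D k"
proof -
  assume i: "i < n"
  have "(\<delta> i k)\<^sup>2 \<le> (\<kappa> * \<epsilon>t ^ k)\<^sup>2" using \<delta>[OF i, of k] by (intro power_mono) auto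
  then show ?thesis by (simp add: D_def power_mult_distrib power_mult[symmetric] mult.commute)
qed

lemma D_nonneg: "0 \<le> D k" by (simp add: D_def)

definition "V k = 16 * p * ((1 + \<sigma>\<^sub>0\<^sup>2) * (1 + \<sigma>t\<^sub>0\<^sup>2)) * gsq k + 8 * p * (\<sigma>\<^sub>1\<^sup>2 + 2 * (1 + \<sigma>\<^sub>0\<^sup>2) * \<sigma>\<^sub>2\<^sup>2)
    + 8 * p * (1 + \<sigma>\<^sub>0\<^sup>2) * Lf\<^sup>2 * ce k + p\<^sup>2 * Lf\<^sup>2 * D k / 2"

lemma second_moment_le_V: "(\<Sum>i<n. \<integral>\<omega>. (\<Sum>j<p. (g i k \<omega> j)\<^sup>2) \<partial>M) / real n \<le> V k"
proof -
  have "(\<Sum>i<n. \<integral>\<omega>. (\<Sum>j<p. (g i k \<omega> j)\<^sup>2) \<partial>M) / real n \<le> (\<Sum>i<n. \<integral>\<omega>. Vb i k \<omega> \<partial>M) / real n"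
    by (intro divide_right_mono sum_mono g_second_moment) auto
  also have "\<dots> = (\<integral>\<omega>. (\<Sum>i<n. Vb i k \<omega>) / real n \<partial>M)"
    by (subst integral_divide_zero, subst Bochner_Integration.integral_sum) (auto intro: Vb_integrable)
  also have "\<dots> \<le> (\<integral>\<omega>. 16 * p * ((1 + \<sigma>\<^sub>0\<^sup>2) * (1 + \<sigma>t\<^sub>0\<^sup>2)) * (vnorm p (grad p f (xb k \<omega>)))\<^sup>2
      + 8 * p * (\<sigma>\<^sub>1\<^sup>2 + 2 * (1 + \<sigma>\<^sub>0\<^sup>2) * \<sigma>\<^sub>2\<^sup>2) + 8 * p * (1 + \<sigma>\<^sub>0\<^sup>2) * Lf\<^sup>2 * consensus_error n p (X k \<omega>) + p\<^sup>2 * Lf\<^sup>2 * D k / 2 \<partial>M)"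
  proof (rule integral_mono)
    show "integrable M (\<lambda>\<omega>. (\<Sum>i<n. Vb i k \<omega>) / real n)"
      by (intro integrable_divide Bochner_Integration.integrable_sum Vb_integrable) auto
    show "integrable M (\<lambda>\<omega>. 16 * p * ((1 + \<sigma>\<^sub>0\<^sup>2) * (1 + \<sigma>t\<^sub>0\<^sup>2)) * (vnorm p (grad p f (xb k \<omega>)))\<^sup>2
      + 8 * p * (\<sigma>\<^sub>1\<^sup>2 + 2 * (1 + \<sigma>\<^sub>0\<^sup>2) * \<sigma>\<^sub>2\<^sup>2) + 8 * p * (1 + \<sigma>\<^sub>0\<^sup>2) * Lf\<^sup>2 * consensus_error n p (X k \<omega>) + p\<^sup>2 * Lf\<^sup>2 * D k / 2)"
      by (intro Bochner_Integration.integrable_add integrable_mult_right gsq_integrable consensus_integrable) auto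
    fix \<omega>
    have dis: "\<And>i x. i < n \<Longrightarrow> x \<in> Rn p \<Longrightarrow> (vnorm p (vdiff p (grad p (fi i) x) (grad p f x)))\<^sup>2
        \<le> \<sigma>t\<^sub>0\<^sup>2 * (vnorm p (grad p f x))\<^sup>2 + \<sigma>\<^sub>2\<^sup>2"
      using dissimilarity unfolding gradient_dissimilarity_def by blast
    show "(\<Sum>i<n. Vb i k \<omega>) / real n \<le> 16 * p * ((1 + \<sigma>\<^sub>0\<^sup>2) * (1 + \<sigma>t\<^sub>0\<^sup>2)) * (vnorm p (grad p f (xb k \<omega>)))\<^sup>2
      + 8 * p * (\<sigma>\<^sub>1\<^sup>2 + 2 * (1 + \<sigma>\<^sub>0\<^sup>2) * \<sigma>\<^sub>2\<^sup>2) + 8 * p * (1 + \<sigma>\<^sub>0\<^sup>2) * Lf\<^sup>2 * consensus_error n p (X k \<omega>) + p\<^sup>2 * Lf\<^sup>2 * D k / 2"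
      unfolding Vb_def
      by (rule mean_variance_bound[OF n less_imp_le[OF Lf] fi_smooth f_eq X_Rn \<delta>_sq dis])
  qed
  also have "\<dots> = V k"
    using gsq_integrable[of k] consensus_integrable[of k]
    by (simp add: V_def gsq_def ce_def prob_space)
  finally show ?thesis .
qed

lemma X_update: "i < n \<Longrightarrow> j < p \<Longrightarrow>
    X (Suc k) \<omega> i j = X k \<omega> i j - \<gamma> * (\<Sum>m<n. laplacian n a $$ (i, m) * X k \<omega> m j) - \<eta> * g i k \<omega> j"
  unfolding X_Suc by simp

abbreviation "mixing \<equiv> \<gamma> * rho2 (laplacian n a)"

lemma mixing_pos: "0 < mixing" using step_size(1)[OF n graph \<gamma>] \<gamma> by simp

lemma consensus_recursion: "ce (Suc k) \<le> (1 - mixing / 2) * ce k + (1 + 1 / mixing) * \<eta>\<^sup>2 * V k"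
proof -
  have "ce (Suc k) \<le> (\<integral>\<omega>. (1 - mixing / 2) * consensus_error n p (X k \<omega>) + (1 + 1 / mixing) * \<eta>\<^sup>2 * ((\<Sum>i<n. \<Sum>j<p. (g i k \<omega> j)\<^sup>2) / real n) \<partial>M)"
    unfolding ce_def
  proof (rule integral_mono[OF consensus_integrable])
    show "integrable M (\<lambda>\<omega>. (1 - mixing / 2) * consensus_error n p (X k \<omega>) + (1 + 1 / mixing) * \<eta>\<^sup>2 * ((\<Sum>i<n. \<Sum>j<p. (g i k \<omega> j)\<^sup>2) / real n))"
      by (intro Bochner_Integration.integrable_add integrable_mult_right integrable_divide consensus_integrable Bochner_Integration.integrable_sum[of "{..<n}"] g_square_sum) auto
    fix \<omega>
    show "consensus_error n p (X (Suc k) \<omega>) \<le> (1 - mixing / 2) * consensus_error n p (X k \<omega>) + (1 + 1 / mixing) * \<eta>\<^sup>2 * ((\<Sum>i<n. \<Sum>j<p. (g i k \<omega> j)\<^sup>2) / real n)"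
      by (rule consensus_error_update(1)[OF n graph \<gamma> X_update])
  qed
  also have "\<dots> = (1 - mixing / 2) * ce k + (1 + 1 / mixing) * \<eta>\<^sup>2 * ((\<Sum>i<n. \<integral>\<omega>. (\<Sum>j<p. (g i k \<omega> j)\<^sup>2) \<partial>M) / real n)"
  proof -
    have 1: "integrable M (\<lambda>\<omega>. (\<Sum>i<n. \<Sum>j<p. (g i k \<omega> j)\<^sup>2))"
      by (rule Bochner_Integration.integrable_sum) (auto intro: g_square_sum)
    have 2: "(\<integral>\<omega>. (\<Sum>i<n. \<Sum>j<p. (g i k \<omega> j)\<^sup>2) \<partial>M) = (\<Sum>i<n. \<integral>\<omega>. (\<Sum>j<p. (g i k \<omega> j)\<^sup>2) \<partial>M)"
      by (rule Bochner_Integration.integral_sum) (auto intro: g_square_sum)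
    show ?thesis
      unfolding 2[symmetric] ce_def
      by (subst Bochner_Integration.integral_add)
         (auto intro!: integrable_mult_right integrable_divide consensus_integrable 1)
  qed
  also have "\<dots> \<le> (1 - mixing / 2) * ce k + (1 + 1 / mixing) * \<eta>\<^sup>2 * V k"
    using second_moment_le_V mixing_pos by (intro add_left_mono mult_left_mono) auto
  finally show ?thesis .
qed

text \<open>The order of the estimates matters. The centred part drops out of the linear term and
  enters the quadratic one with \<open>V k / n\<close>; the predictable part is kept inside the
  expectation until \<open>descent_inner\<close> absorbs its square, and then only its distance to
  the gradient remains, which splits into consensus error and bias.\<close>

lemma gap_recursion:
  "gap (Suc k) \<le> gap k - \<eta> / 2 * gsq k + \<eta> * Lf\<^sup>2 * ce k + Lf * \<eta>\<^sup>2 / (2 * n) * V k + \<eta> * p * Lf\<^sup>2 * D k / 4"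
proof -
  let ?d = "\<lambda>\<omega> j. grad p f (xb k \<omega>) j"
  have gb: "integrable M (\<lambda>\<omega>. ?d \<omega> j * gm k \<omega> j)" "integrable M (\<lambda>\<omega>. (gm k \<omega> j)\<^sup>2)"
     "integrable M (\<lambda>\<omega>. ?d \<omega> j * bm k \<omega> j)" "integrable M (\<lambda>\<omega>. (bm k \<omega> j)\<^sup>2)" if "j < p" for j
    using that by (auto intro!: square_integrable_mult_integrable square_integrable_sq grad_xb_square_integrable gm_square_integrable bm_square_integrable)
  have e1: "(\<integral>\<omega>. ?d \<omega> j * gm k \<omega> j \<partial>M) = (\<integral>\<omega>. ?d \<omega> j * bm k \<omega> j \<partial>M)" if j: "j < p" for j
  proof -
    have "(\<integral>\<omega>. ?d \<omega> j * gm k \<omega> j \<partial>M) = (\<integral>\<omega>. ?d \<omega> j * bm k \<omega> j \<partial>M) + (\<integral>\<omega>. ?d \<omega> j * zm k \<omega> j \<partial>M)"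
      unfolding gm_split distrib_left using j
      by (intro Bochner_Integration.integral_add square_integrable_mult_integrable grad_xb_square_integrable bm_square_integrable zm_square_integrable)
    then show ?thesis using deviation_orthogonal[OF grad_xb_past[OF j] grad_xb_square_integrable[OF j] j] by simp
  qed
  have e2: "(\<integral>\<omega>. (gm k \<omega> j)\<^sup>2 \<partial>M) \<le> (\<integral>\<omega>. (bm k \<omega> j)\<^sup>2 \<partial>M) + (\<Sum>i<n. \<integral>\<omega>. (g i k \<omega> j)\<^sup>2 \<partial>M) / (real n)\<^sup>2" if j: "j < p" for j
  proof -
    note b = bm_square_integrable[OF j, of k] and z = zm_square_integrable[OF j, of k]
    have eq: "(gm k \<omega> j)\<^sup>2 = (bm k \<omega> j)\<^sup>2 + (zm k \<omega> j)\<^sup>2 + 2 * (bm k \<omega> j * zm k \<omega> j)" for \<omega>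
      by (simp add: gm_split power2_eq_square algebra_simps)
    have "(\<integral>\<omega>. (gm k \<omega> j)\<^sup>2 \<partial>M) = (\<integral>\<omega>. (bm k \<omega> j)\<^sup>2 \<partial>M) + (\<integral>\<omega>. (zm k \<omega> j)\<^sup>2 \<partial>M) + 2 * (\<integral>\<omega>. bm k \<omega> j * zm k \<omega> j \<partial>M)"
      unfolding eq using square_integrable_sq[OF z] square_integrable_sq[OF b] square_integrable_mult_integrable[OF b z]
      by (subst Bochner_Integration.integral_add, (auto intro!: Bochner_Integration.integrable_add)[2],
        subst Bochner_Integration.integral_add) auto
    then show ?thesis
      using deviation_orthogonal[OF bm_past[OF j] b j] mean_deviation_square[OF j, of k] by simp
  qed
  have "gap (Suc k) \<le> (\<integral>\<omega>. (f (xb k \<omega>) - min_value p f) - \<eta> * (\<Sum>j<p. ?d \<omega> j * gm k \<omega> j) + Lf * \<eta>\<^sup>2 / 2 * (\<Sum>j<p. (gm k \<omega> j)\<^sup>2) \<partial>M)"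
    unfolding gap_def
  proof (rule integral_mono)
    show "integrable M (\<lambda>\<omega>. f (xb (Suc k) \<omega>) - min_value p f)"
      by (intro Bochner_Integration.integrable_diff f_xb_integrable) simp
    show "integrable M (\<lambda>\<omega>. (f (xb k \<omega>) - min_value p f) - \<eta> * (\<Sum>j<p. ?d \<omega> j * gm k \<omega> j) + Lf * \<eta>\<^sup>2 / 2 * (\<Sum>j<p. (gm k \<omega> j)\<^sup>2))"
      using gb by (intro Bochner_Integration.integrable_add Bochner_Integration.integrable_diff integrable_mult_right Bochner_Integration.integrable_sum f_xb_integrable) auto
    fix \<omega>
    have "xb (Suc k) \<omega> = move p (xb k \<omega>) 1 (\<lambda>j. - \<eta> * gm k \<omega> j)"
      unfolding gm_def by (rule consensus_error_update(2)[OF n graph \<gamma> X_update])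
    then show "f (xb (Suc k) \<omega>) - min_value p f \<le> (f (xb k \<omega>) - min_value p f) - \<eta> * (\<Sum>j<p. ?d \<omega> j * gm k \<omega> j) + Lf * \<eta>\<^sup>2 / 2 * (\<Sum>j<p. (gm k \<omega> j)\<^sup>2)"
      using descent_step[OF n less_imp_le[OF Lf] fi_smooth f_eq average_Rn less_imp_le[OF \<eta>(1)], of n "X k \<omega>" "gm k \<omega>"] by simp
  qed
  also have "\<dots> = gap k - \<eta> * (\<Sum>j<p. \<integral>\<omega>. ?d \<omega> j * gm k \<omega> j \<partial>M) + Lf * \<eta>\<^sup>2 / 2 * (\<Sum>j<p. \<integral>\<omega>. (gm k \<omega> j)\<^sup>2 \<partial>M)"
  proof -
    have 1: "integrable M (\<lambda>\<omega>. f (xb k \<omega>) - min_value p f)"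
      by (intro Bochner_Integration.integrable_diff f_xb_integrable) simp
    have 2: "integrable M (\<lambda>\<omega>. \<eta> * (\<Sum>j<p. ?d \<omega> j * gm k \<omega> j))" "integrable M (\<lambda>\<omega>. Lf * \<eta>\<^sup>2 / 2 * (\<Sum>j<p. (gm k \<omega> j)\<^sup>2))"
      using gb by (auto intro!: integrable_mult_right Bochner_Integration.integrable_sum)
    show ?thesis
      using gb unfolding gap_def Bochner_Integration.integral_add[OF Bochner_Integration.integrable_diff[OF 1 2(1)] 2(2)]
        Bochner_Integration.integral_diff[OF 1 2(1)]
      by (simp add: Bochner_Integration.integral_sum)
  qed
  also have "\<dots> \<le> gap k - \<eta> * (\<Sum>j<p. \<integral>\<omega>. ?d \<omega> j * bm k \<omega> j \<partial>M) + Lf * \<eta>\<^sup>2 / 2 * (\<Sum>j<p. (\<integral>\<omega>. (bm k \<omega> j)\<^sup>2 \<partial>M) + (\<Sum>i<n. \<integral>\<omega>. (g i k \<omega> j)\<^sup>2 \<partial>M) / (real n)\<^sup>2)"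
    using e1 e2 Lf by (intro add_mono mult_left_mono sum_mono) auto
  also have "\<dots> = gap k + (\<integral>\<omega>. - \<eta> * (\<Sum>j<p. ?d \<omega> j * bm k \<omega> j) + Lf * \<eta>\<^sup>2 / 2 * (\<Sum>j<p. (bm k \<omega> j)\<^sup>2) \<partial>M)
      + Lf * \<eta>\<^sup>2 / 2 * ((\<Sum>j<p. \<Sum>i<n. \<integral>\<omega>. (g i k \<omega> j)\<^sup>2 \<partial>M) / (real n)\<^sup>2)"
  proof -
    have "(\<integral>\<omega>. - \<eta> * (\<Sum>j<p. ?d \<omega> j * bm k \<omega> j) + Lf * \<eta>\<^sup>2 / 2 * (\<Sum>j<p. (bm k \<omega> j)\<^sup>2) \<partial>M)
      = - \<eta> * (\<Sum>j<p. \<integral>\<omega>. ?d \<omega> j * bm k \<omega> j \<partial>M) + Lf * \<eta>\<^sup>2 / 2 * (\<Sum>j<p. \<integral>\<omega>. (bm k \<omega> j)\<^sup>2 \<partial>M)"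
      using gb by (subst Bochner_Integration.integral_add)
        (auto intro!: Bochner_Integration.integrable_sum integrable_mult_right simp: Bochner_Integration.integral_sum)
    then show ?thesis by (simp add: sum.distrib distrib_left flip: sum_divide_distrib)
  qed
  also have "(\<integral>\<omega>. - \<eta> * (\<Sum>j<p. ?d \<omega> j * bm k \<omega> j) + Lf * \<eta>\<^sup>2 / 2 * (\<Sum>j<p. (bm k \<omega> j)\<^sup>2) \<partial>M)
     \<le> (\<integral>\<omega>. - (\<eta> / 2) * (vnorm p (grad p f (xb k \<omega>)))\<^sup>2 + \<eta> / 2 * (2 * Lf\<^sup>2 * consensus_error n p (X k \<omega>) + real p * Lf\<^sup>2 * D k / 2) \<partial>M)"
  proof (rule integral_mono)
    show "integrable M (\<lambda>\<omega>. - \<eta> * (\<Sum>j<p. ?d \<omega> j * bm k \<omega> j) + Lf * \<eta>\<^sup>2 / 2 * (\<Sum>j<p. (bm k \<omega> j)\<^sup>2))"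
      using gb by (intro Bochner_Integration.integrable_add integrable_mult_right Bochner_Integration.integrable_sum) auto
    show "integrable M (\<lambda>\<omega>. - (\<eta> / 2) * (vnorm p (grad p f (xb k \<omega>)))\<^sup>2 + \<eta> / 2 * (2 * Lf\<^sup>2 * consensus_error n p (X k \<omega>) + real p * Lf\<^sup>2 * D k / 2))"
      by (intro Bochner_Integration.integrable_add integrable_mult_right gsq_integrable consensus_integrable) auto
    fix \<omega>
    have b: "(vnorm p (vdiff p (b i k \<omega>) (grad p (fi i) (X k \<omega> i))))\<^sup>2 \<le> real p * Lf\<^sup>2 * D k / 4" if i: "i < n" for i
    proof -
      have "(vnorm p (vdiff p (b i k \<omega>) (grad p (fi i) (X k \<omega> i))))\<^sup>2 \<le> (sqrt p * (Lf * \<delta> i k / 2))\<^sup>2"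
        by (intro power_mono b_bias i) simp
      also have "\<dots> = real p * Lf\<^sup>2 / 4 * (\<delta> i k)\<^sup>2" by (simp add: power_mult_distrib power_divide)
      also have "\<dots> \<le> real p * Lf\<^sup>2 / 4 * D k" by (intro mult_left_mono \<delta>_sq i) simp
      finally show ?thesis by simp
    qed
    have "- \<eta> * (\<Sum>j<p. ?d \<omega> j * bm k \<omega> j) + Lf * \<eta>\<^sup>2 / 2 * (\<Sum>j<p. (bm k \<omega> j)\<^sup>2)
       \<le> - (\<eta> / 2) * (\<Sum>j<p. (?d \<omega> j)\<^sup>2) + \<eta> / 2 * (\<Sum>j<p. (bm k \<omega> j - ?d \<omega> j)\<^sup>2)"
      by (rule descent_inner) (use \<eta> in auto)
    also have "(\<Sum>j<p. (bm k \<omega> j - ?d \<omega> j)\<^sup>2) \<le> 2 * Lf\<^sup>2 * consensus_error n p (X k \<omega>) + real p * Lf\<^sup>2 * D k / 2"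
      unfolding bm_def
      by (rule mean_gradient_error[OF n less_imp_le[OF Lf] fi_smooth f_eq X_Rn D_nonneg b])
    finally show "- \<eta> * (\<Sum>j<p. ?d \<omega> j * bm k \<omega> j) + Lf * \<eta>\<^sup>2 / 2 * (\<Sum>j<p. (bm k \<omega> j)\<^sup>2)
        \<le> - (\<eta> / 2) * (vnorm p (grad p f (xb k \<omega>)))\<^sup>2 + \<eta> / 2 * (2 * Lf\<^sup>2 * consensus_error n p (X k \<omega>) + real p * Lf\<^sup>2 * D k / 2)"
      using \<eta> by (simp add: vnorm_sq)
  qed
  also have "\<dots> = - (\<eta> / 2) * gsq k + \<eta> / 2 * (2 * Lf\<^sup>2 * ce k + real p * Lf\<^sup>2 * D k / 2)"
    using gsq_integrable[of k] consensus_integrable[of k] by (simp add: gsq_def ce_def prob_space)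
  \<comment> \<open>One of the two factors 1/n averages the agents into \<open>V k\<close>, the
    other is the gain from their independence.\<close>
  also have "(\<Sum>j<p. \<Sum>i<n. \<integral>\<omega>. (g i k \<omega> j)\<^sup>2 \<partial>M) / (real n)\<^sup>2 \<le> V k / n"
  proof -
    have "(\<Sum>j<p. \<Sum>i<n. \<integral>\<omega>. (g i k \<omega> j)\<^sup>2 \<partial>M) = (\<Sum>i<n. \<Sum>j<p. \<integral>\<omega>. (g i k \<omega> j)\<^sup>2 \<partial>M)" by (rule sum.swap)
    also have "\<dots> = (\<Sum>i<n. \<integral>\<omega>. (\<Sum>j<p. (g i k \<omega> j)\<^sup>2) \<partial>M)"
      by (intro sum.cong[OF refl] Bochner_Integration.integral_sum[symmetric]) (auto intro: square_integrable_sq g_square_integrable)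
    finally have "(\<Sum>j<p. \<Sum>i<n. \<integral>\<omega>. (g i k \<omega> j)\<^sup>2 \<partial>M) / (real n)\<^sup>2 = ((\<Sum>i<n. \<integral>\<omega>. (\<Sum>j<p. (g i k \<omega> j)\<^sup>2) \<partial>M) / real n) / real n"
      by (simp add: power2_eq_square)
    then show ?thesis using divide_right_mono[OF second_moment_le_V[of k], of "real n"] by simp
  qed
  finally have "gap (Suc k) \<le> gap k + (- (\<eta> / 2) * gsq k + \<eta> / 2 * (2 * Lf\<^sup>2 * ce k + real p * Lf\<^sup>2 * D k / 2)) + Lf * \<eta>\<^sup>2 / 2 * (V k / n)"
    using Lf by (simp add: mult_left_mono)
  then show ?thesis by (simp add: algebra_simps)
qed

lemma gsq_le_gap: "gsq k \<le> 2 * Lf * gap k"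
proof -
  have "gsq k \<le> (\<integral>\<omega>. 2 * Lf * (f (xb k \<omega>) - min_value p f) \<partial>M)"
    unfolding gsq_def
    by (intro integral_mono gsq_integrable integrable_mult_right Bochner_Integration.integrable_diff f_xb_integrable
        gradient_le_gap f_smooth Lf bdd average_Rn) simp
  then show ?thesis by (simp add: gap_def)
qed

end

section \<open>Passage from the process to the scalar recursions\<close>

theorem theorem12:
  fixes Lf \<sigma>\<^sub>0 \<sigma>\<^sub>1 \<sigma>t\<^sub>0 \<sigma>\<^sub>2 \<nu> \<gamma> \<kappa> \<epsilon>t r r\<^sub>2 B\<^sub>0 B\<^sub>1 :: real
  assumes "Lf > 0" and "\<nu> > 0" and "\<kappa> > 0" and "0 < \<epsilon>t" and "\<epsilon>t < 1"
  shows "\<exists>C>0. \<forall>(n::nat) (p::nat) E a (\<Xi> :: nat \<Rightarrow> 'b measure) F (M :: 'w measure) u \<xi> x0 \<delta> \<eta>.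
    let L = laplacian n a;
        f = global_cost n \<Xi> F;
        X = zo_iterate n p L \<gamma> (\<lambda>k. \<eta>) \<delta> F u \<xi> x0;
        s = \<sigma>\<^sub>1\<^sup>2 + 2 * (1 + \<sigma>\<^sub>0\<^sup>2) * \<sigma>\<^sub>2\<^sup>2
    in
      n \<ge> 1 \<and> p \<ge> 1 \<and>
      weighted_graph n E a \<and> connected_graph n E \<and> rho L = r \<and> rho2 L = r\<^sub>2 \<and>
      stochastic_costs n p \<Xi> F \<and>
      minimizers p f \<noteq> {} \<and> bdd_below (f ` Rn p) \<and>
      (\<forall>i<n. AE z in \<Xi> i. lipschitz_grad p Lf (\<lambda>x. F i x z)) \<and>
      gradient_noise n p \<Xi> F \<sigma>\<^sub>0 \<sigma>\<^sub>1 \<and>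
      gradient_dissimilarity n p \<Xi> F \<sigma>t\<^sub>0 \<sigma>\<^sub>2 \<and>
      zo_sampling M n p \<Xi> u \<xi> \<and>
      (\<forall>i<n. x0 i \<in> Rn p) \<and>
      consensus_error n p x0 \<le> B\<^sub>0 \<and> f (average n p x0) - min_value p f \<le> B\<^sub>1 \<and>
      0 < \<gamma> \<and> \<gamma> < const_d1 L \<and>
      0 < \<eta> \<and> \<eta> \<le> const_d2 \<gamma> L p Lf \<sigma>\<^sub>0 \<sigma>t\<^sub>0 \<and>
      (\<forall>i<n. \<forall>k. 0 < \<delta> i k \<and> \<delta> i k \<le> \<kappa> * \<epsilon>t ^ k)
    \<longrightarrow>
      (\<forall>k. integrable M (\<lambda>\<omega>. consensus_error n p (X k \<omega>)) \<and>
           integrable M (\<lambda>\<omega>. (vnorm p (grad p f (average n p (X k \<omega>))))\<^sup>2)) \<and>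
      (\<forall>T::nat. T \<ge> 1 \<longrightarrow>
        (1 / real T) * (\<Sum>k<T. \<integral>\<omega>. consensus_error n p (X k \<omega>) \<partial>M)
          \<le> C * (1 / real T + s * real p * \<eta>\<^sup>2)) \<and>
      (\<forall>T::nat. T \<ge> 1 \<and> real T \<ge> C * ln (1 / (real p * \<eta>\<^sup>2)) \<longrightarrow>
        (\<integral>\<omega>. consensus_error n p (X T \<omega>) \<partial>M)
          \<le> C * (real p * \<eta>\<^sup>2 + s * (real p)\<^sup>2 * \<eta> ^ 4 * (1 / real n + \<eta>) * real T)) \<and>
      (\<forall>T::nat. T \<ge> 1 \<longrightarrow>
        (1 / real T) * (\<Sum>k<T. \<integral>\<omega>. (vnorm p (grad p f (average n p (X k \<omega>))))\<^sup>2 \<partial>M)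
          \<le> C * (1 / (\<eta> * real T) + s * (real p * \<eta> / real n + real p * \<eta>\<^sup>2))) \<and>
      (polyak_lojasiewicz p \<nu> f \<longrightarrow>
        0 < rate \<gamma> L \<nu> \<eta> \<epsilon>t \<and> rate \<gamma> L \<nu> \<eta> \<epsilon>t < 1 \<and>
        (\<forall>k::nat. k \<ge> 1 \<longrightarrow>
          integrable M (\<lambda>\<omega>. consensus_error n p (X k \<omega>)
                              + f (average n p (X k \<omega>)) - min_value p f) \<and>
          (\<integral>\<omega>. (consensus_error n p (X k \<omega>)
                  + f (average n p (X k \<omega>)) - min_value p f) \<partial>M)
            \<le> C * (rate \<gamma> L \<nu> \<eta> \<epsilon>t ^ k + s * real p * \<eta>)))"
proof -
  let ?P = "1 + \<sigma>\<^sub>0\<^sup>2" and ?A = "(1 + \<sigma>\<^sub>0\<^sup>2) * (1 + \<sigma>t\<^sub>0\<^sup>2)" and ?s = "\<sigma>\<^sub>1\<^sup>2 + 2 * (1 + \<sigma>\<^sub>0\<^sup>2) * \<sigma>\<^sub>2\<^sup>2"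
  \<comment> \<open>\<open>rho2\<close> enters through the fixed number \<open>r\<^sub>2\<close>, so
    the constant is determined before the graph is chosen.\<close>
  let ?C = "zo_const Lf (\<gamma> * r\<^sub>2) ?A ?s \<kappa> \<epsilon>t B\<^sub>0 B\<^sub>1 \<nu>"
  show ?thesis
  proof (rule exI[of _ ?C], rule conjI[OF zo_const_pos], unfold Let_def, intro allI impI, goal_cases)
    case (1 n p E a \<Xi> F M u \<xi> x0 \<delta> \<eta>)
    let ?L = "laplacian n a" and ?f = "global_cost n \<Xi> F"
    let ?X = "zo_iterate n p ?L \<gamma> (\<lambda>k. \<eta>) \<delta> F u \<xi> x0"
    from 1 have n: "n \<ge> 1" and p: "p \<ge> 1" and graph: "weighted_graph n E a" "connected_graph n E"
      and r2: "rho2 ?L = r\<^sub>2" and costs: "stochastic_costs n p \<Xi> F" and bdd: "bdd_below (?f ` Rn p)"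
      and smooth: "\<forall>i<n. AE z in \<Xi> i. lipschitz_grad p Lf (\<lambda>x. F i x z)"
      and noise: "gradient_noise n p \<Xi> F \<sigma>\<^sub>0 \<sigma>\<^sub>1" and dis: "gradient_dissimilarity n p \<Xi> F \<sigma>t\<^sub>0 \<sigma>\<^sub>2"
      and sampling: "zo_sampling M n p \<Xi> u \<xi>" and x0: "\<forall>i<n. x0 i \<in> Rn p"
      and init: "consensus_error n p x0 \<le> B\<^sub>0" "?f (average n p x0) - min_value p ?f \<le> B\<^sub>1"
      and \<gamma>: "0 < \<gamma>" "\<gamma> < const_d1 ?L"
      and \<eta>: "0 < \<eta>" "\<eta> \<le> const_d2 \<gamma> ?L p Lf \<sigma>\<^sub>0 \<sigma>t\<^sub>0"
      and \<delta>: "\<forall>i<n. \<forall>k. 0 < \<delta> i k \<and> \<delta> i k \<le> \<kappa> * \<epsilon>t ^ k"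
      by - (elim conjE, assumption)+
    note ss = step_size[OF n graph \<gamma>, unfolded r2]
    have a_pos: "0 < \<gamma> * r\<^sub>2" using \<gamma>(1) ss(1) by simp
    have "?P * 1 \<le> ?A" by (intro mult_left_mono) auto
    then have A: "1 \<le> ?P" "?P \<le> ?A" by (simp, simp only: mult_1_right)
    have eps1: "0 < eps1 \<gamma> ?L" "eps1 \<gamma> ?L \<le> \<gamma> * r\<^sub>2 / 2"
    proof -
      have "\<gamma> * (2 * \<gamma> * rho (?L * ?L)) < \<gamma> * r\<^sub>2" using ss(2) \<gamma>(1) by (rule mult_strict_left_mono)
      then show "0 < eps1 \<gamma> ?L" by (simp add: eps1_def r2 power2_eq_square)
      show "eps1 \<gamma> ?L \<le> \<gamma> * r\<^sub>2 / 2" using ss(3) by (simp add: eps1_def r2)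
    qed
    have eta1: "9 * Lf\<^sup>2 * \<eta> \<le> 4 * eps1 \<gamma> ?L"
    proof -
      have "\<eta> \<le> 4 * eps1 \<gamma> ?L / (9 * Lf\<^sup>2)" using \<eta>(2) by (simp add: const_d2_def)
      then show ?thesis using \<open>Lf > 0\<close> by (simp add: pos_le_divide_eq mult.commute)
    qed
    \<comment> \<open>This identifies the second entry of \<open>const_d2\<close> with the
      assumption \<open>eta2\<close> of the scalar locale, for \<open>a\<close> equal to
      \<open>\<gamma> * r\<^sub>2\<close>.\<close>
    have Q: "2 * eps2 \<gamma> ?L + Lf = 2 + 1 / (\<gamma> * r\<^sub>2) + Lf"
      using \<gamma>(1) ss(1) by (simp add: eps2_def r2 field_simps)
    have Q_pos: "0 < 2 + 1 / (\<gamma> * r\<^sub>2) + Lf" using a_pos \<open>Lf > 0\<close> by (simp add: add_pos_pos)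
    have eta2: "64 * p * ?A * (2 + 1 / (\<gamma> * r\<^sub>2) + Lf) * \<eta> \<le> 1"
    proof -
      have "0 < 64 * p * ?A * (2 + 1 / (\<gamma> * r\<^sub>2) + Lf)" using p Q_pos a_pos \<open>Lf > 0\<close> by (intro mult_pos_pos add_pos_nonneg) auto
      moreover have "\<eta> \<le> 1 / (64 * p * ?A * (2 + 1 / (\<gamma> * r\<^sub>2) + Lf))"
        using \<eta>(2) unfolding const_d2_def Q by (simp add: mult.assoc)
      ultimately show ?thesis by (simp add: pos_le_divide_eq mult.commute)
    qed
    have eta3: "Lf * \<eta> \<le> 1"
    proof -
      \<comment> \<open>The factors 64 p and \<open>?A\<close> are at least 1 and the parenthesis is
        at least \<open>Lf\<close>, so the bound is contained in \<open>eta2\<close>.\<close>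
      have "1 * 1 * Lf * \<eta> \<le> (64 * p) * ?A * (2 + 1 / (\<gamma> * r\<^sub>2) + Lf) * \<eta>"
        using p order_trans[OF A] a_pos \<open>Lf > 0\<close> \<eta>(1) by (intro mult_mono mult_right_mono) auto
      then show ?thesis using eta2 by simp
    qed
    interpret Z: zo_run M n p \<Xi> u \<xi> E a F x0 \<delta> \<eta> \<gamma> Lf \<sigma>\<^sub>0 \<sigma>\<^sub>1 \<sigma>t\<^sub>0 \<sigma>\<^sub>2 \<kappa> \<epsilon>t
    proof (intro zo_run.intro zo_noise.intro zo_run_axioms.intro)
      show "\<And>i. i < n \<Longrightarrow> prob_space (\<Xi> i)" using costs unfolding stochastic_costs_def by blast
      show "\<And>i. i < n \<Longrightarrow> AE z in \<Xi> i. lipschitz_grad p Lf (\<lambda>x. F i x z)" using smooth by blast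
      show "\<And>i. i < n \<Longrightarrow> x0 i \<in> Rn p" using x0 by blast
      show "\<And>i k. i < n \<Longrightarrow> 0 < \<delta> i k" "\<And>i k. i < n \<Longrightarrow> \<delta> i k \<le> \<kappa> * \<epsilon>t ^ k" using \<delta> by blast+
    qed (fact sampling p n graph assms costs bdd noise dis \<gamma> \<eta>(1) eta3)+
    interpret R: zo_recursion n p Lf "\<gamma> * r\<^sub>2" ?P ?A ?s \<kappa> \<epsilon>t \<eta> "eps1 \<gamma> ?L" B\<^sub>0 B\<^sub>1 Z.ce Z.gap Z.gsq
    proof (rule zo_recursion.intro)
      show "0 \<le> ?s" by simp
      show "\<And>k. 0 \<le> Z.ce k" unfolding Z.ce_def by (rule Bochner_Integration.integral_nonneg) (rule consensus_error_nonneg)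
      show "\<And>k. 0 \<le> Z.gap k" unfolding Z.gap_def by (rule Bochner_Integration.integral_nonneg) (rule Z.gap_nonneg)
      show "\<And>k. 0 \<le> Z.gsq k" unfolding Z.gsq_def by (rule Bochner_Integration.integral_nonneg) simp
      show "Z.ce 0 \<le> B\<^sub>0" "Z.gap 0 \<le> B\<^sub>1" using init by (simp_all add: Z.ce_def Z.gap_def Z.prob_space)
      show "Z.ce (Suc k) \<le> (1 - \<gamma> * r\<^sub>2 / 2) * Z.ce k + (1 + 1 / (\<gamma> * r\<^sub>2)) * \<eta>\<^sup>2 *
        (16 * p * ?A * Z.gsq k + 8 * p * ?s + 8 * p * ?P * Lf\<^sup>2 * Z.ce k + p\<^sup>2 * Lf\<^sup>2 * (\<kappa>\<^sup>2 * (\<epsilon>t\<^sup>2) ^ k) / 2)" for k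
        using Z.consensus_recursion[of k] by (simp only: Z.V_def Z.D_def r2)
      show "Z.gap (Suc k) \<le> Z.gap k - \<eta> / 2 * Z.gsq k + \<eta> * Lf\<^sup>2 * Z.ce k + Lf * \<eta>\<^sup>2 / (2 * n) *
        (16 * p * ?A * Z.gsq k + 8 * p * ?s + 8 * p * ?P * Lf\<^sup>2 * Z.ce k + p\<^sup>2 * Lf\<^sup>2 * (\<kappa>\<^sup>2 * (\<epsilon>t\<^sup>2) ^ k) / 2)
        + \<eta> * p * Lf\<^sup>2 * (\<kappa>\<^sup>2 * (\<epsilon>t\<^sup>2) ^ k) / 4" for k
        using Z.gap_recursion[of k] by (simp only: Z.V_def Z.D_def)
    qed (fact n p assms a_pos A eps1 eta1 eta2 \<eta>(1) Z.gsq_le_gap)+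
    have PL: "2 * \<nu> * Z.gap k \<le> Z.gsq k" if "polyak_lojasiewicz p \<nu> ?f" for k
    proof -
      have "2 * \<nu> * (?f (average n p (?X k \<omega>)) - min_value p ?f) \<le> (vnorm p (grad p ?f (average n p (?X k \<omega>))))\<^sup>2" for \<omega>
      proof -
        have "\<nu> * (?f (average n p (?X k \<omega>)) - min_value p ?f) \<le> 1/2 * (vnorm p (grad p ?f (average n p (?X k \<omega>))))\<^sup>2"
          using that average_Rn[of n p "?X k \<omega>"] unfolding polyak_lojasiewicz_def by blast
        then show ?thesis by simp
      qed
      then have "(\<integral>\<omega>. 2 * \<nu> * (?f (average n p (?X k \<omega>)) - min_value p ?f) \<partial>M) \<le> Z.gsq k"
        unfolding Z.gsq_def
        by (intro integral_mono Z.gsq_integrable integrable_mult_right Bochner_Integration.integrable_diff Z.f_xb_integrable) auto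
      then show ?thesis by (simp add: Z.gap_def)
    qed
    have gap_int: "integrable M (\<lambda>\<omega>. ?f (average n p (?X k \<omega>)) - min_value p ?f)" for k
      by (intro Bochner_Integration.integrable_diff Z.f_xb_integrable) simp
    show ?case
    proof (intro conjI allI impI, goal_cases)
      case (1 k)
      show ?case by (rule Z.consensus_integrable)
    next
      case (2 k)
      show ?case by (rule Z.gsq_integrable)
    next
      case (3 T)
      then show ?case using R.zo_bounds(1)[of T \<nu>] by (simp only: Z.ce_def)
    next
      case (4 T)
      then have "1 \<le> T" "?C * ln (1 / (real p * \<eta>\<^sup>2)) \<le> real T" by blast+
      from R.zo_bounds(2)[OF this] show ?case by (simp only: Z.ce_def)
    next
      case (5 T)
      then show ?case using R.zo_bounds(3)[of T \<nu>] by (simp only: Z.gsq_def)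
    next
      case 6
      show ?case unfolding rate_def eps8_def by (rule R.linear_rate(1)[OF \<open>\<nu> > 0\<close> PL[OF 6]])
    next
      case 7
      show ?case unfolding rate_def eps8_def by (rule R.linear_rate(2)[OF \<open>\<nu> > 0\<close> PL[OF 7]])
    next
      case (8 k)
      show ?case
        using Bochner_Integration.integrable_add[OF Z.consensus_integrable gap_int, of k k] by (simp add: add_diff_eq)
    next
      case (9 k)
      have "(\<integral>\<omega>. (consensus_error n p (?X k \<omega>) + ?f (average n p (?X k \<omega>)) - min_value p ?f) \<partial>M) = Z.ce k + Z.gap k"
        unfolding Z.ce_def Z.gap_def add_diff_eq[symmetric]
        by (rule Bochner_Integration.integral_add[OF Z.consensus_integrable gap_int])
      then show ?case
        using R.zo_bounds(4)[OF \<open>\<nu> > 0\<close> PL[OF 9(1)], of k] unfolding rate_def eps8_def by (simp only:)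
    qed
  qed
qed

end
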